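(* Let $\mathfrak R=\{\mathbf r_1,\mathbf r_2\}$ be a non-involutive partial frame on an open neighborhood of $\bar u\in\mathbb R^3$, i.e. $[\mathbf r_1,\mathbf r_2]|_{\bar u}\notin\operatorname{span}_{\mathbb R}\{\mathbf r_1|_{\bar u},\mathbf r_2|_{\bar u}\}$, satisfying $$\tilde\nabla_{\mathbf r_1}\mathbf r_2|_{\bar u}\notin\operatorname{span}_{\mathbb R}\{\mathbf r_1|_{\bar u},\mathbf r_2|_{\bar u}\}\quad\text{and}\quad\tilde\nabla_{\mathbf r_2}\mathbf r_1|_{\bar u}\notin\operatorname{span}_{\mathbb R}\{\mathbf r_1|_{\bar u},\mathbf r_2|_{\bar u}\}.$$ Let $\mathbf s$ be any completion of $\mathbf r_1,\mathbf r_2$ to a local frame near $\bar u$, and let the $\Gamma$'s be the Christoffel symbols of $\tilde\nabla$ relative to this frame. Assume further that $$\Gamma^3_{22}(\bar u)\,\Gamma^3_{11}(\bar u)-9\,\Gamma^3_{12}(\bar u)\,\Gamma^3_{21}(\bar u)\ne0.$$ Then: 1) $0\le\dim\mathcal F(\mathfrak R)/\mathcal F^{\mathrm{triv}}\le4$. 2) For each $k=0,\dots,4$ there exists a partial frame $\mathfrak R=\{\mathbf r_1,\mathbf r_2\}$ on an open neighborhood of a point $\bar u\in\mathbb R^3$ such that none of the vectors $[\mathbf r_1,\mathbf r_2]|_{\bar u}$, $\tilde\nabla_{\mathbf r_1}\mathbf r_2|_{\bar u}$, $\tilde\nabla_{\mathbf r_2}\mathbf r_1|_{\bar u}$ lies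 in $\operatorname{span}_{\mathbb R}\{\mathbf r_1|_{\bar u},\mathbf r_2|_{\bar u}\}$, such that $\Gamma^3_{22}(\bar u)\,\Gamma^3_{11}(\bar u)-9\,\Gamma^3_{12}(\bar u)\,\Gamma^3_{21}(\bar u)\ne0$ (Christoffel symbols of $\tilde\nabla$ relative to a completion of $\mathbf r_1,\mathbf r_2$ to a local frame near $\bar u$), and such that $\dim\mathcal F(\mathfrak R)/\mathcal F^{\mathrm{triv}}=k$.
   Context: All objects are $C^\infty$-smooth. $\tilde\nabla$ is a flat symmetric connection near $\bar u\in\mathbb R^3$; concretely, $\tilde\nabla_{\partial/\partial u^i}\partial/\partial u^j=0$ for fixed (affine) coordinates $u^1,u^2,u^3$. A partial frame is a set of smooth vector fields linearly independent at every point. For a frame $(\mathbf r_1,\mathbf r_2,\mathbf r_3=\mathbf s)$ the Christoffel symbols are defined by $\tilde\nabla_{\mathbf r_i}\mathbf r_j=\sum_{k=1}^3\Gamma_{ij}^k\mathbf r_k$. $\mathcal F(\mathfrak R)$ is the real vector space of smooth vector fields $\mathbf f$ defined near $\bar u$ (two being identified if they agree near $\bar u$) for which there exist smooth functions $\lambda^1,\lambda^2$ near $\bar u$ with $\tilde\nabla_{\mathbf r_1}\mathbf f=\lambda^1\mathbf r_1$ and $\tilde\nabla_{\mathbf r_2}\mathbf f=\lambda^2\mathbf r_2$. $\mathcal F^{\mathrm{triv}}\subset\mathcal F(\mathfrak R)$ is the 4-dimensional space of trivial fluxes: those $\mathbf f$ for which there is a constant $\bar\lambda\in\mathbb R$ with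 $\tilde\nabla_{\mathbf r}\mathbf f=\bar\lambda\mathbf r$ for all vector fields $\mathbf r$; in affine coordinates $\mathbf f=\bar\lambda u+\bar a$, $\bar a\in\mathbb R^3$ constant. *)

theory Defs
  imports "HOL-Analysis.Analysis"
begin

text \<open>Smooth functions. Both predicates are meant for open sets only; there,
  continuity of all iterated directional derivatives is the usual notion of being
  continuously differentiable of order k.\<close>

primrec Ck_on :: "nat \<Rightarrow> 'a::real_normed_vector set \<Rightarrow> ('a \<Rightarrow> 'b::real_normed_vector) \<Rightarrow> bool" where
  "Ck_on 0 S f \<longleftrightarrow> continuous_on S f"
| "Ck_on (Suc k) S f \<longleftrightarrow> (\<forall>x\<in>S. f differentiable (at x)) \<and>
     (\<forall>v. Ck_on k S (\<lambda>x. frechet_derivative f (at x) v))"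

definition smooth_on :: "'a::real_normed_vector set \<Rightarrow> ('a \<Rightarrow> 'b::real_normed_vector) \<Rightarrow> bool" where
  "smooth_on S f \<longleftrightarrow> (\<forall>k. Ck_on k S f)"

definition smooth_near :: "'a::real_normed_vector \<Rightarrow> ('a \<Rightarrow> 'b::real_normed_vector) \<Rightarrow> bool" where
  "smooth_near p f \<longleftrightarrow> (\<exists>U. open U \<and> p \<in> U \<and> smooth_on U f)"


text \<open>Vector fields are total functions, written in the affine coordinates of the flat
  connection; a field defined on an open set only is given by any total extension.
  In these coordinates the covariant derivative of a field \<open>f\<close> along \<open>r\<close> is the
  directional derivative, because the coordinate fields are parallel.\<close>

type_synonym vfield = "real^3 \<Rightarrow> real^3"

definition nabla :: "vfield \<Rightarrow> vfield \<Rightarrow> vfield" where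
  "nabla r f = (\<lambda>u. frechet_derivative f (at u) (r u))"

definition lie_bracket :: "vfield \<Rightarrow> vfield \<Rightarrow> vfield" where
  "lie_bracket r s = (\<lambda>u. frechet_derivative s (at u) (r u) - frechet_derivative r (at u) (s u))"

definition partial_frame_on :: "(real^3) set \<Rightarrow> nat set \<Rightarrow> (nat \<Rightarrow> vfield) \<Rightarrow> bool" where
  "partial_frame_on U I r \<longleftrightarrow> (\<forall>i\<in>I. smooth_on U (r i)) \<and>
     (\<forall>u\<in>U. inj_on (\<lambda>i. r i u) I \<and> independent ((\<lambda>i. r i u) ` I))"

text \<open>\<open>christoffel r i j k\<close> is the symbol with lower indices \<open>i\<close>, \<open>j\<close> and upper index \<open>k\<close>
  relative to the frame \<open>r 1, r 2, r 3\<close>: the coefficient at \<open>r k\<close> of the covariant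
  derivative of \<open>r j\<close> along \<open>r i\<close>; see \<open>nabla_christoffel\<close> below.\<close>

definition christoffel :: "(nat \<Rightarrow> vfield) \<Rightarrow> nat \<Rightarrow> nat \<Rightarrow> nat \<Rightarrow> real^3 \<Rightarrow> real" where
  "christoffel r i j k u =
     representation ((\<lambda>l. r l u) ` {1..3}) (nabla (r i) (r j) u) (r k u)"

lemma nabla_christoffel:
  assumes fr: "partial_frame_on U {1..3} r" and u: "u \<in> U"
  shows "nabla (r i) (r j) u = (\<Sum>k=1..3. christoffel r i j k u *\<^sub>R r k u)"
proof -
  let ?B = "(\<lambda>l. r l u) ` {1..3}"
  have inj: "inj_on (\<lambda>l. r l u) {1..3}" and ind: "independent ?B"
    using fr u by (auto simp: partial_frame_on_def)
  have "card ?B = 3" using card_image[OF inj] by simp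
  then have "UNIV \<subseteq> span ?B"
    by (intro card_ge_dim_independent[OF _ ind]) simp_all
  then have "nabla (r i) (r j) u \<in> span ?B" by blast
  then have "(\<Sum>b\<in>?B. representation ?B (nabla (r i) (r j) u) b *\<^sub>R b) = nabla (r i) (r j) u"
    by (intro sum_representation_eq[OF ind]) auto
  then show ?thesis
    by (subst (asm) sum.reindex[OF inj]) (simp add: christoffel_def)
qed


text \<open>Germs of vector fields. The germ at an arbitrary point \<open>p\<close> is moved to the origin by
  a translation, so that the germs at all points share one real vector space type.\<close>

quotient_type vgerm = "real^3 \<Rightarrow> real^3" / "\<lambda>f g. eventually (\<lambda>x. f x = g x) (nhds 0)"
proof (intro equivpI reflpI sympI transpI)
  fix f g h :: vfield
  assume "eventually (\<lambda>x. f x = g x) (nhds 0)" "eventually (\<lambda>x. g x = h x) (nhds 0)"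
  then show "eventually (\<lambda>x. f x = h x) (nhds 0)" by eventually_elim simp
qed (auto elim: eventually_mono)

instantiation vgerm :: real_vector
begin

lift_definition zero_vgerm :: vgerm is "\<lambda>x. 0" .
lift_definition plus_vgerm :: "vgerm \<Rightarrow> vgerm \<Rightarrow> vgerm" is "\<lambda>f g x. f x + g x"
  by (auto elim: eventually_elim2)
lift_definition minus_vgerm :: "vgerm \<Rightarrow> vgerm \<Rightarrow> vgerm" is "\<lambda>f g x. f x - g x"
  by (auto elim: eventually_elim2)
lift_definition uminus_vgerm :: "vgerm \<Rightarrow> vgerm" is "\<lambda>f x. - f x"
  by (auto elim: eventually_mono)
lift_definition scaleR_vgerm :: "real \<Rightarrow> vgerm \<Rightarrow> vgerm" is "\<lambda>c f x. c *\<^sub>R f x"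
  by (auto elim: eventually_mono)

instance
  by (standard; transfer) (simp_all add: algebra_simps)

end

lift_definition germ :: "real^3 \<Rightarrow> vfield \<Rightarrow> vgerm" is "\<lambda>p f x. f (p + x)" .

lemma germ_eq_iff: "germ p f = germ p g \<longleftrightarrow> eventually (\<lambda>u. f u = g u) (nhds p)"
proof -
  have "germ p f = germ p g \<longleftrightarrow> eventually (\<lambda>x. f (p + x) = g (p + x)) (nhds 0)"
    by transfer simp
  also have "\<dots> \<longleftrightarrow> eventually (\<lambda>u. f u = g u) (filtermap ((+) p) (nhds 0))"
    by (simp add: eventually_filtermap)
  also have "(+) p = (\<lambda>x. x - (- p))"
    by (simp add: fun_eq_iff)
  also have "filtermap \<dots> (nhds 0) = nhds p"
    by (simp only: filtermap_nhds_shift) simp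
  finally show ?thesis .
qed

lemma germ_add: "germ p (\<lambda>u. f u + g u) = germ p f + germ p g"
  by transfer simp

lemma germ_scaleR: "germ p (\<lambda>u. c *\<^sub>R f u) = c *\<^sub>R germ p f"
  by transfer simp

definition fluxes :: "real^3 \<Rightarrow> (nat \<Rightarrow> vfield) \<Rightarrow> vgerm set" where
  "fluxes p r = germ p ` {f. smooth_near p f \<and>
     (\<forall>i\<in>{1,2}. \<exists>l::real^3 \<Rightarrow> real. smooth_near p l \<and>
        eventually (\<lambda>u. nabla (r i) f u = l u *\<^sub>R r i u) (nhds p))}"

definition trivial_fluxes :: "real^3 \<Rightarrow> vgerm set" where
  "trivial_fluxes p = germ p ` {f. smooth_near p f \<and>
     (\<exists>c::real. \<forall>r. smooth_near p r \<longrightarrow> eventually (\<lambda>u. nabla r f u = c *\<^sub>R r u) (nhds p))}"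


text \<open>\<open>quotient_dim V W n\<close>: the quotient of \<open>V\<close> by its subspace \<open>W\<close> is finite-dimensional of
  dimension \<open>n\<close>, i.e. there are \<open>n\<close> vectors in \<open>V\<close> whose cosets form a basis of the quotient.
  A relation is used instead of a number to keep infinite dimension apart from dimension 0.\<close>

definition quotient_dim :: "'a::real_vector set \<Rightarrow> 'a set \<Rightarrow> nat \<Rightarrow> bool" where
  "quotient_dim V W n \<longleftrightarrow> (\<exists>B. finite B \<and> card B = n \<and> B \<subseteq> V \<and>
     (\<forall>c. (\<Sum>b\<in>B. c b *\<^sub>R b) \<in> W \<longrightarrow> (\<forall>b\<in>B. c b = 0)) \<and>
     (\<forall>v\<in>V. \<exists>c. v - (\<Sum>b\<in>B. c b *\<^sub>R b) \<in> W))"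

lemma quotient_dim_le:
  assumes W: "subspace W" and m: "quotient_dim V W m" and n: "quotient_dim V W n"
  shows "m \<le> n"
proof -
  obtain B where B: "finite B" "card B = m" "B \<subseteq> V"
    and indB: "\<And>c. (\<Sum>b\<in>B. c b *\<^sub>R b) \<in> W \<Longrightarrow> \<forall>b\<in>B. c b = 0"
    using m by (auto simp: quotient_dim_def)
  obtain C where C: "finite C" "card C = n"
    and spC: "\<And>v. v \<in> V \<Longrightarrow> \<exists>c. v - (\<Sum>x\<in>C. c x *\<^sub>R x) \<in> W"
    using n by (auto simp: quotient_dim_def)
  obtain a where a: "\<And>b. b \<in> B \<Longrightarrow> b - (\<Sum>x\<in>C. a b x *\<^sub>R x) \<in> W"
    using spC B(3) by (metis subsetD)
  define q where "q b = (\<Sum>x\<in>C. a b x *\<^sub>R x)" for b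
  have key: "\<forall>b\<in>B. c b = 0" if "(\<Sum>b\<in>B. c b *\<^sub>R q b) = 0" for c
  proof (rule indB)
    have "(\<Sum>b\<in>B. c b *\<^sub>R b) = (\<Sum>b\<in>B. c b *\<^sub>R (b - q b))"
      using that by (simp add: algebra_simps sum_subtractf)
    also have "\<dots> \<in> W"
      using a by (intro subspace_sum[OF W] subspace_scale[OF W]) (simp add: q_def)
    finally show "(\<Sum>b\<in>B. c b *\<^sub>R b) \<in> W" .
  qed
  have inj: "inj_on q B"
  proof (rule inj_onI, rule ccontr)
    fix x y assume xy: "x \<in> B" "y \<in> B" "q x = q y" "x \<noteq> y"
    define c where "c b = (if b = x then 1 else if b = y then -1 else 0 :: real)" for b
    have "(\<Sum>b\<in>B. c b *\<^sub>R q b) = (\<Sum>b\<in>{x,y}. c b *\<^sub>R q b)"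
      using xy B(1) by (intro sum.mono_neutral_right) (auto simp: c_def)
    also have "\<dots> = 0" using xy by (simp add: c_def)
    finally show False using key[of c] xy by (auto simp: c_def)
  qed
  have "independent (q ` B)"
  proof (rule independent_if_scalars_zero)
    fix g y assume 0: "(\<Sum>z\<in>q ` B. g z *\<^sub>R z) = 0" and y: "y \<in> q ` B"
    have "(\<Sum>b\<in>B. g (q b) *\<^sub>R q b) = 0"
      using 0 by (simp add: sum.reindex[OF inj])
    then show "g y = 0" using key[of "\<lambda>b. g (q b)"] y by auto
  qed (use B in simp)
  moreover have "q ` B \<subseteq> span C"
    unfolding q_def by (intro image_subsetI span_sum span_scale span_base)
  ultimately have "card (q ` B) \<le> card C"
    using independent_span_bound[OF C(1)] by blast
  then show ?thesis using card_image[OF inj] B C by simp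
qed

lemma quotient_dim_unique:
  "subspace W \<Longrightarrow> quotient_dim V W m \<Longrightarrow> quotient_dim V W n \<Longrightarrow> m = n"
  by (simp add: quotient_dim_le antisym)


subsection \<open>The spaces of fluxes are subspaces\<close>

lemma frechet_derivative_plus:
  "f differentiable (at x) \<Longrightarrow> g differentiable (at x) \<Longrightarrow>
   frechet_derivative (\<lambda>x. f x + g x) (at x) =
     (\<lambda>v. frechet_derivative f (at x) v + frechet_derivative g (at x) v)"
  by (rule frechet_derivative_at[symmetric], rule has_derivative_add)
     (simp_all add: frechet_derivative_works)

lemma frechet_derivative_scaleR:
  "f differentiable (at x) \<Longrightarrow>
   frechet_derivative (\<lambda>x. c *\<^sub>R f x) (at x) = (\<lambda>v. c *\<^sub>R frechet_derivative f (at x) v)"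
  by (rule frechet_derivative_at[symmetric], rule has_derivative_scaleR_right)
     (simp add: frechet_derivative_works)

lemma Ck_on_cong:
  assumes "open S"
  shows "Ck_on k S f \<Longrightarrow> (\<And>x. x \<in> S \<Longrightarrow> f x = g x) \<Longrightarrow> Ck_on k S g"
proof (induction k arbitrary: f g)
  case 0
  then show ?case by (simp cong: continuous_on_cong)
next
  case (Suc k)
  have *: "(g has_derivative frechet_derivative f (at x)) (at x)" if x: "x \<in> S" for x
    using Suc.prems x assms
    by (intro has_derivative_transform_within_open[of f _ x UNIV S g])
       (auto simp: frechet_derivative_works)
  have eq: "frechet_derivative f (at x) = frechet_derivative g (at x)" if "x \<in> S" for x
    using frechet_derivative_at[OF *[OF that]] .
  show ?case
    using Suc.prems(1) * Suc.IH[of "\<lambda>x. frechet_derivative f (at x) v" for v]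
    by (auto simp: eq differentiable_def)
qed

lemma Ck_on_add:
  assumes "open S"
  shows "Ck_on k S f \<Longrightarrow> Ck_on k S g \<Longrightarrow> Ck_on k S (\<lambda>x. f x + g x)"
proof (induction k arbitrary: f g)
  case 0
  then show ?case by (auto intro: continuous_intros)
next
  case (Suc k)
  have "Ck_on k S (\<lambda>x. frechet_derivative (\<lambda>x. f x + g x) (at x) v)" for v
    by (rule Ck_on_cong[OF assms Suc.IH[of "\<lambda>x. frechet_derivative f (at x) v"
            "\<lambda>x. frechet_derivative g (at x) v"]])
       (use Suc.prems in \<open>auto simp: frechet_derivative_plus\<close>)
  then show ?case using Suc.prems by auto
qed

lemma Ck_on_scaleR:
  assumes "open S"
  shows "Ck_on k S f \<Longrightarrow> Ck_on k S (\<lambda>x. c *\<^sub>R f x)"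
proof (induction k arbitrary: f)
  case 0
  then show ?case by (auto intro: continuous_intros)
next
  case (Suc k)
  have "Ck_on k S (\<lambda>x. frechet_derivative (\<lambda>x. c *\<^sub>R f x) (at x) v)" for v
    by (rule Ck_on_cong[OF assms Suc.IH[of "\<lambda>x. frechet_derivative f (at x) v"]])
       (use Suc.prems in \<open>auto simp: frechet_derivative_scaleR\<close>)
  then show ?case using Suc.prems by auto
qed

lemma Ck_on_const: "Ck_on k S (\<lambda>x. c)"
  by (induction k arbitrary: c) (auto simp: frechet_derivative_const)

lemma Ck_on_subset: "Ck_on k S f \<Longrightarrow> T \<subseteq> S \<Longrightarrow> Ck_on k T f"
  by (induction k arbitrary: f) (auto intro: continuous_on_subset)

lemma smooth_near_add:
  assumes "smooth_near p f" "smooth_near p g"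
  shows "smooth_near p (\<lambda>x. f x + g x)"
proof -
  obtain U V where "open U" "p \<in> U" "smooth_on U f" "open V" "p \<in> V" "smooth_on V g"
    using assms by (auto simp: smooth_near_def)
  then show ?thesis
    unfolding smooth_near_def smooth_on_def
    by (intro exI[of _ "U \<inter> V"]) (auto intro!: Ck_on_add intro: Ck_on_subset)
qed

lemma smooth_near_scaleR: "smooth_near p f \<Longrightarrow> smooth_near p (\<lambda>x. c *\<^sub>R f x)"
  unfolding smooth_near_def smooth_on_def using Ck_on_scaleR by blast

lemma smooth_near_const: "smooth_near p (\<lambda>x. c)"
  unfolding smooth_near_def smooth_on_def using Ck_on_const open_UNIV by blast

lemma smooth_near_differentiable:
  assumes "smooth_near p f"
  shows "eventually (\<lambda>u. f differentiable (at u)) (nhds p)"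
proof -
  obtain U where U: "open U" "p \<in> U" "smooth_on U f"
    using assms by (auto simp: smooth_near_def)
  then have "Ck_on (Suc 0) U f" unfolding smooth_on_def by blast
  then show ?thesis
    using U by (auto simp: eventually_nhds)
qed

lemma subspace_fluxes: "subspace (fluxes p r)"
proof (rule subspaceI)
  show "0 \<in> fluxes p r"
    unfolding fluxes_def
  proof (rule image_eqI)
    show "0 = germ p (\<lambda>u. 0)" by transfer simp
  qed (auto intro!: smooth_near_const exI[of _ "\<lambda>u. 0"] simp: nabla_def frechet_derivative_const)
next
  fix x y assume "x \<in> fluxes p r" "y \<in> fluxes p r"
  then obtain f g where f: "x = germ p f" "smooth_near p f"
    "\<And>i. i \<in> {1,2} \<Longrightarrow> \<exists>l::real^3 \<Rightarrow> real. smooth_near p l \<and>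
        eventually (\<lambda>u. nabla (r i) f u = l u *\<^sub>R r i u) (nhds p)"
    and g: "y = germ p g" "smooth_near p g"
    "\<And>i. i \<in> {1,2} \<Longrightarrow> \<exists>l::real^3 \<Rightarrow> real. smooth_near p l \<and>
        eventually (\<lambda>u. nabla (r i) g u = l u *\<^sub>R r i u) (nhds p)"
    unfolding fluxes_def by fastforce
  have "\<exists>l::real^3 \<Rightarrow> real. smooth_near p l \<and>
        eventually (\<lambda>u. nabla (r i) (\<lambda>u. f u + g u) u = l u *\<^sub>R r i u) (nhds p)"
    if i: "i \<in> {1,2}" for i
  proof -
    obtain l m :: "real^3 \<Rightarrow> real" where lm: "smooth_near p l" "smooth_near p m"
      and l: "eventually (\<lambda>u. nabla (r i) f u = l u *\<^sub>R r i u) (nhds p)"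
      and m: "eventually (\<lambda>u. nabla (r i) g u = m u *\<^sub>R r i u) (nhds p)"
      using f(3)[OF i] g(3)[OF i] by blast
    have "eventually (\<lambda>u. nabla (r i) (\<lambda>u. f u + g u) u = (l u + m u) *\<^sub>R r i u) (nhds p)"
      using l m smooth_near_differentiable[OF f(2)] smooth_near_differentiable[OF g(2)]
      by eventually_elim (simp add: nabla_def frechet_derivative_plus algebra_simps)
    then show ?thesis using smooth_near_add[OF lm] by blast
  qed
  then show "x + y \<in> fluxes p r"
    unfolding fluxes_def f(1) g(1) germ_add[symmetric]
    using smooth_near_add[OF f(2) g(2)] by blast
next
  fix c x assume "x \<in> fluxes p r"
  then obtain f where f: "x = germ p f" "smooth_near p f"
    "\<And>i. i \<in> {1,2} \<Longrightarrow> \<exists>l::real^3 \<Rightarrow> real. smooth_near p l \<and>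
        eventually (\<lambda>u. nabla (r i) f u = l u *\<^sub>R r i u) (nhds p)"
    unfolding fluxes_def by fastforce
  have "\<exists>l::real^3 \<Rightarrow> real. smooth_near p l \<and>
        eventually (\<lambda>u. nabla (r i) (\<lambda>u. c *\<^sub>R f u) u = l u *\<^sub>R r i u) (nhds p)"
    if i: "i \<in> {1,2}" for i
  proof -
    obtain l :: "real^3 \<Rightarrow> real" where lm: "smooth_near p l"
      and l: "eventually (\<lambda>u. nabla (r i) f u = l u *\<^sub>R r i u) (nhds p)"
      using f(3)[OF i] by blast
    have "eventually (\<lambda>u. nabla (r i) (\<lambda>u. c *\<^sub>R f u) u = (c *\<^sub>R l u) *\<^sub>R r i u) (nhds p)"
      using l smooth_near_differentiable[OF f(2)]
      by eventually_elim (simp add: nabla_def frechet_derivative_scaleR)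
    then show ?thesis using smooth_near_scaleR[OF lm] by blast
  qed
  then show "c *\<^sub>R x \<in> fluxes p r"
    unfolding fluxes_def f(1) germ_scaleR[symmetric]
    using smooth_near_scaleR[OF f(2)] by blast
qed

lemma subspace_trivial_fluxes: "subspace (trivial_fluxes p)"
proof (rule subspaceI)
  show "0 \<in> trivial_fluxes p"
    unfolding trivial_fluxes_def
  proof (rule image_eqI)
    show "0 = germ p (\<lambda>u. 0)" by transfer simp
  qed (auto intro!: smooth_near_const exI[of _ 0] simp: nabla_def frechet_derivative_const)
next
  fix x y assume "x \<in> trivial_fluxes p" "y \<in> trivial_fluxes p"
  then obtain f g and l m :: real where f: "x = germ p f" "smooth_near p f"
    "\<And>r. smooth_near p r \<Longrightarrow> eventually (\<lambda>u. nabla r f u = l *\<^sub>R r u) (nhds p)"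
    and g: "y = germ p g" "smooth_near p g"
    "\<And>r. smooth_near p r \<Longrightarrow> eventually (\<lambda>u. nabla r g u = m *\<^sub>R r u) (nhds p)"
    unfolding trivial_fluxes_def by fastforce
  have "eventually (\<lambda>u. nabla r (\<lambda>u. f u + g u) u = (l + m) *\<^sub>R r u) (nhds p)"
    if r: "smooth_near p r" for r
    using f(3)[OF r] g(3)[OF r] smooth_near_differentiable[OF f(2)] smooth_near_differentiable[OF g(2)]
    by eventually_elim (simp add: nabla_def frechet_derivative_plus algebra_simps)
  then show "x + y \<in> trivial_fluxes p"
    unfolding trivial_fluxes_def f(1) g(1) germ_add[symmetric]
    using smooth_near_add[OF f(2) g(2)] by blast
next
  fix c x assume "x \<in> trivial_fluxes p"
  then obtain f and l :: real where f: "x = germ p f" "smooth_near p f"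
    "\<And>r. smooth_near p r \<Longrightarrow> eventually (\<lambda>u. nabla r f u = l *\<^sub>R r u) (nhds p)"
    unfolding trivial_fluxes_def by fastforce
  have "eventually (\<lambda>u. nabla r (\<lambda>u. c *\<^sub>R f u) u = (c * l) *\<^sub>R r u) (nhds p)"
    if r: "smooth_near p r" for r
    using f(3)[OF r] smooth_near_differentiable[OF f(2)]
    by eventually_elim (simp add: nabla_def frechet_derivative_scaleR)
  then show "c *\<^sub>R x \<in> trivial_fluxes p"
    unfolding trivial_fluxes_def f(1) germ_scaleR[symmetric]
    using smooth_near_scaleR[OF f(2)] by blast
qed

lemma trivial_fluxes_subset:
  assumes "smooth_near p (r 1)" "smooth_near p (r 2)"
  shows "trivial_fluxes p \<subseteq> fluxes p r"
proof
  fix x assume "x \<in> trivial_fluxes p"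
  then obtain f and l :: real where f: "x = germ p f" "smooth_near p f"
    "\<And>r. smooth_near p r \<Longrightarrow> eventually (\<lambda>u. nabla r f u = l *\<^sub>R r u) (nhds p)"
    unfolding trivial_fluxes_def by fastforce
  then show "x \<in> fluxes p r"
    unfolding fluxes_def using assms by (auto intro!: imageI exI[of _ "\<lambda>u. l"] smooth_near_const)
qed

end

(*
Write z = [r1, r2]. The commutator [D_r1, D_r2] f = D_z f expresses D_z f by the eigenvalues l1, l2 and
their first derivatives, so l1 and l2 determine f up to a constant. The remaining integrability conditions
are two linear first-order relations between l1 and l2 and four second-order ones. Modulo lower-order terms
all second derivatives are multiples of y = D_z l1, and the two first-order relations differentiated along z
give a linear system for D_r1 y and D_r2 y whose determinant is a nonzero multiple of
Gamma^3_22 Gamma^3_11 - 9 Gamma^3_12 Gamma^3_21. Hence (l1, l2, D_r1 l2, D_r2 l1, y) satisfies a closed linear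
first-order system and is determined by its value at the point; the identity accounts for one of the five
dimensions. The examples are r1 = (1, 0, p), r2 = (0, 1, q) with polynomials p and q in x and y: derivatives of
the integrability conditions, evaluated at the origin, bound the dimension from above by the number of
explicit polynomial fluxes.
*)
theory Submission
  imports Defs
begin

section \<open>Smooth functions and directional derivatives\<close>

text \<open>Derivatives carry weights: one along r1 and r2, two along their bracket z. The
  first-order relations are solved for D_r1 l1 and D_r2 l2; this is where Gamma^3_21 and Gamma^3_12
  must not vanish. Differentiating one of them along r2 makes D_z l2 a multiple of D_z l1 modulo
  lower weight. The coefficient 2 in these relations is a Leibniz effect: D_r1 (D_z f) contains the
  product of D_r1 l2 and D_r1 r2 twice. Once D_z l2 is eliminated from the z-derivatives, both
  off-diagonal entries of the system carry the factor 2 + 1 = 3, whence the 9. The obstacle is the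
  size of the lower-order coefficients; module membership is enough, because uniqueness for a closed
  linear system holds whatever its smooth coefficients are. Only uniqueness enters: no solution of
  the system is constructed, and the examples rest on explicit fluxes. The count takes place on
  germs, where the trivial fluxes are exactly the common kernel of four linear functionals on the
  space of fluxes.\<close>

lemma Ck_on_Suc_imp: "Ck_on (Suc k) S f \<Longrightarrow> Ck_on k S f"
proof (induction k arbitrary: f)
  case 0
  then show ?case
    by (auto intro!: continuous_at_imp_continuous_on differentiable_imp_continuous_within)
next
  case (Suc k)
  then show ?case by (metis Ck_on.simps(2))
qed

lemma Ck_on_linear:
  assumes S: "open S" and L: "bounded_linear L"
  shows "Ck_on k S f \<Longrightarrow> Ck_on k S (\<lambda>x. L (f x))"
proof (induction k arbitrary: f)
  case 0
  then show ?case using L by (auto intro: bounded_linear.continuous_on)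
next
  case (Suc k)
  have d: "((\<lambda>x. L (f x)) has_derivative (\<lambda>v. L (frechet_derivative f (at x) v))) (at x)"
    if "x \<in> S" for x
    using Suc.prems that
    by (intro bounded_linear.has_derivative[OF L]) (simp add: frechet_derivative_works)
  have "Ck_on k S (\<lambda>x. frechet_derivative (\<lambda>x. L (f x)) (at x) v)" for v
    by (rule Ck_on_cong[OF S Suc.IH[of "\<lambda>x. frechet_derivative f (at x) v"]])
       (use Suc.prems in \<open>auto simp: frechet_derivative_at[OF d, symmetric]\<close>)
  then show ?case using d by (auto simp: differentiable_def)
qed

lemma Ck_on_scaleR_fun:
  fixes a :: "_ \<Rightarrow> real"
  assumes S: "open S"
  shows "Ck_on k S a \<Longrightarrow> Ck_on k S g \<Longrightarrow> Ck_on k S (\<lambda>x. a x *\<^sub>R g x)"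
proof (induction k arbitrary: a g)
  case 0
  then show ?case by (auto intro: continuous_intros)
next
  case (Suc k)
  have d: "((\<lambda>x. a x *\<^sub>R g x) has_derivative
      (\<lambda>v. a x *\<^sub>R frechet_derivative g (at x) v + frechet_derivative a (at x) v *\<^sub>R g x)) (at x)"
    if "x \<in> S" for x
    using Suc.prems that by (intro has_derivative_scaleR) (simp_all add: frechet_derivative_works)
  have ag: "Ck_on k S a" "Ck_on k S g" using Suc.prems by (auto intro: Ck_on_Suc_imp)
  have "Ck_on k S (\<lambda>x. a x *\<^sub>R frechet_derivative g (at x) v + frechet_derivative a (at x) v *\<^sub>R g x)" for v
    using Suc.prems ag by (intro Ck_on_add S Suc.IH) auto
  then have "Ck_on k S (\<lambda>x. frechet_derivative (\<lambda>x. a x *\<^sub>R g x) (at x) v)" for v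
    by (rule Ck_on_cong[OF S]) (auto simp: frechet_derivative_at[OF d, symmetric])
  then show ?case using d by (auto simp: differentiable_def)
qed

lemma Ck_on_inverse:
  fixes a :: "_ \<Rightarrow> real"
  assumes S: "open S" and nz: "\<And>x. x \<in> S \<Longrightarrow> a x \<noteq> 0"
  shows "Ck_on k S a \<Longrightarrow> Ck_on k S (\<lambda>x. inverse (a x))"
proof (induction k)
  case 0
  then show ?case using nz by (auto intro: continuous_intros)
next
  case (Suc k)
  have d: "((\<lambda>x. inverse (a x)) has_derivative
      (\<lambda>v. - (inverse (a x) * frechet_derivative a (at x) v * inverse (a x)))) (at x)"
    if "x \<in> S" for x
    using Suc.prems that nz by (intro Deriv.has_derivative_inverse) (simp_all add: frechet_derivative_works)
  have i: "Ck_on k S (\<lambda>x. inverse (a x))" by (rule Suc.IH[OF Ck_on_Suc_imp[OF Suc.prems]])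
  have "Ck_on k S (\<lambda>x. (-1) *\<^sub>R (inverse (a x) *\<^sub>R (frechet_derivative a (at x) v *\<^sub>R inverse (a x))))" for v
    using Suc.prems by (intro Ck_on_scaleR Ck_on_scaleR_fun S i) auto
  then have "Ck_on k S (\<lambda>x. frechet_derivative (\<lambda>x. inverse (a x)) (at x) v)" for v
    by (rule Ck_on_cong[OF S]) (auto simp: frechet_derivative_at[OF d, symmetric])
  then show ?case using d by (auto simp: differentiable_def)
qed

lemma smooth_on_subset: "smooth_on S f \<Longrightarrow> T \<subseteq> S \<Longrightarrow> smooth_on T f"
  unfolding smooth_on_def by (blast intro: Ck_on_subset)

lemma smooth_on_cong:
  "open S \<Longrightarrow> smooth_on S f \<Longrightarrow> (\<And>x. x \<in> S \<Longrightarrow> f x = g x) \<Longrightarrow> smooth_on S g"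
  unfolding smooth_on_def by (blast intro: Ck_on_cong)

lemma smooth_on_const: "smooth_on S (\<lambda>x. c)"
  unfolding smooth_on_def by (blast intro: Ck_on_const)

lemma smooth_on_add:
  "open S \<Longrightarrow> smooth_on S f \<Longrightarrow> smooth_on S g \<Longrightarrow> smooth_on S (\<lambda>x. f x + g x)"
  unfolding smooth_on_def by (blast intro: Ck_on_add)

lemma smooth_on_scaleR:
  fixes a :: "_ \<Rightarrow> real"
  shows "open S \<Longrightarrow> smooth_on S a \<Longrightarrow> smooth_on S g \<Longrightarrow> smooth_on S (\<lambda>x. a x *\<^sub>R g x)"
  unfolding smooth_on_def by (blast intro: Ck_on_scaleR_fun)

lemma smooth_on_mult:
  fixes a g :: "_ \<Rightarrow> real"
  shows "open S \<Longrightarrow> smooth_on S a \<Longrightarrow> smooth_on S g \<Longrightarrow> smooth_on S (\<lambda>x. a x * g x)"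
  using smooth_on_scaleR[of S a g] by simp

lemma smooth_on_linear:
  "open S \<Longrightarrow> bounded_linear L \<Longrightarrow> smooth_on S f \<Longrightarrow> smooth_on S (\<lambda>x. L (f x))"
  unfolding smooth_on_def by (blast intro: Ck_on_linear)

lemma smooth_on_minus: "open S \<Longrightarrow> smooth_on S f \<Longrightarrow> smooth_on S (\<lambda>x. - f x)"
  by (rule smooth_on_linear) (auto intro: bounded_linear_minus bounded_linear_ident)

lemma smooth_on_diff:
  "open S \<Longrightarrow> smooth_on S f \<Longrightarrow> smooth_on S g \<Longrightarrow> smooth_on S (\<lambda>x. f x - g x)"
  using smooth_on_add[of S f "\<lambda>x. - g x"] smooth_on_minus[of S g] by simp

lemma smooth_on_sum:
  "open S \<Longrightarrow> (\<And>i. i \<in> I \<Longrightarrow> smooth_on S (f i)) \<Longrightarrow> smooth_on S (\<lambda>x. \<Sum>i\<in>I. f i x)"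
  by (induction I rule: infinite_finite_induct) (auto intro: smooth_on_const smooth_on_add)

lemma smooth_on_divide:
  fixes a g :: "_ \<Rightarrow> real"
  assumes "open S" "smooth_on S g" "smooth_on S a" "\<And>x. x \<in> S \<Longrightarrow> a x \<noteq> 0"
  shows "smooth_on S (\<lambda>x. g x / a x)"
  using assms unfolding divide_inverse
  by (intro smooth_on_mult) (auto simp: smooth_on_def intro: Ck_on_inverse)

lemma smooth_on_id: "smooth_on S (\<lambda>x. x)"
  unfolding smooth_on_def
proof
  fix k show "Ck_on k S (\<lambda>x. x)"
    by (cases k) (auto intro: Ck_on_const continuous_intros simp: frechet_derivative_ident)
qed

lemma smooth_on_nth: "open S \<Longrightarrow> smooth_on S f \<Longrightarrow> smooth_on S (\<lambda>x. f x $ i)"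
  by (rule smooth_on_linear) (auto intro: bounded_linear_vec_nth)

lemma smooth_on_inner:
  fixes f g :: "_ \<Rightarrow> real^'n"
  shows "open S \<Longrightarrow> smooth_on S f \<Longrightarrow> smooth_on S g \<Longrightarrow> smooth_on S (\<lambda>x. f x \<bullet> g x)"
  unfolding inner_vec_def inner_real_def
  by (intro smooth_on_sum smooth_on_mult smooth_on_nth)

lemma smooth_on_vector_3:
  fixes a b c :: "_ \<Rightarrow> real"
  assumes S: "open S" and "smooth_on S a" "smooth_on S b" "smooth_on S c"
  shows "smooth_on S (\<lambda>x. vector [a x, b x, c x] :: real^3)"
proof (rule smooth_on_cong[OF S])
  show "smooth_on S (\<lambda>x. a x *\<^sub>R axis 1 1 + (b x *\<^sub>R axis 2 1 + c x *\<^sub>R axis 3 1) :: real^3)"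
    using assms by (intro smooth_on_add smooth_on_scaleR smooth_on_const)
qed (simp add: vec_eq_iff forall_3 axis_def)

lemma smooth_on_cross3:
  "open S \<Longrightarrow> smooth_on S f \<Longrightarrow> smooth_on S g \<Longrightarrow> smooth_on S (\<lambda>x. cross3 (f x) (g x))"
  unfolding cross3_def
  by (intro smooth_on_vector_3 smooth_on_diff smooth_on_mult smooth_on_nth)

lemma smooth_on_continuous_on: "smooth_on S f \<Longrightarrow> continuous_on S f"
  unfolding smooth_on_def by (metis Ck_on.simps(1))

lemma smooth_on_differentiable: "smooth_on S f \<Longrightarrow> x \<in> S \<Longrightarrow> f differentiable (at x)"
  unfolding smooth_on_def by (metis Ck_on.simps(2))

lemma smooth_on_frechet_derivative:
  "smooth_on S f \<Longrightarrow> smooth_on S (\<lambda>x. frechet_derivative f (at x) v)"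
  unfolding smooth_on_def by (metis Ck_on.simps(2))


section \<open>Derivatives along variable vector fields\<close>

definition dirD :: "('a::real_normed_vector \<Rightarrow> 'a) \<Rightarrow> ('a \<Rightarrow> 'b::real_normed_vector) \<Rightarrow> 'a \<Rightarrow> 'b" where
  "dirD v f u = frechet_derivative f (at u) (v u)"

lemma nabla_eq_dirD: "nabla = dirD"
  by (simp add: fun_eq_iff nabla_def dirD_def)

lemma dirD_eqI: "(f has_derivative F) (at u) \<Longrightarrow> dirD v f u = F (v u)"
  unfolding dirD_def by (metis frechet_derivative_at)

lemma has_derivative_frechet:
  "smooth_on S f \<Longrightarrow> u \<in> S \<Longrightarrow> (f has_derivative frechet_derivative f (at u)) (at u)"
  by (metis smooth_on_differentiable frechet_derivative_works)

lemma linear_frechet: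
  "smooth_on S f \<Longrightarrow> u \<in> S \<Longrightarrow> linear (frechet_derivative f (at u))"
  by (metis smooth_on_differentiable linear_frechet_derivative)

text \<open>\<open>frechet_derivative\<close> is a choice among all derivatives at the point, and
  the set of candidates depends only on the germ. So functions that are not differentiable at
  \<open>u\<close> are covered as well.\<close>

lemma dirD_cong_eventually:
  assumes "eventually (\<lambda>x. f x = g x) (nhds u)"
  shows "dirD v f u = dirD v g u"
proof -
  have "f u = g u" using assms by (rule eventually_nhds_x_imp_x)
  then have "(f has_derivative F) (at u) \<longleftrightarrow> (g has_derivative F) (at u)" for F
    using assms has_derivative_transform_eventually[of f F u UNIV g]
      has_derivative_transform_eventually[of g F u UNIV f]
    by (auto simp: eventually_nhds_conv_at eq_commute)
  then show ?thesis by (simp add: dirD_def frechet_derivative_def)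
qed

lemma dirD_cong:
  assumes "open S" "u \<in> S" "\<And>x. x \<in> S \<Longrightarrow> f x = g x"
  shows "dirD v f u = dirD v g u"
  using assms by (intro dirD_cong_eventually) (auto simp: eventually_nhds)

lemma dirD_const: "dirD v (\<lambda>x. c) u = 0"
  by (simp add: dirD_def frechet_derivative_const)

lemma dirD_id: "dirD v (\<lambda>x. x) u = v u"
  by (simp add: dirD_def frechet_derivative_ident)

lemma dirD_add: "smooth_on S f \<Longrightarrow> smooth_on S g \<Longrightarrow> u \<in> S \<Longrightarrow>
    dirD v (\<lambda>x. f x + g x) u = dirD v f u + dirD v g u"
  by (rule dirD_eqI[THEN trans]) (auto intro!: has_derivative_add has_derivative_frechet simp: dirD_def)

lemma dirD_diff: "smooth_on S f \<Longrightarrow> smooth_on S g \<Longrightarrow> u \<in> S \<Longrightarrow>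
    dirD v (\<lambda>x. f x - g x) u = dirD v f u - dirD v g u"
  by (rule dirD_eqI[THEN trans]) (auto intro!: has_derivative_diff has_derivative_frechet simp: dirD_def)

lemma dirD_minus: "smooth_on S f \<Longrightarrow> u \<in> S \<Longrightarrow> dirD v (\<lambda>x. - f x) u = - dirD v f u"
  by (rule dirD_eqI[THEN trans]) (auto intro!: has_derivative_minus has_derivative_frechet simp: dirD_def)

lemma dirD_scaleR:
  fixes a :: "_ \<Rightarrow> real"
  shows "smooth_on S a \<Longrightarrow> smooth_on S g \<Longrightarrow> u \<in> S \<Longrightarrow>
    dirD v (\<lambda>x. a x *\<^sub>R g x) u = dirD v a u *\<^sub>R g u + a u *\<^sub>R dirD v g u"
  by (rule dirD_eqI[THEN trans], rule has_derivative_scaleR)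
     (auto intro!: has_derivative_frechet simp: dirD_def)

lemma dirD_mult:
  fixes a g :: "_ \<Rightarrow> real"
  shows "smooth_on S a \<Longrightarrow> smooth_on S g \<Longrightarrow> u \<in> S \<Longrightarrow>
    dirD v (\<lambda>x. a x * g x) u = dirD v a u * g u + a u * dirD v g u"
  using dirD_scaleR[of S a g u v] by simp

lemma dirD_linear:
  "bounded_linear L \<Longrightarrow> smooth_on S f \<Longrightarrow> u \<in> S \<Longrightarrow> dirD v (\<lambda>x. L (f x)) u = L (dirD v f u)"
  by (rule dirD_eqI[THEN trans], rule bounded_linear.has_derivative)
     (auto intro!: has_derivative_frechet simp: dirD_def)

lemma dirD_Basis:
  fixes v :: "'a::euclidean_space \<Rightarrow> 'a"
  assumes "smooth_on S f" "u \<in> S"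
  shows "dirD v f u = (\<Sum>b\<in>Basis. (v u \<bullet> b) *\<^sub>R frechet_derivative f (at u) b)"
proof -
  have "dirD v f u = frechet_derivative f (at u) (\<Sum>b\<in>Basis. (v u \<bullet> b) *\<^sub>R b)"
    by (simp add: dirD_def euclidean_representation)
  then show ?thesis
    using linear_frechet[OF assms] by (simp add: linear_sum linear_scale)
qed

text \<open>\<open>Ck_on\<close> speaks of constant directions only, so the direction field is
  expanded over \<open>Basis\<close> and its coefficients become smooth factors.\<close>

lemma smooth_on_dirD:
  fixes v :: "'a::euclidean_space \<Rightarrow> 'a"
  assumes S: "open S" and f: "smooth_on S f" and v: "smooth_on S v"
  shows "smooth_on S (dirD v f)"
proof (rule smooth_on_cong[OF S])
  show "smooth_on S (\<lambda>u. \<Sum>b\<in>Basis. (v u \<bullet> b) *\<^sub>R frechet_derivative f (at u) b)"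
    by (intro smooth_on_sum S smooth_on_scaleR smooth_on_frechet_derivative f
        smooth_on_linear[OF S bounded_linear_inner_left v])
qed (simp add: dirD_Basis[OF f])

lemmas smooth_intros = smooth_on_const smooth_on_id smooth_on_add smooth_on_diff smooth_on_minus
  smooth_on_scaleR smooth_on_mult smooth_on_nth smooth_on_inner smooth_on_cross3 smooth_on_dirD
  smooth_on_vector_3

section \<open>Symmetry of second derivatives\<close>

lemma has_real_derivative_along_line:
  fixes h :: "'a::real_normed_vector \<Rightarrow> real"
  assumes "smooth_on S h" "x + s *\<^sub>R v \<in> S"
  shows "((\<lambda>s. h (x + s *\<^sub>R v)) has_real_derivative frechet_derivative h (at (x + s *\<^sub>R v)) v) (at s)"
proof -
  have l: "((\<lambda>s. x + s *\<^sub>R v) has_derivative (\<lambda>s. s *\<^sub>R v)) (at s)"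
    by (auto intro!: derivative_eq_intros)
  have "((\<lambda>s. h (x + s *\<^sub>R v)) has_derivative
      (\<lambda>r. frechet_derivative h (at (x + s *\<^sub>R v)) (r *\<^sub>R v))) (at s)"
    using has_derivative_compose[OF l has_derivative_frechet[OF assms]] .
  then show ?thesis
    by (simp add: has_field_derivative_def linear_scale[OF linear_frechet[OF assms]] mult.commute[of _ "frechet_derivative h _ v"]
        mult_commute_abs)
qed

text \<open>The mean value theorem is used twice: in the direction \<open>v\<close> for the
  difference of \<open>h\<close> along two parallel sides of the parallelogram, then in the
  direction \<open>w\<close> for the derivative. The left side is symmetric in \<open>v\<close> and
  \<open>w\<close>, which yields Schwarz's theorem below.\<close>

lemma second_difference_mean_value:
  fixes h :: "'a::real_normed_vector \<Rightarrow> real"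
  assumes h: "smooth_on S h" and t: "t > 0"
    and S: "\<And>a b. a \<in> {0..t} \<Longrightarrow> b \<in> {0..t} \<Longrightarrow> u + a *\<^sub>R v + b *\<^sub>R w \<in> S"
  obtains a b where "a \<in> {0..t}" "b \<in> {0..t}"
    "h (u + t *\<^sub>R v + t *\<^sub>R w) - h (u + t *\<^sub>R v) - h (u + t *\<^sub>R w) + h u
      = t * t * frechet_derivative (\<lambda>x. frechet_derivative h (at x) v) (at (u + a *\<^sub>R v + b *\<^sub>R w)) w"
proof -
  have S0: "u + a *\<^sub>R v \<in> S" if "a \<in> {0..t}" for a
    using S[of a 0] that t by simp
  have S1: "(u + t *\<^sub>R w) + a *\<^sub>R v \<in> S" if "a \<in> {0..t}" for a
    using S[of a t] that t by (simp add: ac_simps)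
  define k where "k x = frechet_derivative h (at x) v" for x
  have k: "smooth_on S k" unfolding k_def by (rule smooth_on_frechet_derivative[OF h])
  obtain a where a: "0 < a" "a < t" and
    1: "(h (u + t *\<^sub>R w + t *\<^sub>R v) - h (u + t *\<^sub>R v)) - (h (u + t *\<^sub>R w + 0 *\<^sub>R v) - h (u + 0 *\<^sub>R v))
      = (t - 0) * (k (u + t *\<^sub>R w + a *\<^sub>R v) - k (u + a *\<^sub>R v))"
  proof -
    have D: "((\<lambda>s. h (u + t *\<^sub>R w + s *\<^sub>R v) - h (u + s *\<^sub>R v)) has_real_derivative
        k (u + t *\<^sub>R w + s *\<^sub>R v) - k (u + s *\<^sub>R v)) (at s)" if "0 \<le> s" "s \<le> t" for s
      unfolding k_def using that
      by (intro DERIV_diff has_real_derivative_along_line[OF h] S0 S1) auto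
    show thesis using MVT2[OF t D] that by blast
  qed
  have S2: "(u + a *\<^sub>R v) + b *\<^sub>R w \<in> S" if "b \<in> {0..t}" for b
    using S[of a b] that a by simp
  obtain b where b: "0 < b" "b < t" and
    2: "k (u + a *\<^sub>R v + t *\<^sub>R w) - k (u + a *\<^sub>R v + 0 *\<^sub>R w)
      = (t - 0) * frechet_derivative k (at (u + a *\<^sub>R v + b *\<^sub>R w)) w"
    using MVT2[OF t, of "\<lambda>s. k (u + a *\<^sub>R v + s *\<^sub>R w)"
      "\<lambda>s. frechet_derivative k (at (u + a *\<^sub>R v + s *\<^sub>R w)) w"]
      has_real_derivative_along_line[OF k] S2 by auto
  have "h (u + t *\<^sub>R v + t *\<^sub>R w) - h (u + t *\<^sub>R v) - h (u + t *\<^sub>R w) + h u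
      = t * t * frechet_derivative k (at (u + a *\<^sub>R v + b *\<^sub>R w)) w"
    using 1 2 by (simp add: algebra_simps)
  then show thesis
    using that[of a b] a b unfolding k_def[abs_def] by simp
qed

lemma frechet_derivative_commute_real:
  fixes h :: "'a::real_normed_vector \<Rightarrow> real"
  assumes S: "open S" and h: "smooth_on S h" and u: "u \<in> S"
  shows "frechet_derivative (\<lambda>x. frechet_derivative h (at x) v) (at u) w
    = frechet_derivative (\<lambda>x. frechet_derivative h (at x) w) (at u) v"
proof -
  define P where "P v w x = frechet_derivative (\<lambda>x. frechet_derivative h (at x) v) (at x) w" for v w x
  have cont: "continuous (at u) (P v w)" for v w
    using smooth_on_continuous_on[OF smooth_on_frechet_derivative[OF smooth_on_frechet_derivative[OF h]]]
      S u unfolding P_def by (simp add: continuous_on_eq_continuous_at)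
  obtain d where d: "d > 0" "ball u d \<subseteq> S" using S u openE by blast
  \<comment> \<open>The summand 1 keeps \<open>M\<close> positive when \<open>v\<close> and
    \<open>w\<close> vanish; \<open>t = e / M\<close> keeps the parallelogram within distance
    \<open>e\<close> of \<open>u\<close>.\<close>
  define M where "M = norm v + norm w + 1"
  have M: "M > 0" unfolding M_def by (smt (verit) norm_ge_zero)
  have ex: "\<exists>y z. dist u y \<le> e \<and> dist u z \<le> e \<and> P v w y = P w v z" if e: "0 < e" "e < d" for e
  proof -
    define t where "t = e / M"
    have t: "t > 0" using e M by (simp add: t_def)
    have near: "dist u (u + a *\<^sub>R v + b *\<^sub>R w) \<le> e" if "a \<in> {0..t}" "b \<in> {0..t}" for a b
    proof -
      have "dist u (u + a *\<^sub>R v + b *\<^sub>R w) = norm (a *\<^sub>R v + b *\<^sub>R w)"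
        unfolding dist_norm by (subst norm_minus_commute) (simp add: add.assoc)
      also have "\<dots> \<le> a * norm v + b * norm w"
        using that norm_triangle_ineq[of "a *\<^sub>R v" "b *\<^sub>R w"] by simp
      also have "\<dots> \<le> t * norm v + t * norm w"
        using that by (intro add_mono mult_right_mono) auto
      also have "\<dots> \<le> t * M" using t by (simp add: M_def algebra_simps)
      finally show ?thesis using M by (simp add: t_def)
    qed
    have in1: "u + a *\<^sub>R v + b *\<^sub>R w \<in> S" if "a \<in> {0..t}" "b \<in> {0..t}" for a b
      using near[OF that] e d by (auto simp: subset_eq)
    have in2: "u + a *\<^sub>R w + b *\<^sub>R v \<in> S" if "a \<in> {0..t}" "b \<in> {0..t}" for a b
      using in1[OF that(2,1)] by (simp add: ac_simps)
    obtain a b where ab: "a \<in> {0..t}" "b \<in> {0..t}"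
      "h (u + t *\<^sub>R v + t *\<^sub>R w) - h (u + t *\<^sub>R v) - h (u + t *\<^sub>R w) + h u = t * t * P v w (u + a *\<^sub>R v + b *\<^sub>R w)"
      using second_difference_mean_value[OF h t in1] unfolding P_def by blast
    obtain a' b' where ab': "a' \<in> {0..t}" "b' \<in> {0..t}"
      "h (u + t *\<^sub>R w + t *\<^sub>R v) - h (u + t *\<^sub>R w) - h (u + t *\<^sub>R v) + h u = t * t * P w v (u + a' *\<^sub>R w + b' *\<^sub>R v)"
      using second_difference_mean_value[OF h t in2] unfolding P_def by blast
    have "t * t * P v w (u + a *\<^sub>R v + b *\<^sub>R w) = t * t * P w v (u + a' *\<^sub>R w + b' *\<^sub>R v)"
      using ab(3) ab'(3) by (simp add: algebra_simps)
    then have "P v w (u + a *\<^sub>R v + b *\<^sub>R w) = P w v (u + a' *\<^sub>R w + b' *\<^sub>R v)" using t by simp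
    moreover have "dist u (u + a' *\<^sub>R w + b' *\<^sub>R v) \<le> e"
      using near[OF ab'(2,1)] by (simp add: ac_simps)
    ultimately show ?thesis using near[OF ab(1,2)] by blast
  qed
  \<comment> \<open>The denominator \<open>n + 2\<close> keeps the radius strictly below
    \<open>d\<close> already at \<open>n = 0\<close>.\<close>
  then have "\<exists>y z. dist u y \<le> d / (real n + 2) \<and> dist u z \<le> d / (real n + 2) \<and> P v w y = P w v z" for n :: nat
  proof -
    have "d / (real n + 2) < d" using d mult_pos_pos[of d "real n + 1"] by (simp add: field_simps)
    then show ?thesis using d by (intro ex) (auto simp: add.commute)
  qed
  then obtain y z where yz: "\<And>n::nat. dist u (y n) \<le> d / (real n + 2)" "\<And>n. dist u (z n) \<le> d / (real n + 2)"
    "\<And>n. P v w (y n) = P w v (z n)" by metis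
  have lim: "(\<lambda>n::nat. d / (real n + 2)) \<longlonglongrightarrow> 0"
  proof -
    have "(\<lambda>n. d / real (n + 2)) \<longlonglongrightarrow> 0"
      by (rule LIMSEQ_ignore_initial_segment[where f = "\<lambda>n. d / real n"]) (rule lim_const_over_n)
    then show ?thesis by (simp add: add.commute)
  qed
  have "y \<longlonglongrightarrow> u" "z \<longlonglongrightarrow> u"
    unfolding tendsto_dist_iff[of _ u]
    by (rule tendsto_sandwich[OF _ _ tendsto_const lim]; use yz in \<open>simp add: dist_commute\<close>)+
  then have "(\<lambda>n. P v w (y n)) \<longlonglongrightarrow> P v w u" "(\<lambda>n. P w v (z n)) \<longlonglongrightarrow> P w v u"
    by (auto intro: isCont_tendsto_compose[OF cont])
  then show ?thesis using yz(3) LIMSEQ_unique unfolding P_def by simp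
qed

lemma frechet_derivative_commute:
  fixes h :: "'a::real_normed_vector \<Rightarrow> 'b::euclidean_space"
  assumes S: "open S" and h: "smooth_on S h" and u: "u \<in> S"
  shows "frechet_derivative (\<lambda>x. frechet_derivative h (at x) v) (at u) w
    = frechet_derivative (\<lambda>x. frechet_derivative h (at x) w) (at u) v"
proof (rule euclidean_eqI)
  fix b :: 'b
  define hb where "hb x = h x \<bullet> b" for x
  have hb: "smooth_on S hb"
    unfolding hb_def by (rule smooth_on_linear[OF S bounded_linear_inner_left h])
  have 1: "frechet_derivative (\<lambda>x. k x \<bullet> b) (at x) v = frechet_derivative k (at x) v \<bullet> b"
    if "smooth_on S k" "x \<in> S" for k :: "'a \<Rightarrow> 'b" and x v
    using dirD_linear[OF bounded_linear_inner_left that, of "\<lambda>_. v" b] by (simp add: dirD_def)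
  have 2: "frechet_derivative (\<lambda>x. frechet_derivative hb (at x) v) (at u) w
    = frechet_derivative (\<lambda>x. frechet_derivative h (at x) v) (at u) w \<bullet> b" for v w
  proof -
    have "frechet_derivative (\<lambda>x. frechet_derivative hb (at x) v) (at u) w
       = frechet_derivative (\<lambda>x. frechet_derivative h (at x) v \<bullet> b) (at u) w"
      using dirD_cong[OF S u, of "\<lambda>x. frechet_derivative hb (at x) v"
          "\<lambda>x. frechet_derivative h (at x) v \<bullet> b" "\<lambda>_. w"] 1[OF h, folded hb_def]
      by (simp add: dirD_def)
    then show ?thesis using 1[OF smooth_on_frechet_derivative[OF h] u] by simp
  qed
  show "frechet_derivative (\<lambda>x. frechet_derivative h (at x) v) (at u) w \<bullet> b
    = frechet_derivative (\<lambda>x. frechet_derivative h (at x) w) (at u) v \<bullet> b"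
    using frechet_derivative_commute_real[OF S hb u] unfolding 2 .
qed

lemma dirD_sum:
  assumes "open S" "\<And>i. i \<in> I \<Longrightarrow> smooth_on S (f i)" "u \<in> S"
  shows "dirD v (\<lambda>x. \<Sum>i\<in>I. f i x) u = (\<Sum>i\<in>I. dirD v (f i) u)"
  using assms(2)
proof (induction I rule: infinite_finite_induct)
  case (insert i I)
  then show ?case
    using dirD_add[OF _ smooth_on_sum[OF assms(1), of I f] assms(3), of "f i" v] by simp
qed (auto simp: dirD_const)

text \<open>The second-order parts of the two iterated derivatives are the same double sum by
  symmetry of second derivatives, so only derivatives of the direction fields survive.\<close>

lemma dirD_commutator:
  fixes h :: "'a::euclidean_space \<Rightarrow> 'b::euclidean_space"
  assumes S: "open S" and h: "smooth_on S h" and v: "smooth_on S v" and w: "smooth_on S w" and u: "u \<in> S"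
  shows "dirD v (dirD w h) u - dirD w (dirD v h) u = dirD (\<lambda>x. dirD v w x - dirD w v x) h u"
proof -
  define d where "d b x = frechet_derivative h (at x) b" for b x
  define e where "e b c = frechet_derivative (d b) (at u) c" for b c
  have d: "smooth_on S (d b)" for b unfolding d_def by (rule smooth_on_frechet_derivative[OF h])
  have vb: "smooth_on S (\<lambda>x. v x \<bullet> b)" if "smooth_on S v" for v :: "'a \<Rightarrow> 'a" and b
    using smooth_on_linear[OF S bounded_linear_inner_left that] .
  have exp: "dirD v (dirD w h) u = (\<Sum>b\<in>Basis. (dirD v w u \<bullet> b) *\<^sub>R d b u)
      + (\<Sum>b\<in>Basis. \<Sum>c\<in>Basis. ((w u \<bullet> b) * (v u \<bullet> c)) *\<^sub>R e b c)"
    if v: "smooth_on S v" and w: "smooth_on S w" for v w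
  proof -
    have "dirD v (dirD w h) u = dirD v (\<lambda>x. \<Sum>b\<in>Basis. (w x \<bullet> b) *\<^sub>R d b x) u"
      by (rule dirD_cong[OF S u]) (simp add: d_def dirD_Basis[OF h])
    also have "\<dots> = (\<Sum>b\<in>Basis. dirD v (\<lambda>x. (w x \<bullet> b) *\<^sub>R d b x) u)"
      by (intro dirD_sum[OF S] smooth_on_scaleR S vb w d u)
    also have "\<dots> = (\<Sum>b\<in>Basis. (dirD v w u \<bullet> b) *\<^sub>R d b u + (w u \<bullet> b) *\<^sub>R dirD v (d b) u)"
      using dirD_scaleR[OF vb[OF w] d u] dirD_linear[OF bounded_linear_inner_left w u] by simp
    also have "\<dots> = (\<Sum>b\<in>Basis. (dirD v w u \<bullet> b) *\<^sub>R d b u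
         + (\<Sum>c\<in>Basis. ((w u \<bullet> b) * (v u \<bullet> c)) *\<^sub>R e b c))"
      by (simp add: dirD_Basis[OF d u] e_def scaleR_sum_right)
    finally show ?thesis by (simp add: sum.distrib)
  qed
  have "e b c = e c b" for b c
    unfolding e_def d_def by (rule frechet_derivative_commute[OF S h u])
  then have "(\<Sum>b\<in>Basis. \<Sum>c\<in>Basis. ((w u \<bullet> b) * (v u \<bullet> c)) *\<^sub>R e b c)
      = (\<Sum>b\<in>Basis. \<Sum>c\<in>Basis. ((v u \<bullet> b) * (w u \<bullet> c)) *\<^sub>R e b c)"
    by (subst sum.swap) (simp add: mult.commute)
  then show ?thesis
    unfolding exp[OF v w] exp[OF w v] dirD_Basis[OF h u] d_def
    by (simp add: inner_diff_left scaleR_left_diff_distrib sum_subtractf)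
qed

lemma smooth_on_lie_bracket: "open S \<Longrightarrow> smooth_on S v \<Longrightarrow> smooth_on S w \<Longrightarrow> smooth_on S (lie_bracket v w)"
  unfolding lie_bracket_def dirD_def[symmetric] by (intro smooth_intros)

lemma dirD_lie_bracket:
  fixes h :: "real^3 \<Rightarrow> 'b::euclidean_space"
  assumes "open S" "smooth_on S h" "smooth_on S v" "smooth_on S w" "u \<in> S"
  shows "dirD v (dirD w h) u - dirD w (dirD v h) u = dirD (lie_bracket v w) h u"
  using dirD_commutator[OF assms] by (simp add: lie_bracket_def dirD_def)

section \<open>Modules over the smooth functions\<close>

text \<open>The submodule generated by \<open>G\<close> over the ring of smooth functions on \<open>V\<close>, functions being identified
  when they agree on \<open>V\<close>. Lower-order terms are only tracked up to membership.\<close>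

inductive_set smod :: "'a::real_normed_vector set \<Rightarrow> ('a \<Rightarrow> real) set \<Rightarrow> ('a \<Rightarrow> real) set"
  for V G where
  gen: "g \<in> G \<Longrightarrow> g \<in> smod V G"
| zero: "(\<lambda>_. 0) \<in> smod V G"
| add: "g \<in> smod V G \<Longrightarrow> h \<in> smod V G \<Longrightarrow> (\<lambda>u. g u + h u) \<in> smod V G"
| mult: "smooth_on V a \<Longrightarrow> h \<in> smod V G \<Longrightarrow> (\<lambda>u. a u * h u) \<in> smod V G"
| cong: "h \<in> smod V G \<Longrightarrow> (\<And>u. u \<in> V \<Longrightarrow> h u = k u) \<Longrightarrow> k \<in> smod V G"

lemma smod_minus: "h \<in> smod V G \<Longrightarrow> (\<lambda>u. - h u) \<in> smod V G"
  using smod.mult[OF smooth_on_const[of V "-1"], of h G] by simp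

lemma smod_diff: "g \<in> smod V G \<Longrightarrow> h \<in> smod V G \<Longrightarrow> (\<lambda>u. g u - h u) \<in> smod V G"
  using smod.add[OF _ smod_minus, of g V G h] by simp

lemma smod_trans: "h \<in> smod V G \<Longrightarrow> G \<subseteq> smod V H \<Longrightarrow> h \<in> smod V H"
  by (induction rule: smod.induct) (auto intro: smod.intros)

lemma smod_mono: "h \<in> smod V G \<Longrightarrow> G \<subseteq> H \<Longrightarrow> h \<in> smod V H"
  by (erule smod_trans) (auto intro: smod.gen)

lemma smod_smooth_on:
  assumes "open V" "\<And>g. g \<in> G \<Longrightarrow> smooth_on V g"
  shows "h \<in> smod V G \<Longrightarrow> smooth_on V h"
  by (induction rule: smod.induct)
     (use assms in \<open>auto intro: smooth_intros smooth_on_cong\<close>)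

lemma smod_divide:
  assumes V: "open V" and a: "smooth_on V a" "\<And>u. u \<in> V \<Longrightarrow> a u \<noteq> 0"
    and h: "(\<lambda>u. a u * h u) \<in> smod V G"
  shows "h \<in> smod V G"
proof (rule smod.cong)
  show "(\<lambda>u. (1 / a u) * (a u * h u)) \<in> smod V G"
    by (intro smod.mult h smooth_on_divide V a smooth_intros)
qed (use a in simp)

text \<open>By the Leibniz rule the derivative may fall on a coefficient, so the target module must
  contain the generators besides their derivatives.\<close>

lemma smod_dirD:
  fixes v :: "'a::euclidean_space \<Rightarrow> 'a"
  assumes V: "open V" and v: "smooth_on V v"
    and G: "\<And>g. g \<in> G \<Longrightarrow> smooth_on V g"
    and H: "G \<subseteq> smod V H" "\<And>g. g \<in> G \<Longrightarrow> dirD v g \<in> smod V H"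
  shows "h \<in> smod V G \<Longrightarrow> dirD v h \<in> smod V H"
proof (induction rule: smod.induct)
  case (gen g)
  then show ?case by (rule H)
next
  case zero
  then show ?case by (rule smod.cong[OF smod.zero]) (simp add: dirD_const)
next
  case (add g h)
  show ?case
    by (rule smod.cong[OF smod.add[OF add.IH]])
       (use dirD_add[OF smod_smooth_on[OF V G add.hyps(1)] smod_smooth_on[OF V G add.hyps(2)]] in auto)
next
  case (mult a h)
  have h: "smooth_on V h" using smod_smooth_on[OF V G mult.hyps(2)] .
  show ?case
    by (rule smod.cong[OF smod.add[OF smod.mult[OF smooth_on_dirD[OF V mult.hyps(1) v]
              smod_trans[OF mult.hyps(2) H(1)]] smod.mult[OF mult.hyps(1) mult.IH]]])
       (simp add: dirD_mult[OF mult.hyps(1) h])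
next
  case (cong h k)
  show ?case
    by (rule smod.cong[OF cong.IH]) (use dirD_cong[OF V] cong.hyps in auto)
qed

section \<open>Uniqueness for closed linear first-order systems\<close>

lemma smod_bound:
  assumes G: "finite G" "\<And>g. g \<in> G \<Longrightarrow> smooth_on V g" and K: "compact K" "K \<subseteq> V"
  shows "h \<in> smod V G \<Longrightarrow> \<exists>C\<ge>0. \<forall>u\<in>K. \<bar>h u\<bar> \<le> C * (\<Sum>g\<in>G. \<bar>g u\<bar>)"
proof (induction rule: smod.induct)
  case (gen g)
  then show ?case
    using G by (intro exI[of _ 1]) (auto intro!: member_le_sum)
next
  case zero
  then show ?case by (intro exI[of _ 0]) auto
next
  case (add g h)
  then obtain C D where "C \<ge> 0" "\<forall>u\<in>K. \<bar>g u\<bar> \<le> C * (\<Sum>g\<in>G. \<bar>g u\<bar>)"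
     "D \<ge> 0" "\<forall>u\<in>K. \<bar>h u\<bar> \<le> D * (\<Sum>g\<in>G. \<bar>g u\<bar>)" by auto
  then show ?case
    by (intro exI[of _ "C + D"]) (fastforce simp: distrib_right)
next
  case (mult a h)
  then obtain C where C: "C \<ge> 0" "\<forall>u\<in>K. \<bar>h u\<bar> \<le> C * (\<Sum>g\<in>G. \<bar>g u\<bar>)" by auto
  \<comment> \<open>A smooth coefficient may be unbounded on \<open>V\<close>; on the compact set
    \<open>K\<close> it is bounded.\<close>
  have "compact (a ` K)"
    using smooth_on_continuous_on[OF mult.hyps(1)] K
    by (blast intro: compact_continuous_image continuous_on_subset)
  then obtain B where B: "\<forall>u\<in>K. \<bar>a u\<bar> \<le> B"
    using compact_imp_bounded by (fastforce simp: bounded_iff)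
  have "\<bar>a u * h u\<bar> \<le> \<bar>B\<bar> * C * (\<Sum>g\<in>G. \<bar>g u\<bar>)" if "u \<in> K" for u
  proof -
    have "\<bar>a u\<bar> \<le> \<bar>B\<bar>" using B that by fastforce
    then show ?thesis
      using C that by (auto simp: abs_mult mult.assoc intro!: mult_mono)
  qed
  then show ?case using C by (intro exI[of _ "\<bar>B\<bar> * C"]) auto
next
  case (cong h k)
  then show ?case using K by (metis subsetD)
qed

text \<open>Gronwall along the segment from \<open>p\<close> to \<open>u\<close>: closedness of the
  system bounds the derivative of the sum of squares \<open>F\<close> by a constant times
  \<open>F\<close>, and \<open>F\<close> starts at zero. A ball contains all these segments.\<close>

lemma vanishing_of_differential_inequality:
  fixes G :: "('a::euclidean_space \<Rightarrow> real) set"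
  assumes G: "finite G" "\<And>g. g \<in> G \<Longrightarrow> smooth_on (ball p d) g"
    and D: "\<And>g b. g \<in> G \<Longrightarrow> b \<in> Basis \<Longrightarrow> dirD (\<lambda>_. b) g \<in> smod (ball p d) G"
    and p: "\<And>g. g \<in> G \<Longrightarrow> g p = 0"
    and g: "g \<in> G" and u: "u \<in> ball p d"
  shows "g u = 0"
proof -
  define v where "v = u - p"
  define l where "l t = p + t *\<^sub>R v" for t
  have lin: "l t \<in> ball p d" if "t \<in> {0..1}" for t
  proof -
    have "\<bar>t\<bar> * norm v \<le> norm v" using that by (simp add: mult_left_le_one_le)
    also have "\<dots> < d" using u by (simp add: v_def dist_norm norm_minus_commute)
    finally show ?thesis by (simp add: l_def dist_norm)
  qed
  define K where "K = l ` {0..1}"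
  have K: "compact K" "K \<subseteq> ball p d"
    using lin unfolding K_def l_def
    by (auto intro!: compact_continuous_image continuous_intros)
  have Dv: "dirD (\<lambda>_. v) h \<in> smod (ball p d) G" if "h \<in> G" for h
  proof (rule smod.cong)
    have "(\<lambda>u. \<Sum>b\<in>B. (v \<bullet> b) * dirD (\<lambda>_. b) h u) \<in> smod (ball p d) G" if "B \<subseteq> Basis" for B
      using finite_subset[OF that finite_Basis] that
      by (induction B) (auto intro!: smod.zero smod.add smod.mult smooth_on_const D \<open>h \<in> G\<close>)
    then show "(\<lambda>u. \<Sum>b\<in>Basis. (v \<bullet> b) * dirD (\<lambda>_. b) h u) \<in> smod (ball p d) G" by blast
  qed (use dirD_Basis[OF G(2)[OF that], where v = "\<lambda>_. v"] in \<open>simp add: dirD_def\<close>)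
  have "\<forall>h\<in>G. \<exists>C\<ge>0. \<forall>u\<in>K. \<bar>dirD (\<lambda>_. v) h u\<bar> \<le> C * (\<Sum>g\<in>G. \<bar>g u\<bar>)"
    using smod_bound[OF G K Dv] by blast
  then obtain C where C: "\<And>h. h \<in> G \<Longrightarrow> C h \<ge> 0"
    "\<And>h u. h \<in> G \<Longrightarrow> u \<in> K \<Longrightarrow> \<bar>dirD (\<lambda>_. v) h u\<bar> \<le> C h * (\<Sum>g\<in>G. \<bar>g u\<bar>)" by metis
  define M where "M = (\<Sum>h\<in>G. C h)"
  have M: "C h \<le> M" if "h \<in> G" for h
    using member_le_sum[of h G C] that C G by (auto simp: M_def)
  \<comment> \<open>The 2 comes from differentiating squares, \<open>M\<close> dominates the
    constants of all generators, and \<open>card G\<close> is the Cauchy-Schwarz loss between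
    absolute values and squares.\<close>
  define N where "N = 2 * M * real (card G)"
  define F where "F t = (\<Sum>h\<in>G. (h (l t))\<^sup>2)" for t
  define F' where "F' t = (\<Sum>h\<in>G. 2 * h (l t) * dirD (\<lambda>_. v) h (l t))" for t
  have dF: "(F has_real_derivative F' t) (at t)" if t: "t \<in> {0..1}" for t
  proof -
    have "((\<lambda>t. (h (l t))\<^sup>2) has_real_derivative 2 * h (l t) * dirD (\<lambda>_. v) h (l t)) (at t)" if "h \<in> G" for h
    proof -
      have "((\<lambda>t. h (l t)) has_real_derivative dirD (\<lambda>_. v) h (l t)) (at t)"
        using has_real_derivative_along_line[OF G(2)[OF that]] lin[OF t] by (simp add: l_def dirD_def)
      from DERIV_power[OF this, of 2] show ?thesis by (simp add: mult_ac)
    qed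
    then show ?thesis unfolding F_def F'_def by (intro DERIV_sum) auto
  qed
  have F': "F' t \<le> N * F t" if t: "t \<in> {0..1}" for t
  proof -
    have lK: "l t \<in> K" using t by (simp add: K_def)
    have S: "(\<Sum>g\<in>G. \<bar>g (l t)\<bar>)\<^sup>2 \<le> card G * F t"
      using Cauchy_Schwarz_ineq_sum[of "\<lambda>g. \<bar>g (l t)\<bar>" "\<lambda>_. 1" G] by (simp add: F_def mult.commute)
    have "F' t \<le> (\<Sum>h\<in>G. 2 * \<bar>h (l t)\<bar> * (M * (\<Sum>g\<in>G. \<bar>g (l t)\<bar>)))"
      unfolding F'_def
    proof (rule sum_mono)
      fix h assume h: "h \<in> G"
      have "\<bar>dirD (\<lambda>_. v) h (l t)\<bar> \<le> M * (\<Sum>g\<in>G. \<bar>g (l t)\<bar>)"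
        using C(2)[OF h lK] mult_right_mono[OF M[OF h], of "\<Sum>g\<in>G. \<bar>g (l t)\<bar>"]
        by (smt (verit) sum_nonneg)
      then have "\<bar>2 * h (l t)\<bar> * \<bar>dirD (\<lambda>_. v) h (l t)\<bar> \<le> \<bar>2 * h (l t)\<bar> * (M * (\<Sum>g\<in>G. \<bar>g (l t)\<bar>))"
        by (rule mult_left_mono) simp
      then have "\<bar>2 * h (l t) * dirD (\<lambda>_. v) h (l t)\<bar> \<le> 2 * \<bar>h (l t)\<bar> * (M * (\<Sum>g\<in>G. \<bar>g (l t)\<bar>))"
        by (simp add: abs_mult)
      then show "2 * h (l t) * dirD (\<lambda>_. v) h (l t) \<le> 2 * \<bar>h (l t)\<bar> * (M * (\<Sum>g\<in>G. \<bar>g (l t)\<bar>))"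
        by (rule order_trans[OF abs_ge_self])
    qed
    also have "\<dots> = 2 * M * (\<Sum>g\<in>G. \<bar>g (l t)\<bar>)\<^sup>2"
      by (simp add: sum_distrib_left sum_distrib_right power2_eq_square mult_ac)
    also have "\<dots> \<le> 2 * M * (card G * F t)"
      using S C(1) by (intro mult_left_mono) (auto simp: M_def sum_nonneg)
    finally show ?thesis by (simp add: N_def mult_ac)
  qed
  have "F 1 * exp (- N * 1) \<le> F 0 * exp (- N * 0)"
  proof (rule DERIV_nonpos_imp_nonincreasing[of 0 1 "\<lambda>t. F t * exp (- N * t)"])
    fix t :: real assume "0 \<le> t" "t \<le> 1"
    then have t: "t \<in> {0..1}" by simp
    have "((\<lambda>t. F t * exp (- N * t)) has_real_derivative (F' t - N * F t) * exp (- N * t)) (at t)"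
      by (auto intro!: derivative_eq_intros dF[OF t] simp: algebra_simps)
    then show "\<exists>y. ((\<lambda>t. F t * exp (- N * t)) has_real_derivative y) (at t) \<and> y \<le> 0"
      using F'[OF t] by (intro exI conjI) (auto intro: mult_nonpos_nonneg)
  qed simp
  moreover have "F 0 = 0" unfolding F_def l_def by (intro sum.neutral) (simp add: p)
  ultimately have "F 1 \<le> 0" by (simp add: mult_le_0_iff)
  moreover have "F 1 \<ge> 0" unfolding F_def by (intro sum_nonneg) simp
  ultimately have "F 1 = 0" by simp
  then have "\<forall>h\<in>G. (h (l 1))\<^sup>2 = 0"
    using G(1) unfolding F_def by (subst (asm) sum_nonneg_eq_0_iff) auto
  then show ?thesis using g by (simp add: l_def v_def)
qed

section \<open>Integrability conditions of a flux\<close>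

lemma inner_3: "(x::real^3) \<bullet> y = x $ 1 * y $ 1 + x $ 2 * y $ 2 + x $ 3 * y $ 3"
  by (simp add: inner_vec_def sum_3)

text \<open>Cramer's rule, with triple products as determinants and the denominator cleared.\<close>

lemma cramer_cross3:
  "(cross3 a b \<bullet> c) *\<^sub>R x = (cross3 b c \<bullet> x) *\<^sub>R a + (cross3 c a \<bullet> x) *\<^sub>R b + (cross3 a b \<bullet> x) *\<^sub>R c"
  by (simp add: vec_eq_iff forall_3 cross3_def inner_3) (simp add: algebra_simps)

text \<open>One elimination step with the nowhere vanishing pivot \<open>c\<close>. Shorter
  combinations are padded with a zero coefficient.\<close>

lemma smod_solve:
  assumes "open V" "\<And>u. u \<in> V \<Longrightarrow> c u \<noteq> 0"
    "smooth_on V c" "smooth_on V a" "smooth_on V b" "smooth_on V d"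
    "g \<in> smod V G" "h \<in> smod V G" "e \<in> smod V G"
    "\<And>u. u \<in> V \<Longrightarrow> c u * k u = a u * g u + b u * h u + d u * e u"
  shows "k \<in> smod V G"
proof (rule smod_divide[where a = c])
  show "(\<lambda>u. c u * k u) \<in> smod V G"
    by (rule smod.cong[where h = "\<lambda>u. a u * g u + b u * h u + d u * e u"])
       (intro smod.add smod.mult assms | simp add: assms)+
qed (use assms in auto)

lemma smod_sum3:
  assumes "smooth_on V a" "smooth_on V b" "smooth_on V d"
    "g \<in> smod V G" "h \<in> smod V G" "e \<in> smod V G"
    "\<And>u. u \<in> V \<Longrightarrow> k u = a u * g u + b u * h u + d u * e u"
  shows "k \<in> smod V G"
  by (rule smod.cong[where h = "\<lambda>u. a u * g u + b u * h u + d u * e u"])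
     (intro smod.add smod.mult assms | simp add: assms)+

locale flux_pair =
  fixes V :: "(real^3) set" and r1 r2 f :: vfield and l1 l2 :: "real^3 \<Rightarrow> real"
  assumes V: "open V"
    and smooth_r1: "smooth_on V r1" and smooth_r2: "smooth_on V r2" and smooth_f: "smooth_on V f"
    and smooth_l1: "smooth_on V l1" and smooth_l2: "smooth_on V l2"
    and eigen1: "\<And>u. u \<in> V \<Longrightarrow> dirD r1 f u = l1 u *\<^sub>R r1 u"
    and eigen2: "\<And>u. u \<in> V \<Longrightarrow> dirD r2 f u = l2 u *\<^sub>R r2 u"
    and non_involutive: "\<And>u. u \<in> V \<Longrightarrow> cross3 (r1 u) (r2 u) \<bullet> lie_bracket r1 r2 u \<noteq> 0"
begin

definition "z = lie_bracket r1 r2"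
definition "n u = cross3 (r1 u) (r2 u)"
definition "dt u = n u \<bullet> z u"
text \<open>As \<open>n\<close> annihilates \<open>r1\<close> and \<open>r2\<close>, this is the
  transversal part of \<open>dirD v w\<close>. On the frame fields it is the Christoffel symbol with
  upper index 3 times the scalar product of \<open>n\<close> with the completing field. That factor
  is common to all index pairs, so the genericity expression changes only by its square.\<close>

definition "\<gamma> v w u = n u \<bullet> dirD v w u"

text \<open>Exchanging the fields reverses both the normal and the bracket, so their triple product
  is unchanged. Each relation is therefore proved for one index and transferred to the
  other.\<close>

lemma swap: "flux_pair V r2 r1 f l2 l1"
proof
  show "cross3 (r2 u) (r1 u) \<bullet> lie_bracket r2 r1 u \<noteq> 0" if "u \<in> V" for u
    using non_involutive[OF that] cross_skew[of "r2 u" "r1 u"]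
    by (simp add: lie_bracket_def inner_diff_right)
qed (use V smooth_r1 smooth_r2 smooth_f smooth_l1 smooth_l2 eigen1 eigen2 in auto)

lemma smooth_z: "smooth_on V z"
  unfolding z_def by (intro smooth_on_lie_bracket V smooth_r1 smooth_r2)

lemma smooth_n: "smooth_on V n"
  unfolding n_def[abs_def] by (intro smooth_intros V smooth_r1 smooth_r2)

lemma smooth_dt: "smooth_on V dt"
  unfolding dt_def[abs_def] by (intro smooth_intros V smooth_n smooth_z)

lemma dt_nonzero: "u \<in> V \<Longrightarrow> dt u \<noteq> 0"
  using non_involutive by (simp add: dt_def n_def z_def)

lemma smooth_\<gamma>: "smooth_on V v \<Longrightarrow> smooth_on V w \<Longrightarrow> smooth_on V (\<gamma> v w)"
  unfolding \<gamma>_def[abs_def] by (intro smooth_intros V smooth_n)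

lemmas smooth_data = V smooth_r1 smooth_r2 smooth_z smooth_n smooth_dt smooth_\<gamma> smooth_l1 smooth_l2 smooth_f

lemma dirD_decompose:
  fixes h :: "real^3 \<Rightarrow> 'b::euclidean_space"
  assumes "smooth_on V h" "u \<in> V"
  shows "dt u *\<^sub>R dirD v h u = (cross3 (r2 u) (z u) \<bullet> v u) *\<^sub>R dirD r1 h u
    + (cross3 (z u) (r1 u) \<bullet> v u) *\<^sub>R dirD r2 h u + (n u \<bullet> v u) *\<^sub>R dirD z h u"
proof -
  note L = linear_frechet[OF assms]
  have "dt u *\<^sub>R dirD v h u = frechet_derivative h (at u) (dt u *\<^sub>R v u)"
    by (simp add: dirD_def linear_scale[OF L])
  also have "dt u *\<^sub>R v u = (cross3 (r2 u) (z u) \<bullet> v u) *\<^sub>R r1 u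
    + (cross3 (z u) (r1 u) \<bullet> v u) *\<^sub>R r2 u + (n u \<bullet> v u) *\<^sub>R z u"
    unfolding dt_def n_def by (rule cramer_cross3)
  finally show ?thesis by (simp add: dirD_def linear_add[OF L] linear_scale[OF L])
qed

lemma smod_dirD_frame:
  assumes h: "smooth_on V h" and v: "smooth_on V v"
    and "dirD r1 h \<in> smod V G" "dirD r2 h \<in> smod V G" "dirD z h \<in> smod V G"
  shows "dirD v h \<in> smod V G"
  by (rule smod_solve[where c = dt and g = "dirD r1 h" and h = "dirD r2 h" and e = "dirD z h"
        and a = "\<lambda>u. cross3 (r2 u) (z u) \<bullet> v u" and b = "\<lambda>u. cross3 (z u) (r1 u) \<bullet> v u"
        and d = "\<lambda>u. n u \<bullet> v u"])
     (use assms dt_nonzero dirD_decompose[OF h, of _ v] in \<open>auto intro!: smooth_intros smooth_data\<close>)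

lemma dirD_z_f:
  assumes u: "u \<in> V"
  shows "dirD z f u = dirD r1 l2 u *\<^sub>R r2 u + l2 u *\<^sub>R dirD r1 r2 u
    - (dirD r2 l1 u *\<^sub>R r1 u + l1 u *\<^sub>R dirD r2 r1 u)"
proof -
  have "dirD r1 (dirD r2 f) u = dirD r1 (\<lambda>u. l2 u *\<^sub>R r2 u) u"
    by (rule dirD_cong[OF V u eigen2])
  moreover have "dirD r2 (dirD r1 f) u = dirD r2 (\<lambda>u. l1 u *\<^sub>R r1 u) u"
    by (rule dirD_cong[OF V u eigen1])
  ultimately show ?thesis
    using dirD_lie_bracket[OF V smooth_f smooth_r1 smooth_r2 u]
    by (simp add: z_def dirD_scaleR[OF smooth_l1 smooth_r1 u] dirD_scaleR[OF smooth_l2 smooth_r2 u])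
qed

text \<open>The identity \<open>[D\<^sub>r\<^sub>1, D\<^sub>z] f = D\<^sub>[\<^sub>r\<^sub>1\<^sub>,\<^sub>z\<^sub>] f\<close> paired with a covector \<open>\<theta>\<close>; the choices \<open>\<theta> = r1 \<times> r2\<close>, \<open>z \<times> r1\<close>, \<open>r2 \<times> z\<close>
  isolate its three components. The companion identity for \<open>r2\<close> and \<open>z\<close> comes from \<open>swap\<close>.\<close>

lemma integrability_r1_z:
  assumes u: "u \<in> V"
  defines "w \<equiv> lie_bracket r1 z"
  shows "dt u * ((\<theta> \<bullet> r2 u) * dirD r1 (dirD r1 l2) u
      - (\<theta> \<bullet> r1 u) * (dirD r1 (dirD r2 l1) u + dirD z l1 u)
      + 2 * (\<theta> \<bullet> dirD r1 r2 u) * dirD r1 l2 u - (\<theta> \<bullet> dirD r1 r1 u) * dirD r2 l1 u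
      - (\<theta> \<bullet> dirD r2 r1 u) * dirD r1 l1 u
      + (\<theta> \<bullet> dirD r1 (dirD r1 r2) u) * l2 u
      - (\<theta> \<bullet> dirD r1 (dirD r2 r1) u + \<theta> \<bullet> dirD z r1 u) * l1 u)
    = (cross3 (r2 u) (z u) \<bullet> w u) * (\<theta> \<bullet> r1 u) * l1 u + (cross3 (z u) (r1 u) \<bullet> w u) * (\<theta> \<bullet> r2 u) * l2 u
      + (n u \<bullet> w u) * ((\<theta> \<bullet> r2 u) * dirD r1 l2 u - (\<theta> \<bullet> r1 u) * dirD r2 l1 u
          + (\<theta> \<bullet> dirD r1 r2 u) * l2 u - (\<theta> \<bullet> dirD r2 r1 u) * l1 u)"
proof -
  note S = smooth_on_dirD[OF V _ smooth_r1] smooth_on_dirD[OF V _ smooth_r2] smooth_data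
  note A = smooth_on_add[OF V] smooth_on_scaleR[OF V]
  have "dirD r1 (dirD z f) u = dirD r1 (\<lambda>u. (dirD r1 l2 u *\<^sub>R r2 u + l2 u *\<^sub>R dirD r1 r2 u)
    - (dirD r2 l1 u *\<^sub>R r1 u + l1 u *\<^sub>R dirD r2 r1 u)) u"
    by (rule dirD_cong[OF V u dirD_z_f])
  also have "\<dots> = dirD r1 (dirD r1 l2) u *\<^sub>R r2 u + dirD r1 l2 u *\<^sub>R dirD r1 r2 u
     + (dirD r1 l2 u *\<^sub>R dirD r1 r2 u + l2 u *\<^sub>R dirD r1 (dirD r1 r2) u)
    - (dirD r1 (dirD r2 l1) u *\<^sub>R r1 u + dirD r2 l1 u *\<^sub>R dirD r1 r1 u
     + (dirD r1 l1 u *\<^sub>R dirD r2 r1 u + l1 u *\<^sub>R dirD r1 (dirD r2 r1) u))"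
    by (subst dirD_diff[of V] dirD_add[of V] dirD_scaleR[of V]; (intro A S u)?)+ (simp add: add_ac)
  finally have 1: "dirD r1 (dirD z f) u = \<dots>" .
  have "dirD z (dirD r1 f) u = dirD z (\<lambda>u. l1 u *\<^sub>R r1 u) u"
    by (rule dirD_cong[OF V u eigen1])
  then have 2: "dirD z (dirD r1 f) u = dirD z l1 u *\<^sub>R r1 u + l1 u *\<^sub>R dirD z r1 u"
    by (simp add: dirD_scaleR[OF smooth_l1 smooth_r1 u])
  have 3: "dirD r1 (dirD z f) u - dirD z (dirD r1 f) u = dirD w f u"
    unfolding w_def by (rule dirD_lie_bracket[OF V smooth_f smooth_r1 smooth_z u])
  \<comment> \<open>The factor \<open>dt u\<close> clears the denominator when \<open>w\<close> is
    expanded in \<open>r1\<close>, \<open>r2\<close>, \<open>z\<close>.\<close>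
  have "dt u * (\<theta> \<bullet> (dirD r1 (dirD z f) u - dirD z (dirD r1 f) u)) = \<theta> \<bullet> (dt u *\<^sub>R dirD w f u)"
    by (simp add: 3)
  note E = this[unfolded 1 2 dirD_decompose[OF smooth_f u] eigen1[OF u] eigen2[OF u] dirD_z_f[OF u]
      inner_add_right inner_diff_right inner_scaleR_right]
  show ?thesis using E by algebra
qed

text \<open>Pairing with \<open>n\<close> removes all second derivatives and
  \<open>dirD z l1\<close>, because they multiply \<open>r1\<close> or \<open>r2\<close>. The 2
  appears because both terms of \<open>dirD_z_f\<close> that contain \<open>l2\<close> contribute
  \<open>dirD r1 l2\<close> times \<open>dirD r1 r2\<close>.\<close>

lemma first_order_relation:
  "(\<lambda>u. 2 * \<gamma> r1 r2 u * dirD r1 l2 u - \<gamma> r1 r1 u * dirD r2 l1 u - \<gamma> r2 r1 u * dirD r1 l1 u) \<in> smod V {l1, l2}"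
proof (rule smod_divide[OF V smooth_dt dt_nonzero])
  let ?w = "lie_bracket r1 z"
  have w: "smooth_on V ?w" by (intro smooth_on_lie_bracket smooth_data)
  let ?a = "\<lambda>u. dt u * (n u \<bullet> dirD r1 (dirD r2 r1) u + n u \<bullet> dirD z r1 u) - (n u \<bullet> ?w u) * \<gamma> r2 r1 u"
  let ?b = "\<lambda>u. (n u \<bullet> ?w u) * \<gamma> r1 r2 u - dt u * (n u \<bullet> dirD r1 (dirD r1 r2) u)"
  show "(\<lambda>u. dt u * (2 * \<gamma> r1 r2 u * dirD r1 l2 u - \<gamma> r1 r1 u * dirD r2 l1 u - \<gamma> r2 r1 u * dirD r1 l1 u))
    \<in> smod V {l1, l2}"
  proof (rule smod.cong[where h = "\<lambda>u. ?a u * l1 u + ?b u * l2 u"])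
    show "(\<lambda>u. ?a u * l1 u + ?b u * l2 u) \<in> smod V {l1, l2}"
      by (intro smod.add smod.mult smod.gen smooth_intros smooth_data w) auto
    fix u assume u: "u \<in> V"
    have "n u \<bullet> r1 u = 0" "n u \<bullet> r2 u = 0"
      by (simp_all add: n_def dot_cross_self)
    then show "?a u * l1 u + ?b u * l2 u =
      dt u * (2 * \<gamma> r1 r2 u * dirD r1 l2 u - \<gamma> r1 r1 u * dirD r2 l1 u - \<gamma> r2 r1 u * dirD r1 l1 u)"
      using integrability_r1_z[OF u, of "n u"] by (simp add: \<gamma>_def algebra_simps)
  qed
qed

text \<open>Derivatives along \<open>z\<close> are left out: \<open>z\<close> is a bracket, so they
  count as second order.\<close>

definition "L1 = {l1, l2, dirD r1 l1, dirD r1 l2, dirD r2 l1, dirD r2 l2}"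

text \<open>The covector \<open>z \<times> r1\<close> annihilates \<open>r1\<close>, which carries
  the second derivatives of \<open>l1\<close>. One factor \<open>dt\<close> is the prefactor of the
  identity, the other is the value of the covector on \<open>r2\<close>.\<close>

lemma second_order_relation_l2: "dirD r1 (dirD r1 l2) \<in> smod V L1"
proof (rule smod_divide[where a = "\<lambda>u. dt u * dt u"])
  let ?w = "lie_bracket r1 z"
  let ?\<theta> = "\<lambda>u. cross3 (z u) (r1 u)"
  have w: "smooth_on V ?w" by (intro smooth_on_lie_bracket smooth_data)
  let ?a = "\<lambda>u. dt u * (?\<theta> u \<bullet> dirD r1 (dirD r2 r1) u + ?\<theta> u \<bullet> dirD z r1 u) - (n u \<bullet> ?w u) * (?\<theta> u \<bullet> dirD r2 r1 u)"
  let ?b = "\<lambda>u. (?\<theta> u \<bullet> ?w u) * dt u + (n u \<bullet> ?w u) * (?\<theta> u \<bullet> dirD r1 r2 u) - dt u * (?\<theta> u \<bullet> dirD r1 (dirD r1 r2) u)"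
  let ?c = "\<lambda>u. (n u \<bullet> ?w u) * dt u - 2 * dt u * (?\<theta> u \<bullet> dirD r1 r2 u)"
  let ?d = "\<lambda>u. dt u * (?\<theta> u \<bullet> dirD r1 r1 u)"
  let ?e = "\<lambda>u. dt u * (?\<theta> u \<bullet> dirD r2 r1 u)"
  show "(\<lambda>u. dt u * dt u * dirD r1 (dirD r1 l2) u) \<in> smod V L1"
  proof (rule smod.cong[where h = "\<lambda>u. ?a u * l1 u + ?b u * l2 u + ?c u * dirD r1 l2 u
      + ?d u * dirD r2 l1 u + ?e u * dirD r1 l1 u"])
    show "(\<lambda>u. ?a u * l1 u + ?b u * l2 u + ?c u * dirD r1 l2 u
      + ?d u * dirD r2 l1 u + ?e u * dirD r1 l1 u) \<in> smod V L1"
      by (intro smod.add smod.mult smod.gen smooth_intros smooth_data w) (auto simp: L1_def)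
    fix u assume u: "u \<in> V"
    have "?\<theta> u \<bullet> r1 u = 0" by (simp add: dot_cross_self)
    moreover have "?\<theta> u \<bullet> r2 u = dt u"
      by (simp add: dt_def n_def cross3_def inner_3) (simp add: algebra_simps)
    ultimately show "?a u * l1 u + ?b u * l2 u + ?c u * dirD r1 l2 u
      + ?d u * dirD r2 l1 u + ?e u * dirD r1 l1 u = dt u * dt u * dirD r1 (dirD r1 l2) u"
      using integrability_r1_z[OF u, of "?\<theta> u"] by (simp add: algebra_simps)
  qed
qed (use dt_nonzero in \<open>auto intro!: smooth_intros smooth_data\<close>)

lemma dirD_z:
  fixes h :: "real^3 \<Rightarrow> real"
  shows "smooth_on V h \<Longrightarrow> u \<in> V \<Longrightarrow> dirD z h u = dirD r1 (dirD r2 h) u - dirD r2 (dirD r1 h) u"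
  unfolding z_def using dirD_lie_bracket[OF V _ smooth_r1 smooth_r2] by metis

text \<open>The 2 arises because \<open>dirD z l1\<close> joins \<open>dirD r1 (dirD r2 l1)\<close>
  in the coefficient of \<open>r1\<close> and is itself a commutator containing that term.\<close>

lemma second_order_relation_l1: "(\<lambda>u. 2 * dirD r1 (dirD r2 l1) u - dirD r2 (dirD r1 l1) u) \<in> smod V L1"
proof (rule smod_divide[where a = "\<lambda>u. dt u * dt u"])
  let ?w = "lie_bracket r1 z"
  let ?\<theta> = "\<lambda>u. cross3 (r2 u) (z u)"
  have w: "smooth_on V ?w" by (intro smooth_on_lie_bracket smooth_data)
  let ?a = "\<lambda>u. (n u \<bullet> ?w u) * (?\<theta> u \<bullet> dirD r2 r1 u) - (?\<theta> u \<bullet> ?w u) * dt u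
     - dt u * (?\<theta> u \<bullet> dirD r1 (dirD r2 r1) u + ?\<theta> u \<bullet> dirD z r1 u)"
  let ?b = "\<lambda>u. dt u * (?\<theta> u \<bullet> dirD r1 (dirD r1 r2) u) - (n u \<bullet> ?w u) * (?\<theta> u \<bullet> dirD r1 r2 u)"
  let ?c = "\<lambda>u. 2 * dt u * (?\<theta> u \<bullet> dirD r1 r2 u)"
  let ?d = "\<lambda>u. (n u \<bullet> ?w u) * dt u - dt u * (?\<theta> u \<bullet> dirD r1 r1 u)"
  let ?e = "\<lambda>u. - (dt u * (?\<theta> u \<bullet> dirD r2 r1 u))"
  show "(\<lambda>u. dt u * dt u * (2 * dirD r1 (dirD r2 l1) u - dirD r2 (dirD r1 l1) u)) \<in> smod V L1"
  proof (rule smod.cong[where h = "\<lambda>u. ?a u * l1 u + ?b u * l2 u + ?c u * dirD r1 l2 u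
      + ?d u * dirD r2 l1 u + ?e u * dirD r1 l1 u"])
    show "(\<lambda>u. ?a u * l1 u + ?b u * l2 u + ?c u * dirD r1 l2 u
      + ?d u * dirD r2 l1 u + ?e u * dirD r1 l1 u) \<in> smod V L1"
      by (intro smod.add smod.mult smod.gen smooth_intros smooth_data w) (auto simp: L1_def)
    fix u assume u: "u \<in> V"
    have "?\<theta> u \<bullet> r2 u = 0" by (simp add: dot_cross_self)
    moreover have "?\<theta> u \<bullet> r1 u = dt u"
      by (simp add: dt_def n_def cross3_def inner_3) (simp add: algebra_simps)
    ultimately show "?a u * l1 u + ?b u * l2 u + ?c u * dirD r1 l2 u
      + ?d u * dirD r2 l1 u + ?e u * dirD r1 l1 u =
      dt u * dt u * (2 * dirD r1 (dirD r2 l1) u - dirD r2 (dirD r1 l1) u)"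
      using integrability_r1_z[OF u, of "?\<theta> u"] dirD_z[OF smooth_l1 u] by (simp add: algebra_simps)
  qed
qed (use dt_nonzero in \<open>auto intro!: smooth_intros smooth_data\<close>)

end

section \<open>The closed linear system\<close>

lemma dirD_relation:
  fixes a b c x y t :: "real^3 \<Rightarrow> real"
  assumes "open S" "smooth_on S a" "smooth_on S b" "smooth_on S c" "smooth_on S x" "smooth_on S y"
    "smooth_on S t" "u \<in> S"
  shows "dirD v (\<lambda>u. 2 * a u * x u - b u * y u - c u * t u) u =
    2 * dirD v a u * x u + 2 * a u * dirD v x u - dirD v b u * y u - b u * dirD v y u
    - dirD v c u * t u - c u * dirD v t u"
proof -
  note S = smooth_on_mult[OF assms(1)] smooth_on_diff[OF assms(1)] smooth_on_const assms
  show ?thesis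
    by (subst dirD_diff[of S] dirD_mult[of S] dirD_const; (intro S)?)+ (simp add: algebra_simps dirD_const)
qed

locale generic_flux_pair = flux_pair +
  assumes \<gamma>12: "\<And>u. u \<in> V \<Longrightarrow> \<gamma> r1 r2 u \<noteq> 0"
    and \<gamma>21: "\<And>u. u \<in> V \<Longrightarrow> \<gamma> r2 r1 u \<noteq> 0"
    and \<gamma>_generic: "\<And>u. u \<in> V \<Longrightarrow> \<gamma> r2 r2 u * \<gamma> r1 r1 u - 9 * \<gamma> r1 r2 u * \<gamma> r2 r1 u \<noteq> 0"
begin

sublocale sw: flux_pair V r2 r1 f l2 l1 by (rule swap)

text \<open>\<open>G2\<close> is the state vector: its span \<open>M2\<close> over the smooth functions turns out to be stable under
  every directional derivative. \<open>M1\<close> contains all first derivatives of \<open>l1\<close> and \<open>l2\<close>.\<close>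

definition "A = dirD r1 l2"
definition "B = dirD r2 l1"
definition "Y = dirD z l1"
definition "Y2 = dirD z l2"
definition "G1 = {l1, l2, A, B}"
definition "G2 = {l1, l2, A, B, Y}"
abbreviation "M1 \<equiv> smod V G1"
abbreviation "M2 \<equiv> smod V G2"

definition "g11 = \<gamma> r1 r1"
definition "g12 = \<gamma> r1 r2"
definition "g21 = \<gamma> r2 r1"
definition "g22 = \<gamma> r2 r2"

lemma smooth_g: "smooth_on V g11" "smooth_on V g12" "smooth_on V g21" "smooth_on V g22"
  unfolding g11_def g12_def g21_def g22_def by (intro smooth_data)+

lemma sD: "smooth_on V h \<Longrightarrow> smooth_on V (dirD r1 h)" "smooth_on V h \<Longrightarrow> smooth_on V (dirD r2 h)"
  "smooth_on V h \<Longrightarrow> smooth_on V (dirD z h)"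
  by (auto intro!: smooth_on_dirD smooth_data)

lemma smooth_AB: "smooth_on V A" "smooth_on V B" "smooth_on V Y" "smooth_on V Y2"
  unfolding A_def B_def Y_def Y2_def by (intro sD smooth_data)+

lemmas smooth_all = smooth_data smooth_g smooth_AB sD

lemma M1_gen: "l1 \<in> M1" "l2 \<in> M1" "A \<in> M1" "B \<in> M1"
  by (auto simp: G1_def intro: smod.gen)

lemma M2_gen: "Y \<in> M2" and M1_M2: "h \<in> M1 \<Longrightarrow> h \<in> M2"
  by (auto simp: G1_def G2_def intro: smod.gen smod_mono)

definition "e1 u = 2 * g12 u * A u - g11 u * B u - g21 u * dirD r1 l1 u"
definition "e2 u = 2 * g21 u * B u - g22 u * A u - g12 u * dirD r2 l2 u"

lemma e1_M0: "e1 \<in> smod V {l1, l2}"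
  using first_order_relation by (simp add: e1_def[abs_def] g11_def g12_def g21_def A_def B_def)

lemma sw_n: "sw.n u = - n u"
  by (simp add: n_def sw.n_def cross_skew[of "r2 u" "r1 u"])

lemma e2_M0: "e2 \<in> smod V {l1, l2}"
proof -
  have "sw.\<gamma> v w u = - \<gamma> v w u" for v w u by (simp add: \<gamma>_def sw.\<gamma>_def sw_n)
  then show ?thesis
    using smod_minus[OF sw.first_order_relation]
    by (simp add: e2_def[abs_def] g22_def g12_def g21_def A_def B_def insert_commute algebra_simps)
qed

lemma M0_M1: "h \<in> smod V {l1, l2} \<Longrightarrow> h \<in> M1"
  by (erule smod_mono) (auto simp: G1_def)

text \<open>The pivot is \<open>g21\<close>: here \<open>dirD r2 r1\<close> must leave the plane of
  \<open>r1\<close> and \<open>r2\<close>. The companion \<open>D2l2_M1\<close> uses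
  \<open>g12\<close> in the same way.\<close>

lemma D1l1_M1: "dirD r1 l1 \<in> M1"
  by (rule smod_solve[OF V, where c = g21 and g = A and h = B and e = e1
      and a = "\<lambda>u. 2 * g12 u" and b = "\<lambda>u. - g11 u" and d = "\<lambda>_. -1"])
     (use \<gamma>21 M1_gen M0_M1[OF e1_M0] in \<open>auto intro!: smooth_intros smooth_all simp: g21_def e1_def\<close>)

lemma D2l2_M1: "dirD r2 l2 \<in> M1"
  by (rule smod_solve[OF V, where c = g12 and g = B and h = A and e = e2
      and a = "\<lambda>u. 2 * g21 u" and b = "\<lambda>u. - g22 u" and d = "\<lambda>_. -1"])
     (use \<gamma>12 M1_gen M0_M1[OF e2_M0] in \<open>auto intro!: smooth_intros smooth_all simp: g12_def e2_def\<close>)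

lemma L1_M1: "h \<in> smod V L1 \<Longrightarrow> h \<in> M1"
  by (erule smod_trans) (use M1_gen D1l1_M1 D2l2_M1 in \<open>auto simp: L1_def A_def B_def\<close>)

lemma D1A_M1: "dirD r1 A \<in> M1"
  unfolding A_def by (intro L1_M1 second_order_relation_l2)

lemma sw_L1: "sw.L1 = L1"
  by (auto simp: L1_def sw.L1_def)

lemma D2B_M1: "dirD r2 B \<in> M1"
  unfolding B_def using sw.second_order_relation_l2 by (simp add: sw_L1 L1_M1)

lemma Y_eq: "u \<in> V \<Longrightarrow> Y u = dirD r1 B u - dirD r2 (dirD r1 l1) u"
  using dirD_z[OF smooth_l1] by (simp add: Y_def B_def)

lemma Y2_eq: "u \<in> V \<Longrightarrow> Y2 u = dirD r1 (dirD r2 l2) u - dirD r2 A u"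
  using dirD_z[OF smooth_l2] by (simp add: Y2_def A_def)

text \<open>The second-order relations in terms of \<open>Y\<close> and \<open>Y2\<close>: modulo
  \<open>M1\<close>, \<open>dirD r1 B\<close> is \<open>- Y\<close> and \<open>dirD r2 A\<close> is
  \<open>Y2\<close>. The signs differ because exchanging the fields reverses
  \<open>z\<close>.\<close>

definition "s1 u = dirD r1 B u + Y u"
definition "s2 u = dirD r2 A u - Y2 u"

lemma s1_M1: "s1 \<in> M1"
  by (rule smod.cong[OF L1_M1[OF second_order_relation_l1]]) (simp add: s1_def Y_eq B_def)

lemma s2_M1: "s2 \<in> M1"
  using L1_M1[OF sw.second_order_relation_l1[unfolded sw_L1]]
  by (rule smod.cong) (simp add: s2_def Y2_eq A_def)

lemma D1B_M2: "dirD r1 B \<in> M2"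
  by (rule smod_sum3[where g = s1 and h = Y and e = s1 and a = "\<lambda>_. 1" and b = "\<lambda>_. -1" and d = "\<lambda>_. 0"])
     (use M2_gen M1_M2[OF s1_M1] in \<open>auto intro!: smooth_intros simp: s1_def\<close>)

lemma smod_dirD_M0:
  assumes "smooth_on V v" "dirD v l1 \<in> smod V H" "dirD v l2 \<in> smod V H" "l1 \<in> smod V H" "l2 \<in> smod V H"
    and "h \<in> smod V {l1, l2}"
  shows "dirD v h \<in> smod V H"
  by (rule smod_dirD[OF V assms(1) _ _ _ assms(6)]) (use assms smooth_l1 smooth_l2 in auto)

text \<open>Half the leading part of \<open>dirD r2 e1\<close>: modulo \<open>M1\<close>,
  \<open>dirD r2 A\<close> is \<open>Y2\<close> and \<open>dirD r2 (dirD r1 l1)\<close> is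
  \<open>- 2 * Y\<close>.\<close>

definition "k u = g12 u * Y2 u + g21 u * Y u"

lemma k_M1: "k \<in> M1"
proof -
  \<comment> \<open>\<open>e1\<close> is a combination of \<open>l1\<close> and \<open>l2\<close>
    alone, so its derivative along \<open>r2\<close> gains only first-order terms.\<close>
  have D: "dirD r2 e1 \<in> M1"
    by (rule smod_dirD_M0[OF smooth_r2 _ _ _ _ e1_M0]) (use D2l2_M1 M1_gen in \<open>auto simp: B_def\<close>)
  have "dirD r2 e1 u = 2 * dirD r2 g12 u * A u + 2 * g12 u * dirD r2 A u - dirD r2 g11 u * B u
      - g11 u * dirD r2 B u - dirD r2 g21 u * dirD r1 l1 u - g21 u * dirD r2 (dirD r1 l1) u" if "u \<in> V" for u
    unfolding e1_def[abs_def] by (rule dirD_relation[of V]) (intro smooth_all that)+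
  then have eq: "2 * k u = (dirD r2 e1 u - 2 * dirD r2 g12 u * A u - 2 * g12 u * s2 u)
      + (dirD r2 g11 u * B u + g11 u * dirD r2 B u) + (dirD r2 g21 u * dirD r1 l1 u + g21 u * s1 u)"
    if "u \<in> V" for u
    using that by (simp add: k_def s1_def s2_def Y_eq algebra_simps)
  show ?thesis
  proof (rule smod_divide[OF V, where a = "\<lambda>_. 2"])
    show "(\<lambda>u. 2 * k u) \<in> M1"
      by (rule smod.cong[OF _ eq[symmetric]])
         (intro smod.add smod_diff smod.mult D M1_gen s1_M1 s2_M1 D1l1_M1 D2B_M1 smooth_intros smooth_all | assumption)+
  qed (auto intro: smooth_intros)
qed

lemma Y2_M2: "Y2 \<in> M2"
  by (rule smod_solve[OF V, where c = g12 and g = k and h = Y and e = Y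
      and a = "\<lambda>_. 1" and b = "\<lambda>u. - g21 u" and d = "\<lambda>_. 0"])
     (use \<gamma>12 M2_gen M1_M2[OF k_M1] in \<open>auto intro!: smooth_intros smooth_all simp: g12_def k_def\<close>)

lemma D2A_M2: "dirD r2 A \<in> M2"
  by (rule smod_sum3[where g = s2 and h = Y2 and e = Y2 and a = "\<lambda>_. 1" and b = "\<lambda>_. 1" and d = "\<lambda>_. 0"])
     (use Y2_M2 M1_M2[OF s2_M1] in \<open>auto intro!: smooth_intros simp: s2_def\<close>)

lemma G1_smooth: "g \<in> G1 \<Longrightarrow> smooth_on V g"
  by (auto simp: G1_def intro: smooth_all)

lemma D1_M1: "h \<in> M1 \<Longrightarrow> dirD r1 h \<in> M2"
  by (rule smod_dirD[OF V smooth_r1 G1_smooth])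
     (use M1_gen D1l1_M1 D1A_M1 D1B_M2 in \<open>auto simp: G1_def A_def intro: M1_M2 smod.gen\<close>)

lemma D2_M1: "h \<in> M1 \<Longrightarrow> dirD r2 h \<in> M2"
  by (rule smod_dirD[OF V smooth_r2 G1_smooth])
     (use M1_gen D2l2_M1 D2A_M2 D2B_M1 in \<open>auto simp: G1_def B_def intro: M1_M2 smod.gen\<close>)

lemma dirD_l1: "smooth_on V v \<Longrightarrow> dirD v l1 \<in> M2"
  by (rule smod_dirD_frame) (use D1l1_M1 M1_gen M2_gen in \<open>auto intro!: smooth_all M1_M2 simp: Y_def B_def\<close>)

lemma dirD_l2: "smooth_on V v \<Longrightarrow> dirD v l2 \<in> M2"
  by (rule smod_dirD_frame) (use D2l2_M1 M1_gen Y2_M2 in \<open>auto intro!: smooth_all M1_M2 simp: Y2_def A_def\<close>)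

text \<open>The commutator is a single derivative of \<open>h\<close>, taken along the bracket of
  \<open>z\<close> and \<open>v\<close>.\<close>

lemma z_commutes:
  assumes "smooth_on V h" "smooth_on V v" "\<And>w. smooth_on V w \<Longrightarrow> dirD w h \<in> M2"
  shows "(\<lambda>u. dirD z (dirD v h) u - dirD v (dirD z h) u) \<in> M2"
  by (rule smod.cong[OF assms(3)[OF smooth_on_lie_bracket[OF V smooth_z assms(2)]]])
     (simp add: dirD_lie_bracket[OF V assms(1) smooth_z assms(2)])

lemma zA: "(\<lambda>u. dirD z A u - dirD r1 Y2 u) \<in> M2"
  unfolding A_def Y2_def by (intro z_commutes smooth_all dirD_l2)
lemma zB: "(\<lambda>u. dirD z B u - dirD r2 Y u) \<in> M2"
  unfolding B_def Y_def by (intro z_commutes smooth_all dirD_l1)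
lemma zD1l1: "(\<lambda>u. dirD z (dirD r1 l1) u - dirD r1 Y u) \<in> M2"
  unfolding Y_def by (intro z_commutes smooth_all dirD_l1)
lemma zD2l2: "(\<lambda>u. dirD z (dirD r2 l2) u - dirD r2 Y2 u) \<in> M2"
  unfolding Y2_def by (intro z_commutes smooth_all dirD_l2)

text \<open>The \<open>z\<close>-derivatives of the two first-order relations, with \<open>z\<close> commuted past \<open>r1\<close> and \<open>r2\<close>
  modulo \<open>M2\<close>; together with the derivatives of \<open>k\<close> they form a linear system for
  \<open>dirD r1 Y\<close> and \<open>dirD r2 Y\<close> whose determinant is the genericity expression \<open>dg\<close>.\<close>

definition "x1 u = 2 * g12 u * dirD r1 Y2 u - g11 u * dirD r2 Y u - g21 u * dirD r1 Y u"
definition "x2 u = 2 * g21 u * dirD r2 Y u - g22 u * dirD r1 Y2 u - g12 u * dirD r2 Y2 u"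

lemma x1_M2: "x1 \<in> M2"
proof -
  have D: "dirD z e1 \<in> M2"
    by (rule smod_dirD_M0[OF smooth_z _ _ _ _ e1_M0]) (use dirD_l1 dirD_l2 smooth_z M1_gen in \<open>auto intro: M1_M2\<close>)
  have "dirD z e1 u = 2 * dirD z g12 u * A u + 2 * g12 u * dirD z A u - dirD z g11 u * B u
      - g11 u * dirD z B u - dirD z g21 u * dirD r1 l1 u - g21 u * dirD z (dirD r1 l1) u" if "u \<in> V" for u
    unfolding e1_def[abs_def] by (rule dirD_relation[of V]) (intro smooth_all that)+
  then have eq: "x1 u = (dirD z e1 u - 2 * dirD z g12 u * A u - 2 * g12 u * (dirD z A u - dirD r1 Y2 u))
      + (dirD z g11 u * B u + g11 u * (dirD z B u - dirD r2 Y u))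
      + (dirD z g21 u * dirD r1 l1 u + g21 u * (dirD z (dirD r1 l1) u - dirD r1 Y u))"
    if "u \<in> V" for u
    using that by (simp add: x1_def algebra_simps)
  show ?thesis
    \<comment> \<open>The instantiated forms of \<open>smod_diff\<close> keep the differences of
      \<open>zA\<close>, \<open>zB\<close> and \<open>zD1l1\<close> whole, since their single terms
      are not yet known to lie in \<open>M2\<close>.\<close>
    by (rule smod.cong[OF _ eq[symmetric]])
       (intro smod.add smod_diff[where g = "\<lambda>u. _ u - _ u"] smod_diff[where h = "\<lambda>u. _ u * _ u"] smod.mult
          D M1_gen[THEN M1_M2] D1l1_M1[THEN M1_M2] zA zB zD1l1 smooth_intros smooth_all | assumption)+
qed

lemma x2_M2: "x2 \<in> M2"
proof -
  have D: "dirD z e2 \<in> M2"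
    by (rule smod_dirD_M0[OF smooth_z _ _ _ _ e2_M0]) (use dirD_l1 dirD_l2 smooth_z M1_gen in \<open>auto intro: M1_M2\<close>)
  have "dirD z e2 u = 2 * dirD z g21 u * B u + 2 * g21 u * dirD z B u - dirD z g22 u * A u
      - g22 u * dirD z A u - dirD z g12 u * dirD r2 l2 u - g12 u * dirD z (dirD r2 l2) u" if "u \<in> V" for u
    unfolding e2_def[abs_def] by (rule dirD_relation[of V]) (intro smooth_all that)+
  then have eq: "x2 u = (dirD z e2 u - 2 * dirD z g21 u * B u - 2 * g21 u * (dirD z B u - dirD r2 Y u))
      + (dirD z g22 u * A u + g22 u * (dirD z A u - dirD r1 Y2 u))
      + (dirD z g12 u * dirD r2 l2 u + g12 u * (dirD z (dirD r2 l2) u - dirD r2 Y2 u))"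
    if "u \<in> V" for u
    using that by (simp add: x2_def algebra_simps)
  show ?thesis
    by (rule smod.cong[OF _ eq[symmetric]])
       (intro smod.add smod_diff[where g = "\<lambda>u. _ u - _ u"] smod_diff[where h = "\<lambda>u. _ u * _ u"] smod.mult
          D M1_gen[THEN M1_M2] D2l2_M1[THEN M1_M2] zA zB zD2l2 smooth_intros smooth_all | assumption)+
qed

text \<open>\<open>k\<close> lies in \<open>M1\<close> and not just in \<open>M2\<close>, so a
  further derivative along \<open>r1\<close> or \<open>r2\<close> remains in \<open>M2\<close>. This
  ties the derivatives of \<open>Y2\<close> to those of \<open>Y\<close>.\<close>

lemma D1k_M2: "(\<lambda>u. g12 u * dirD r1 Y2 u + g21 u * dirD r1 Y u) \<in> M2"
  and D2k_M2: "(\<lambda>u. g12 u * dirD r2 Y2 u + g21 u * dirD r2 Y u) \<in> M2"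
proof -
  have "dirD v k u = dirD v g12 u * Y2 u + g12 u * dirD v Y2 u + (dirD v g21 u * Y u + g21 u * dirD v Y u)"
    if "u \<in> V" for u v
    unfolding k_def[abs_def]
    by (subst dirD_add[of V] dirD_mult[of V]; (intro smooth_intros smooth_all that)?)+ simp
  then have eq: "g12 u * dirD v Y2 u + g21 u * dirD v Y u = dirD v k u - (dirD v g12 u * Y2 u + dirD v g21 u * Y u)"
    if "u \<in> V" for u v
    using that by simp
  have D: "dirD r1 k \<in> M2" "dirD r2 k \<in> M2" using k_M1 by (auto intro: D1_M1 D2_M1)
  show "(\<lambda>u. g12 u * dirD r1 Y2 u + g21 u * dirD r1 Y u) \<in> M2"
    by (rule smod.cong[OF _ eq[symmetric]]) (intro smod_diff smod.add smod.mult D Y2_M2 M2_gen smooth_all | assumption)+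
  show "(\<lambda>u. g12 u * dirD r2 Y2 u + g21 u * dirD r2 Y u) \<in> M2"
    by (rule smod.cong[OF _ eq[symmetric]]) (intro smod_diff smod.add smod.mult D Y2_M2 M2_gen smooth_all | assumption)+
qed

text \<open>The two equations left after the derivatives of \<open>Y2\<close> are eliminated. Each 3
  is 2 + 1, joining the doubled term of a first-order relation with its last term.\<close>

definition "y1 u = g11 u * dirD r2 Y u + 3 * g21 u * dirD r1 Y u"
definition "y2 u = 3 * g12 u * dirD r2 Y u + g22 u * dirD r1 Y u"

lemma y1_M2: "y1 \<in> M2"
  by (rule smod_sum3[where a = "\<lambda>_. 2" and b = "\<lambda>_. -1" and d = "\<lambda>_. 0", OF _ _ _ D1k_M2 x1_M2 x1_M2])
     (auto intro: smooth_intros simp: x1_def y1_def)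

lemma y2_M2: "y2 \<in> M2"
proof (rule smod_solve[where c = g21 and a = g12 and b = g12 and d = g22, OF V _ _ _ _ _ x2_M2 D2k_M2 D1k_M2])
  show "g21 u * y2 u = g12 u * x2 u + g12 u * (g12 u * dirD r2 Y2 u + g21 u * dirD r2 Y u)
     + g22 u * (g12 u * dirD r1 Y2 u + g21 u * dirD r1 Y u)" for u
    by (simp add: y2_def x2_def algebra_simps)
qed (use \<gamma>21 in \<open>auto intro!: smooth_all simp: g21_def\<close>)

definition "dg u = g22 u * g11 u - 9 * g12 u * g21 u"

lemma dg: "smooth_on V dg" "u \<in> V \<Longrightarrow> dg u \<noteq> 0"
  using \<gamma>_generic unfolding dg_def[abs_def]
  by (auto intro!: smooth_intros smooth_all simp: g11_def g12_def g21_def g22_def)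

text \<open>Cramer's rule for the linear forms \<open>y1\<close> and \<open>y2\<close> in
  \<open>dirD r2 Y\<close> and \<open>dirD r1 Y\<close>.\<close>

lemma D1Y_M2: "dirD r1 Y \<in> M2"
proof (rule smod_solve[where c = dg and a = g11 and b = "\<lambda>u. - 3 * g12 u" and d = "\<lambda>_. 0", OF V _ _ _ _ _ y2_M2 y1_M2 y1_M2])
  show "dg u * dirD r1 Y u = g11 u * y2 u + - 3 * g12 u * y1 u + 0 * y1 u" for u
    by (simp add: dg_def y1_def y2_def algebra_simps)
qed (use dg in \<open>auto intro!: smooth_intros smooth_all\<close>)

lemma D2Y_M2: "dirD r2 Y \<in> M2"
proof (rule smod_solve[where c = dg and a = g22 and b = "\<lambda>u. - 3 * g21 u" and d = "\<lambda>_. 0", OF V _ _ _ _ _ y1_M2 y2_M2 y2_M2])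
  show "dg u * dirD r2 Y u = g22 u * y1 u + - 3 * g21 u * y2 u + 0 * y2 u" for u
    by (simp add: dg_def y1_def y2_def algebra_simps)
qed (use dg in \<open>auto intro!: smooth_intros smooth_all\<close>)

lemma G2_smooth: "g \<in> G2 \<Longrightarrow> smooth_on V g"
  by (auto simp: G2_def intro: smooth_all)

lemma D12_G2: "g \<in> G2 \<Longrightarrow> dirD r1 g \<in> M2 \<and> dirD r2 g \<in> M2"
  using D1_M1 D2_M1 M1_gen D1Y_M2 D2Y_M2 by (auto simp: G2_def)

lemma D1_M2: "h \<in> M2 \<Longrightarrow> dirD r1 h \<in> M2"
  by (rule smod_dirD[OF V smooth_r1 G2_smooth]) (auto intro: smod.gen D12_G2[THEN conjunct1])

lemma D2_M2: "h \<in> M2 \<Longrightarrow> dirD r2 h \<in> M2"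
  by (rule smod_dirD[OF V smooth_r2 G2_smooth]) (auto intro: smod.gen D12_G2[THEN conjunct2])

text \<open>Stability under \<open>r1\<close> and \<open>r2\<close> gives stability under
  \<open>z\<close>, whose derivative is their commutator; the three fields span all
  directions.\<close>

lemma closed_system:
  assumes "g \<in> G2" "smooth_on V v" shows "dirD v g \<in> M2"
proof (rule smod_dirD_frame[OF G2_smooth[OF assms(1)] assms(2)])
  show "dirD z g \<in> M2"
    by (rule smod.cong[OF smod_diff[OF D1_M2 D2_M2]]) (use D12_G2 G2_smooth assms dirD_z in auto)
qed (use D12_G2 assms in auto)

lemma eigenvalues_vanish:
  assumes "V = ball p d" "l1 p = 0" "l2 p = 0" "dirD r1 l2 p = 0" "dirD r2 l1 p = 0" "dirD z l1 p = 0"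
    and "u \<in> V"
  shows "l1 u = 0" "l2 u = 0"
proof -
  have "g u = 0" if "g \<in> G2" for g
  proof (rule vanishing_of_differential_inequality[of G2 p d g u])
    show "dirD (\<lambda>_. b) g \<in> smod (ball p d) G2" if "g \<in> G2" for g b
      using closed_system[OF that smooth_on_const] assms(1) by simp
  qed (use that assms G2_smooth in \<open>auto simp: G2_def A_def B_def Y_def\<close>)
  then show "l1 u = 0" "l2 u = 0" by (auto simp: G2_def)
qed

end

section \<open>The space of fluxes at a point\<close>

lemma quotient_dim_refl: "subspace V \<Longrightarrow> quotient_dim V V 0"
  unfolding quotient_dim_def by (intro exI[of _ "{}"]) (auto simp: subspace_0)

text \<open>Cutting \<open>W\<close> by a functional that is nonzero on it costs one dimension: a
  basis of the old quotient is completed by one vector of \<open>W\<close> outside the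
  kernel.\<close>

lemma quotient_dim_extend:
  assumes W: "subspace W" and q: "quotient_dim V W k" and "W \<subseteq> V"
    and add: "\<And>x y. x \<in> W \<Longrightarrow> y \<in> W \<Longrightarrow> \<tau> (x + y) = \<tau> x + \<tau> y"
    and scale: "\<And>c x. x \<in> W \<Longrightarrow> \<tau> (c *\<^sub>R x) = c * (\<tau> x :: real)"
    and b: "b \<in> W" "\<tau> b \<noteq> 0"
  shows "quotient_dim V {w \<in> W. \<tau> w = 0} (Suc k)"
proof -
  obtain B where B: "finite B" "card B = k" "B \<subseteq> V"
    and ind: "\<And>c. (\<Sum>b\<in>B. c b *\<^sub>R b) \<in> W \<Longrightarrow> \<forall>b\<in>B. c b = 0"
    and sp: "\<And>v. v \<in> V \<Longrightarrow> \<exists>c. v - (\<Sum>b\<in>B. c b *\<^sub>R b) \<in> W"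
    using q by (auto simp: quotient_dim_def)
  have bB: "b \<notin> B"
  proof
    assume bB: "b \<in> B"
    have "(\<Sum>x\<in>B. (if x = b then 1 else 0) *\<^sub>R x) = (\<Sum>x\<in>{b}. (if x = b then 1 else 0) *\<^sub>R x)"
      using B(1) bB by (intro sum.mono_neutral_right) auto
    then show False using ind[of "\<lambda>x. if x = b then 1 else 0"] b bB by auto
  qed
  have ins: "(\<Sum>x\<in>insert b B. c x *\<^sub>R x) = c b *\<^sub>R b + (\<Sum>x\<in>B. c x *\<^sub>R x)" for c
    using B(1) bB by simp
  show ?thesis
    unfolding quotient_dim_def
  proof (intro exI[of _ "insert b B"] conjI allI impI ballI)
    show "card (insert b B) = Suc k" using B bB by simp
    show "insert b B \<subseteq> V" using B b assms(3) by auto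
  next
    fix c x assume c: "(\<Sum>x\<in>insert b B. c x *\<^sub>R x) \<in> {w \<in> W. \<tau> w = 0}" and x: "x \<in> insert b B"
    have "(c b *\<^sub>R b + (\<Sum>x\<in>B. c x *\<^sub>R x)) - c b *\<^sub>R b \<in> W"
      using c ins by (intro subspace_diff[OF W] subspace_scale[OF W b(1)]) auto
    then have 0: "\<forall>x\<in>B. c x = 0" using ind by simp
    then have "(\<Sum>x\<in>insert b B. c x *\<^sub>R x) = c b *\<^sub>R b" by (simp only: ins) simp
    then have "c b = 0" using c scale[OF b(1)] b(2) by simp
    then show "c x = 0" using 0 x by auto
  next
    fix v assume "v \<in> V"
    then obtain c where c: "v - (\<Sum>x\<in>B. c x *\<^sub>R x) \<in> W" using sp by blast
    define w where "w = v - (\<Sum>x\<in>B. c x *\<^sub>R x)"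
    \<comment> \<open>Chosen so that \<open>w - t *\<^sub>R b\<close> lies in the kernel of
      \<open>\<tau>\<close>; altering \<open>c\<close> at \<open>b\<close> leaves the sum over
      \<open>B\<close> unchanged.\<close>
    define t where "t = \<tau> w / \<tau> b"
    have "(\<Sum>x\<in>B. (c(b := t)) x *\<^sub>R x) = (\<Sum>x\<in>B. c x *\<^sub>R x)"
      using bB by (intro sum.cong) auto
    then have "v - (\<Sum>x\<in>insert b B. (c(b := t)) x *\<^sub>R x) = w + (- t) *\<^sub>R b"
      by (simp only: ins) (simp add: w_def)
    moreover have "w + (- t) *\<^sub>R b \<in> W"
      using c b by (intro subspace_add[OF W] subspace_scale[OF W]) (auto simp: w_def)
    moreover have "\<tau> (w + (- t) *\<^sub>R b) = 0"
    proof -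
      have "\<tau> (w + (- t) *\<^sub>R b) = \<tau> w + (- t) * \<tau> b"
        using c unfolding scale[OF b(1), symmetric] w_def
        by (intro add subspace_scale[OF W b(1)])
      then show ?thesis using b(2) by (simp add: t_def)
    qed
    ultimately show "\<exists>c. v - (\<Sum>x\<in>insert b B. c x *\<^sub>R x) \<in> {w \<in> W. \<tau> w = 0}"
      by (intro exI[of _ "c(b := t)"]) simp
  qed (use B in auto)
qed

locale functionals =
  fixes V :: "'a::real_vector set" and \<tau> :: "nat \<Rightarrow> 'a \<Rightarrow> real"
  assumes V: "subspace V"
    and add: "\<And>j x y. x \<in> V \<Longrightarrow> y \<in> V \<Longrightarrow> \<tau> j (x + y) = \<tau> j x + \<tau> j y"
    and scale: "\<And>j c x. x \<in> V \<Longrightarrow> \<tau> j (c *\<^sub>R x) = c * \<tau> j x"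
begin

definition "annihilated n = {v \<in> V. \<forall>j<n. \<tau> j v = 0}"

lemma annihilated_Suc: "annihilated (Suc n) = {v \<in> annihilated n. \<tau> n v = 0}"
  by (auto simp: annihilated_def less_Suc_eq)

lemma annihilated_subset: "annihilated n \<subseteq> V"
  by (auto simp: annihilated_def)

lemma subspace_annihilated: "subspace (annihilated n)"
  using V add scale scale[of _ _ 0] unfolding annihilated_def
  by (auto simp: subspace_def)

text \<open>Each further functional either vanishes on the space left so far or cuts it down by one
  dimension.\<close>

lemma quotient_dim_annihilated_le: "\<exists>k\<le>n. quotient_dim V (annihilated n) k"
proof (induction n)
  case 0
  have "annihilated 0 = V" by (auto simp: annihilated_def)
  then show ?case using quotient_dim_refl[OF V] by auto
next
  case (Suc n)
  then obtain k where k: "k \<le> n" "quotient_dim V (annihilated n) k" by blast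
  show ?case
  proof (cases "\<exists>b\<in>annihilated n. \<tau> n b \<noteq> 0")
    case True
    then obtain b where "b \<in> annihilated n" "\<tau> n b \<noteq> 0" by blast
    then have "quotient_dim V (annihilated (Suc n)) (Suc k)"
      unfolding annihilated_Suc using annihilated_subset add scale
      by (intro quotient_dim_extend[OF subspace_annihilated k(2)]) blast+
    then show ?thesis using k by (intro exI[of _ "Suc k"]) simp
  next
    case False
    then have "annihilated (Suc n) = annihilated n" by (auto simp: annihilated_Suc)
    then show ?thesis using k by (intro exI[of _ k]) simp
  qed
qed

text \<open>The triangular values let \<open>b n\<close> survive the first \<open>n\<close>
  functionals but not the next, so every step really drops a dimension.\<close>

lemma quotient_dim_annihilated:
  assumes "\<And>i. i < n \<Longrightarrow> b i \<in> V" "\<And>i. i < n \<Longrightarrow> \<tau> i (b i) \<noteq> 0" "\<And>i j. i < n \<Longrightarrow> j < i \<Longrightarrow> \<tau> j (b i) = 0"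
  shows "quotient_dim V (annihilated n) n"
  using assms
proof (induction n)
  case 0
  have "annihilated 0 = V" by (auto simp: annihilated_def)
  then show ?case using quotient_dim_refl[OF V] by auto
next
  case (Suc n)
  have q: "quotient_dim V (annihilated n) n" using Suc.prems by (intro Suc.IH) auto
  have "b n \<in> annihilated n" using Suc.prems[of n] by (auto simp: annihilated_def)
  then show ?case
    unfolding annihilated_Suc using annihilated_subset add scale Suc.prems(2)[of n]
    by (intro quotient_dim_extend[OF subspace_annihilated q, of _ "b n"]) blast+
qed

end


section \<open>Eigenvalue jets at the point as functionals on flux germs\<close>

context flux_pair begin

text \<open>With both eigenvalues equal to \<open>c\<close>, \<open>dirD_z_f\<close> becomes
  \<open>c\<close> times \<open>dirD r1 r2 - dirD r2 r1\<close>, that is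
  \<open>c *\<^sub>R z\<close>; so all three basis directions are scaled by
  \<open>c\<close>.\<close>

lemma constant_eigenvalues:
  assumes c: "\<And>u. u \<in> V \<Longrightarrow> l1 u = c" "\<And>u. u \<in> V \<Longrightarrow> l2 u = c" and u: "u \<in> V"
  shows "dirD v f u = c *\<^sub>R v u"
proof -
  have "dirD r1 l2 u = 0" "dirD r2 l1 u = 0"
    using dirD_cong[OF V u, of l2 "\<lambda>_. c"] dirD_cong[OF V u, of l1 "\<lambda>_. c"] c by (simp_all add: dirD_const)
  then have z: "dirD z f u = c *\<^sub>R z u"
    using dirD_z_f[OF u] c u by (simp add: z_def lie_bracket_def dirD_def scaleR_diff_right)
  have e: "dt u *\<^sub>R v u = (cross3 (r2 u) (z u) \<bullet> v u) *\<^sub>R r1 u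
    + (cross3 (z u) (r1 u) \<bullet> v u) *\<^sub>R r2 u + (n u \<bullet> v u) *\<^sub>R z u"
    unfolding dt_def n_def by (rule cramer_cross3)
  have "dt u *\<^sub>R dirD v f u = c *\<^sub>R (dt u *\<^sub>R v u)"
    unfolding e dirD_decompose[OF smooth_f u] eigen1[OF u] eigen2[OF u] z c(1)[OF u] c(2)[OF u]
    by (simp only: scaleR_add_right scaleR_scaleR mult.commute)
  also have "\<dots> = dt u *\<^sub>R (c *\<^sub>R v u)" by simp
  finally show ?thesis using dt_nonzero[OF u] by (simp only: scaleR_cancel_left) simp
qed

lemma shift: "flux_pair V r1 r2 (\<lambda>u. f u - c *\<^sub>R u) (\<lambda>u. l1 u - c) (\<lambda>u. l2 u - c)"
proof
  have "dirD v (\<lambda>u. f u - c *\<^sub>R u) u = dirD v f u - c *\<^sub>R v u" if "u \<in> V" for v u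
    using dirD_diff[OF smooth_f _ that, of "\<lambda>u. c *\<^sub>R u" v]
      dirD_scaleR[OF smooth_on_const smooth_on_id that, of v c]
    by (simp add: smooth_on_scaleR[OF V] smooth_on_const smooth_on_id dirD_const dirD_id)
  then show "dirD r1 (\<lambda>u. f u - c *\<^sub>R u) u = (l1 u - c) *\<^sub>R r1 u"
    "dirD r2 (\<lambda>u. f u - c *\<^sub>R u) u = (l2 u - c) *\<^sub>R r2 u" if "u \<in> V" for u
    using that by (simp_all add: eigen1 eigen2 scaleR_diff_left)
qed (use non_involutive in \<open>auto intro!: smooth_intros smooth_data\<close>)

end

text \<open>The conditions use only the normal \<open>cross3 (r 1 u) (r 2 u)\<close>, hence no
  completing field, and hold on an open set so that division is possible near
  \<open>p\<close>.\<close>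

locale generic_frame =
  fixes p :: "real^3" and r :: "nat \<Rightarrow> vfield" and \<Omega> :: "(real^3) set"
  assumes \<Omega>: "open \<Omega>" "p \<in> \<Omega>"
    and smooth_r: "smooth_on \<Omega> (r 1)" "smooth_on \<Omega> (r 2)"
    and bracket: "\<And>u. u \<in> \<Omega> \<Longrightarrow> cross3 (r 1 u) (r 2 u) \<bullet> lie_bracket (r 1) (r 2) u \<noteq> 0"
    and \<Gamma>12: "\<And>u. u \<in> \<Omega> \<Longrightarrow> cross3 (r 1 u) (r 2 u) \<bullet> dirD (r 1) (r 2) u \<noteq> 0"
    and \<Gamma>21: "\<And>u. u \<in> \<Omega> \<Longrightarrow> cross3 (r 1 u) (r 2 u) \<bullet> dirD (r 2) (r 1) u \<noteq> 0"
    and \<Gamma>_generic: "\<And>u. u \<in> \<Omega> \<Longrightarrow>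
      (cross3 (r 1 u) (r 2 u) \<bullet> dirD (r 2) (r 2) u) * (cross3 (r 1 u) (r 2 u) \<bullet> dirD (r 1) (r 1) u)
      - 9 * (cross3 (r 1 u) (r 2 u) \<bullet> dirD (r 1) (r 2) u) * (cross3 (r 1 u) (r 2 u) \<bullet> dirD (r 2) (r 1) u) \<noteq> 0"
begin

text \<open>\<open>lam i f\<close> recovers the eigenvalue from the germ of \<open>f\<close>; the four jets determine the state vector at \<open>p\<close>
  once a multiple of the identity is subtracted from the flux.\<close>

definition lam :: "nat \<Rightarrow> vfield \<Rightarrow> real^3 \<Rightarrow> real" where
  "lam i f u = (dirD (r i) f u \<bullet> r i u) / (r i u \<bullet> r i u)"

definition jet :: "nat \<Rightarrow> vfield \<Rightarrow> real" where
  "jet j f = (if j = 0 then lam 1 f p - lam 2 f p else if j = 1 then dirD (r 1) (lam 2 f) p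
     else if j = 2 then dirD (r 2) (lam 1 f) p else dirD (lie_bracket (r 1) (r 2)) (lam 1 f) p)"

definition germ_jet :: "nat \<Rightarrow> vgerm \<Rightarrow> real" where
  "germ_jet j g = jet j (SOME f. smooth_near p f \<and> germ p f = g)"

lemma r_nonzero: "u \<in> \<Omega> \<Longrightarrow> r 1 u \<noteq> 0" "u \<in> \<Omega> \<Longrightarrow> r 2 u \<noteq> 0"
  using bracket by fastforce+

text \<open>\<open>lam\<close> contains a derivative, so agreement is needed on a neighbourhood of
  each nearby point; \<open>eventually_eventually\<close> supplies it.\<close>

lemma lam_cong:
  assumes "eventually (\<lambda>u. f u = g u) (nhds p)"
  shows "eventually (\<lambda>u. lam i f u = lam i g u) (nhds p)"
proof -
  have "eventually (\<lambda>u. eventually (\<lambda>x. f x = g x) (nhds u)) (nhds p)"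
    using assms by (simp only: eventually_eventually)
  then show ?thesis
  proof (rule eventually_mono)
    fix u assume "eventually (\<lambda>x. f x = g x) (nhds u)"
    from dirD_cong_eventually[OF this] show "lam i f u = lam i g u" by (simp only: lam_def)
  qed
qed

lemma jet_cong: "eventually (\<lambda>u. f u = g u) (nhds p) \<Longrightarrow> jet j f = jet j g"
proof -
  assume fg: "eventually (\<lambda>u. f u = g u) (nhds p)"
  have "lam i f p = lam i g p" "dirD v (lam i f) p = dirD v (lam i g) p" for i v
    by (rule eventually_nhds_x_imp_x[OF lam_cong[OF fg]], rule dirD_cong_eventually[OF lam_cong[OF fg]])
  then show ?thesis by (simp only: jet_def)
qed

lemma germ_jet: "smooth_near p f \<Longrightarrow> germ_jet j (germ p f) = jet j f"
  unfolding germ_jet_def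
  by (rule jet_cong, rule someI2[of _ f]) (auto simp: germ_eq_iff)

lemma lam_eq: "u \<in> \<Omega> \<Longrightarrow> i = 1 \<or> i = 2 \<Longrightarrow> dirD (r i) f u = l *\<^sub>R r i u \<Longrightarrow> lam i f u = l"
  using r_nonzero by (auto simp: lam_def)

lemma smooth_on_lam: "V \<subseteq> \<Omega> \<Longrightarrow> open V \<Longrightarrow> smooth_on V f \<Longrightarrow> i = 1 \<or> i = 2 \<Longrightarrow> smooth_on V (lam i f)"
  unfolding lam_def[abs_def]
  by (intro smooth_on_divide smooth_intros)
     (use smooth_r r_nonzero in \<open>auto intro: smooth_on_subset\<close>)

lemma smooth_near_nbhd:
  assumes "smooth_near p f" "smooth_near p g"
  obtains V where "open V" "p \<in> V" "V \<subseteq> \<Omega>" "smooth_on V f" "smooth_on V g"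
proof -
  obtain V W where "open V" "p \<in> V" "smooth_on V f" "open W" "p \<in> W" "smooth_on W g"
    using assms by (auto simp: smooth_near_def)
  then show thesis using \<Omega> by (intro that[of "V \<inter> W \<inter> \<Omega>"]) (auto intro: smooth_on_subset)
qed

lemma jet_add:
  assumes f: "smooth_near p f" and g: "smooth_near p g"
  shows "jet j (\<lambda>u. f u + g u) = jet j f + jet j g"
proof -
  obtain V where V: "open V" "p \<in> V" "V \<subseteq> \<Omega>" "smooth_on V f" "smooth_on V g"
    using smooth_near_nbhd[OF f g] by blast
  have *: "lam i (\<lambda>u. f u + g u) u = lam i f u + lam i g u" if "u \<in> V" for i u
    using dirD_add[OF V(4,5) that] by (simp add: lam_def inner_add_left add_divide_distrib)
  have "dirD v (lam i (\<lambda>u. f u + g u)) p = dirD v (lam i f) p + dirD v (lam i g) p" if i: "i = 1 \<or> i = 2" for v i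
    by (rule trans[OF dirD_cong[OF V(1,2) *[where i = i]]
          dirD_add[OF smooth_on_lam[OF V(3,1,4) i] smooth_on_lam[OF V(3,1,5) i] V(2)]])
  then show ?thesis by (simp add: jet_def *[OF V(2)])
qed

lemma jet_scaleR:
  assumes f: "smooth_near p f"
  shows "jet j (\<lambda>u. c *\<^sub>R f u) = c * jet j f"
proof -
  obtain V where V: "open V" "p \<in> V" "V \<subseteq> \<Omega>" "smooth_on V f"
    by (rule smooth_near_nbhd[OF f f])
  have D: "dirD v (\<lambda>u. c *\<^sub>R f u) u = c *\<^sub>R dirD v f u" if "u \<in> V" for v u
    by (rule dirD_linear[OF bounded_linear_scaleR_right V(4) that])
  have *: "lam i (\<lambda>u. c *\<^sub>R f u) u = c * lam i f u" if "u \<in> V" for i u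
    by (simp add: lam_def D[OF that])
  have "dirD v (lam i (\<lambda>u. c *\<^sub>R f u)) p = c * dirD v (lam i f) p" if i: "i = 1 \<or> i = 2" for v i
    by (rule trans[OF dirD_cong[OF V(1,2) *[where i = i]]
          dirD_linear[OF bounded_linear_mult_right smooth_on_lam[OF V(3,1,4) i] V(2)]])
  then show ?thesis by (simp add: jet_def *[OF V(2)] right_diff_distrib)
qed

sublocale functionals "fluxes p r" germ_jet
proof
  fix j :: nat and c :: real and x y assume "x \<in> fluxes p r"
  then obtain f where f: "x = germ p f" "smooth_near p f" by (auto simp: fluxes_def)
  then show "germ_jet j (c *\<^sub>R x) = c * germ_jet j x"
    using germ_jet[OF smooth_near_scaleR[OF f(2)]] germ_jet[OF f(2)] jet_scaleR[OF f(2)]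
    by (simp add: germ_scaleR)
  assume "y \<in> fluxes p r"
  then obtain g where g: "y = germ p g" "smooth_near p g" by (auto simp: fluxes_def)
  show "germ_jet j (x + y) = germ_jet j x + germ_jet j y"
    using germ_jet[OF smooth_near_add[OF f(2) g(2)]] germ_jet[OF f(2)] germ_jet[OF g(2)] jet_add[OF f(2) g(2)]
    by (simp add: f g germ_add)
qed (rule subspace_fluxes)

lemma flux_pair_generic:
  assumes "flux_pair V (r 1) (r 2) f l1 l2" "V \<subseteq> \<Omega>"
  shows "generic_flux_pair V (r 1) (r 2) f l1 l2"
proof -
  interpret flux_pair V "r 1" "r 2" f l1 l2 by fact
  show ?thesis
  proof
    fix u assume "u \<in> V"
    then have u: "u \<in> \<Omega>" using assms(2) by blast
    show "\<gamma> (r 1) (r 2) u \<noteq> 0" "\<gamma> (r 2) (r 1) u \<noteq> 0"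
      "\<gamma> (r 2) (r 2) u * \<gamma> (r 1) (r 1) u - 9 * \<gamma> (r 1) (r 2) u * \<gamma> (r 2) (r 1) u \<noteq> 0"
      unfolding \<gamma>_def n_def using \<Gamma>12[OF u] \<Gamma>21[OF u] \<Gamma>_generic[OF u] by blast+
  qed
qed

text \<open>The eigenvalues of a flux are only asserted to exist; near \<open>p\<close> they
  coincide with the quotients \<open>lam\<close>, which \<open>f\<close> determines. The ball
  prepares the uniqueness argument along segments.\<close>

lemma flux_germE:
  assumes "g \<in> fluxes p r"
  obtains f d where "d > 0" "ball p d \<subseteq> \<Omega>" "g = germ p f"
    "generic_flux_pair (ball p d) (r 1) (r 2) f (lam 1 f) (lam 2 f)" "\<And>j. germ_jet j g = jet j f"
proof -
  obtain f where g: "g = germ p f" and f: "smooth_near p f"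
    and l: "\<forall>i\<in>{1,2}. \<exists>l::real^3 \<Rightarrow> real. smooth_near p l \<and> eventually (\<lambda>u. nabla (r i) f u = l u *\<^sub>R r i u) (nhds p)"
    using assms by (auto simp: fluxes_def)
  obtain l1 l2 :: "real^3 \<Rightarrow> real" where
    "eventually (\<lambda>u. dirD (r 1) f u = l1 u *\<^sub>R r 1 u) (nhds p)"
    "eventually (\<lambda>u. dirD (r 2) f u = l2 u *\<^sub>R r 2 u) (nhds p)"
    using l by (auto simp: nabla_eq_dirD)
  then have "eventually (\<lambda>u. dirD (r 1) f u = l1 u *\<^sub>R r 1 u \<and> dirD (r 2) f u = l2 u *\<^sub>R r 2 u) (nhds p)"
    by eventually_elim simp
  then obtain U where U: "open U" "p \<in> U"
    "\<And>u. u \<in> U \<Longrightarrow> dirD (r 1) f u = l1 u *\<^sub>R r 1 u" "\<And>u. u \<in> U \<Longrightarrow> dirD (r 2) f u = l2 u *\<^sub>R r 2 u"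
    unfolding eventually_nhds by blast
  obtain V where V: "open V" "p \<in> V" "V \<subseteq> \<Omega>" "smooth_on V f"
    by (rule smooth_near_nbhd[OF f f])
  obtain d where d: "d > 0" "ball p d \<subseteq> U \<inter> V"
    using openE[of "U \<inter> V" p] U V by auto
  have f': "smooth_on (ball p d) f" using V d by (auto intro: smooth_on_subset)
  have "flux_pair (ball p d) (r 1) (r 2) f (lam 1 f) (lam 2 f)"
  proof
    fix u assume "u \<in> ball p d"
    then have u: "u \<in> U" "u \<in> \<Omega>" using d V by auto
    show "dirD (r 1) f u = lam 1 f u *\<^sub>R r 1 u"
      unfolding lam_eq[OF u(2) disjI1[OF refl] U(3)[OF u(1)]] by (rule U(3)[OF u(1)])
    show "dirD (r 2) f u = lam 2 f u *\<^sub>R r 2 u"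
      unfolding lam_eq[OF u(2) disjI2[OF refl] U(4)[OF u(1)]] by (rule U(4)[OF u(1)])
    show "cross3 (r 1 u) (r 2 u) \<bullet> lie_bracket (r 1) (r 2) u \<noteq> 0"
      by (rule bracket[OF u(2)])
  next
    show "smooth_on (ball p d) (lam 1 f)" "smooth_on (ball p d) (lam 2 f)"
      using d V f' by (auto intro!: smooth_on_lam)
  qed (use smooth_r d V f' in \<open>auto intro: smooth_on_subset\<close>)
  then show thesis
    using d V g germ_jet[OF f] by (intro that[of d f] flux_pair_generic) auto
qed

text \<open>The state has five components but four functionals suffice, because a multiple of the
  identity field absorbs one. After its subtraction the state vanishes at \<open>p\<close>, so both
  eigenvalues are the same constant.\<close>

lemma trivial_fluxes_annihilated: "trivial_fluxes p = annihilated 4"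
proof safe
  fix g assume g: "g \<in> trivial_fluxes p"
  then obtain f c where f: "g = germ p f" "smooth_near p f"
    "\<And>r. smooth_near p r \<Longrightarrow> eventually (\<lambda>u. nabla r f u = c *\<^sub>R r u) (nhds p)"
    by (auto simp: trivial_fluxes_def)
  have sr: "smooth_near p (r 1)" "smooth_near p (r 2)"
    using \<Omega> smooth_r by (auto simp: smooth_near_def)
  have ev: "eventually (\<lambda>u. lam i f u = c) (nhds p)" if i: "i = 1 \<or> i = 2" for i
  proof -
    have "eventually (\<lambda>u. u \<in> \<Omega>) (nhds p)" using \<Omega> by (auto simp: eventually_nhds)
    moreover have "eventually (\<lambda>u. dirD (r i) f u = c *\<^sub>R r i u) (nhds p)"
      using f(3) sr i by (auto simp: nabla_eq_dirD)
    ultimately show ?thesis by eventually_elim (rule lam_eq[OF _ i])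
  qed
  then have "lam i f p = c" "dirD v (lam i f) p = 0" if i: "i = 1 \<or> i = 2" for i v
    using ev[OF i] dirD_cong_eventually[of "lam i f" "\<lambda>_. c" p v]
    by (auto dest: eventually_nhds_x_imp_x simp: dirD_const)
  then have "jet j f = 0" for j by (simp add: jet_def)
  then show "g \<in> annihilated 4"
    using g trivial_fluxes_subset[OF sr] germ_jet[OF f(2)] f(1) by (auto simp: annihilated_def)
next
  fix g assume "g \<in> annihilated 4"
  then have g: "g \<in> fluxes p r" "\<And>j. j < 4 \<Longrightarrow> germ_jet j g = 0" by (auto simp: annihilated_def)
  obtain f d where f: "d > 0" "ball p d \<subseteq> \<Omega>" "g = germ p f"
    "generic_flux_pair (ball p d) (r 1) (r 2) f (lam 1 f) (lam 2 f)"
    using flux_germE[OF g(1)] by blast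
  interpret f: generic_flux_pair "ball p d" "r 1" "r 2" f "lam 1 f" "lam 2 f" by (rule f(4))
  have sf: "smooth_near p f" unfolding smooth_near_def using f(1) f.smooth_f by (intro exI[of _ "ball p d"]) auto
  have j: "jet j f = 0" if "j < 4" for j
    using g(2)[OF that] germ_jet[OF sf] f(3) by simp
  \<comment> \<open>Vanishing of jet 0 makes \<open>c\<close> the value of both eigenvalues at
    \<open>p\<close>.\<close>
  define c where "c = lam 1 f p"
  interpret h: generic_flux_pair "ball p d" "r 1" "r 2" "\<lambda>u. f u - c *\<^sub>R u" "\<lambda>u. lam 1 f u - c" "\<lambda>u. lam 2 f u - c"
    by (rule flux_pair_generic[OF f.shift f(2)])
  have p: "p \<in> ball p d" using f(1) by simp
  have D: "dirD v (\<lambda>u. lam i f u - c) p = dirD v (lam i f) p" if i: "i = 1 \<or> i = 2" for v i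
    using dirD_diff[OF _ smooth_on_const p, of "lam i f" v c] i f.smooth_l1 f.smooth_l2 by (auto simp: dirD_const)
  have "lam 1 f p - lam 2 f p = 0" "dirD (r 2) (lam 1 f) p = 0" "dirD (r 1) (lam 2 f) p = 0"
    "dirD (lie_bracket (r 1) (r 2)) (lam 1 f) p = 0"
    using j[of 0] j[of 1] j[of 2] j[of 3] unfolding jet_def by simp_all
  note j0 = this
  have e1: "lam 1 f p - c = 0" "lam 2 f p - c = 0" using j0(1) by (simp_all add: c_def)
  have e2: "dirD (r 1) (\<lambda>u. lam 2 f u - c) p = 0"
    "dirD (r 2) (\<lambda>u. lam 1 f u - c) p = 0" "dirD h.z (\<lambda>u. lam 1 f u - c) p = 0"
    unfolding h.z_def D[OF disjI1[OF refl]] D[OF disjI2[OF refl]] by (fact j0)+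
  have "lam 1 f u - c = 0" "lam 2 f u - c = 0" if "u \<in> ball p d" for u
    using h.eigenvalues_vanish[OF refl e1 e2 that] .
  then have "dirD v f u = c *\<^sub>R v u" if "u \<in> ball p d" for v u
    using f.constant_eigenvalues[of c u v] that by simp
  then have "eventually (\<lambda>u. nabla v f u = c *\<^sub>R v u) (nhds p)" for v
    unfolding nabla_eq_dirD eventually_nhds using p by (intro exI[of _ "ball p d"]) auto
  then show "g \<in> trivial_fluxes p"
    using sf f(3) by (auto simp: trivial_fluxes_def)
qed

lemma explicit_flux:
  assumes f: "smooth_on \<Omega> f" and l: "smooth_on \<Omega> l1" "smooth_on \<Omega> l2"
    and e: "\<And>u. u \<in> \<Omega> \<Longrightarrow> dirD (r 1) f u = l1 u *\<^sub>R r 1 u" "\<And>u. u \<in> \<Omega> \<Longrightarrow> dirD (r 2) f u = l2 u *\<^sub>R r 2 u"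
  shows "germ p f \<in> fluxes p r"
    and "germ_jet 0 (germ p f) = l1 p - l2 p" "germ_jet 1 (germ p f) = dirD (r 1) l2 p"
      "germ_jet 2 (germ p f) = dirD (r 2) l1 p" "germ_jet 3 (germ p f) = dirD (lie_bracket (r 1) (r 2)) l1 p"
proof -
  have n: "smooth_near p f" "smooth_near p l1" "smooth_near p l2"
    using f l \<Omega> unfolding smooth_near_def by blast+
  have "eventually (\<lambda>u. nabla (r 1) f u = l1 u *\<^sub>R r 1 u) (nhds p)"
    "eventually (\<lambda>u. nabla (r 2) f u = l2 u *\<^sub>R r 2 u) (nhds p)"
    unfolding nabla_eq_dirD eventually_nhds using \<Omega> e by blast+
  then show "germ p f \<in> fluxes p r" using n by (auto simp: fluxes_def)
  have "lam 1 f u = l1 u" "lam 2 f u = l2 u" if "u \<in> \<Omega>" for u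
    using lam_eq[OF that disjI1[OF refl] e(1)[OF that]] lam_eq[OF that disjI2[OF refl] e(2)[OF that]] .
  then have "lam 1 f p = l1 p" "lam 2 f p = l2 p" "dirD v (lam 1 f) p = dirD v l1 p"
     "dirD v (lam 2 f) p = dirD v l2 p" for v
    using \<Omega>(2) dirD_cong[OF \<Omega>] by blast+
  then show "germ_jet 0 (germ p f) = l1 p - l2 p" "germ_jet 1 (germ p f) = dirD (r 1) l2 p"
      "germ_jet 2 (germ p f) = dirD (r 2) l1 p" "germ_jet 3 (germ p f) = dirD (lie_bracket (r 1) (r 2)) l1 p"
    unfolding germ_jet[OF n(1)] by (simp_all only: jet_def) simp_all
qed

lemma quotient_dim_fluxes_le_4: "\<exists>k\<le>4. quotient_dim (fluxes p r) (trivial_fluxes p) k"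
  unfolding trivial_fluxes_annihilated by (rule quotient_dim_annihilated_le)

end

section \<open>From the hypotheses at the point to a generic neighbourhood\<close>

lemma annihilating_cross3_in_span:
  fixes x y v :: "real^3"
  assumes n: "cross3 x y \<noteq> 0" and v: "cross3 x y \<bullet> v = 0"
  shows "v \<in> span {x, y}"
proof -
  define n where "n = cross3 x y"
  \<comment> \<open>Cramer's rule for \<open>x\<close>, \<open>y\<close>, \<open>n\<close>; the
    coefficient of \<open>n\<close> is zero by assumption.\<close>
  have "(n \<bullet> n) *\<^sub>R v = (cross3 y n \<bullet> v) *\<^sub>R x + (cross3 n x \<bullet> v) *\<^sub>R y"
    using cramer_cross3[of x y n v] v by (simp add: n_def)
  then have "v = (1 / (n \<bullet> n)) *\<^sub>R ((cross3 y n \<bullet> v) *\<^sub>R x + (cross3 n x \<bullet> v) *\<^sub>R y)"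
    using n by (metis divide_self_if n_def inner_eq_zero_iff scaleR_one scaleR_scaleR times_divide_eq_left mult_1)
  also have "\<dots> \<in> span {x, y}"
    by (intro span_scale span_add span_base) auto
  finally show ?thesis .
qed

lemma independent_cross3_nonzero:
  fixes x y :: "real^3"
  assumes "independent {x, y}" "x \<noteq> y"
  shows "cross3 x y \<noteq> 0"
proof
  assume "cross3 x y = 0"
  then have "collinear {0, x, y}" by (simp add: cross_eq_0)
  then obtain c where c: "x = 0 \<or> y = 0 \<or> y = c *\<^sub>R x" by (auto simp: collinear_lemma)
  have "x \<noteq> 0" "y \<noteq> 0" using assms(1) dependent_zero by blast+
  moreover have "y \<notin> span {x}"
    using assms by (simp add: insert_commute[of x] independent_insert)
  ultimately show False using c by (auto simp: span_singleton)
qed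

text \<open>All conditions say that continuous functions do not vanish; they are gathered in the
  product \<open>P\<close>. Christoffel symbols become normal components with the factor
  \<open>n p \<bullet> r 3 p\<close>, which is nonzero since otherwise
  \<open>nabla (r 1) (r 2) p\<close> would have no normal component.\<close>

lemma generic_frame_neighborhood:
  assumes \<Omega>: "open \<Omega>" "p \<in> \<Omega>" and fr: "partial_frame_on \<Omega> {1,2} r"
    and b: "lie_bracket (r 1) (r 2) p \<notin> span {r 1 p, r 2 p}"
    and n12: "nabla (r 1) (r 2) p \<notin> span {r 1 p, r 2 p}"
    and n21: "nabla (r 2) (r 1) p \<notin> span {r 1 p, r 2 p}"
    and U: "p \<in> U" "partial_frame_on U {1..3} r"
    and g: "christoffel r 2 2 3 p * christoffel r 1 1 3 p
          - 9 * christoffel r 1 2 3 p * christoffel r 2 1 3 p \<noteq> 0"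
  obtains \<Omega>' where "generic_frame p r \<Omega>'"
proof -
  have s: "smooth_on \<Omega> (r 1)" "smooth_on \<Omega> (r 2)" using fr by (auto simp: partial_frame_on_def)
  define n where "n u = cross3 (r 1 u) (r 2 u)" for u
  have sn: "smooth_on \<Omega> n" unfolding n_def by (intro smooth_intros s \<Omega>)
  define P where "P u = (n u \<bullet> lie_bracket (r 1) (r 2) u) * ((n u \<bullet> dirD (r 1) (r 2) u) * ((n u \<bullet> dirD (r 2) (r 1) u)
    * ((n u \<bullet> dirD (r 2) (r 2) u) * (n u \<bullet> dirD (r 1) (r 1) u)
       - 9 * (n u \<bullet> dirD (r 1) (r 2) u) * (n u \<bullet> dirD (r 2) (r 1) u))))" for u
  have sP: "smooth_on \<Omega> P" unfolding P_def by (intro smooth_intros smooth_on_lie_bracket s sn \<Omega>)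
  have "inj_on (\<lambda>i. r i p) {1,2}" "independent ((\<lambda>i. r i p) ` {1,2})"
    using fr \<Omega> by (auto simp: partial_frame_on_def)
  then have "cross3 (r 1 p) (r 2 p) \<noteq> 0" by (intro independent_cross3_nonzero) auto
  then have nz: "n p \<bullet> v \<noteq> 0" if "v \<notin> span {r 1 p, r 2 p}" for v
    using annihilating_cross3_in_span that unfolding n_def by blast
  have \<Gamma>: "n p \<bullet> dirD (r i) (r j) p = christoffel r i j 3 p * (n p \<bullet> r 3 p)" for i j
  proof -
    have "dirD (r i) (r j) p = (\<Sum>k=1..3. christoffel r i j k p *\<^sub>R r k p)"
      using nabla_christoffel[OF U(2,1)] by (simp add: nabla_eq_dirD)
    then show ?thesis
      by (simp add: eval_nat_numeral inner_add_right n_def dot_cross_self)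
  qed
  have "n p \<bullet> r 3 p \<noteq> 0"
    using nz[OF n12] \<Gamma>[of 1 2] by (auto simp: nabla_eq_dirD)
  then have "(n p \<bullet> dirD (r 2) (r 2) p) * (n p \<bullet> dirD (r 1) (r 1) p)
       - 9 * (n p \<bullet> dirD (r 1) (r 2) p) * (n p \<bullet> dirD (r 2) (r 1) p) \<noteq> 0"
    using g unfolding \<Gamma> by (auto simp: algebra_simps)
  then have Pp: "P p \<noteq> 0"
    using nz[OF b] nz[OF n12] nz[OF n21] by (simp add: P_def nabla_eq_dirD)
  have "open {u \<in> \<Omega>. P u \<noteq> 0}"
    using continuous_open_preimage[OF smooth_on_continuous_on[OF sP] \<Omega>(1), of "- {0}"]
    by (simp add: vimage_def Int_def open_Compl)
  then have "generic_frame p r {u \<in> \<Omega>. P u \<noteq> 0}"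
    by unfold_locales (use \<Omega> Pp s in \<open>auto simp: P_def n_def intro: smooth_on_subset\<close>)
  then show thesis by (rule that)
qed

section \<open>Frames of graphs\<close>

definition graph1 :: "(real^3 \<Rightarrow> real) \<Rightarrow> vfield" where "graph1 p u = vector [1, 0, p u]"
definition graph2 :: "(real^3 \<Rightarrow> real) \<Rightarrow> vfield" where "graph2 q u = vector [0, 1, q u]"
definition vertical :: vfield where "vertical u = vector [0, 0, 1]"

definition graph_frame :: "(real^3 \<Rightarrow> real) \<Rightarrow> (real^3 \<Rightarrow> real) \<Rightarrow> nat \<Rightarrow> vfield" where
  "graph_frame p q i = (if i = 1 then graph1 p else if i = 2 then graph2 q else vertical)"

lemma dirD_vector_3:
  assumes "open S" "smooth_on S a" "smooth_on S b" "smooth_on S c" "u \<in> S"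
  shows "dirD v (\<lambda>u. vector [a u, b u, c u] :: real^3) u = vector [dirD v a u, dirD v b u, dirD v c u]"
proof -
  have "dirD v (\<lambda>u. (vector [a u, b u, c u] :: real^3) $ i) u = dirD v (\<lambda>u. vector [a u, b u, c u] :: real^3) u $ i" for i
    by (rule dirD_linear[OF bounded_linear_vec_nth smooth_on_vector_3[OF assms(1-4)] assms(5)])
  from this[of 1] this[of 2] this[of 3] show ?thesis by (simp add: vec_eq_iff forall_3)
qed

lemma dirD_nth: "dirD v (\<lambda>x. x $ i) u = v u $ i"
  using dirD_linear[OF bounded_linear_vec_nth smooth_on_id, of u UNIV v i] by (simp add: dirD_id)

lemma smooth_graph:
  "open S \<Longrightarrow> smooth_on S p \<Longrightarrow> smooth_on S (graph1 p)"
  "open S \<Longrightarrow> smooth_on S p \<Longrightarrow> smooth_on S (graph2 p)" "open S \<Longrightarrow> smooth_on S vertical"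
  unfolding graph1_def[abs_def] graph2_def[abs_def] vertical_def[abs_def] by (auto intro: smooth_intros)

text \<open>As \<open>p\<close> and \<open>q\<close> do not depend on the third coordinate,
  \<open>vertical\<close> commutes with both fields, and the only nontrivial commutator is
  \<open>c\<close> times \<open>DS\<close>.\<close>

locale graph =
  fixes S :: "(real^3) set" and p q :: "real^3 \<Rightarrow> real"
  assumes S: "open S" and smooth_p: "smooth_on S p" and smooth_q: "smooth_on S q"
    and vertical_pq: "\<And>u. u \<in> S \<Longrightarrow> dirD vertical p u = 0" "\<And>u. u \<in> S \<Longrightarrow> dirD vertical q u = 0"
begin

abbreviation "D1 \<equiv> dirD (graph1 p)"
abbreviation "D2 \<equiv> dirD (graph2 q)"
abbreviation "DS \<equiv> dirD vertical"
definition "c u = D1 q u - D2 p u"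

lemma dirD_graph:
  assumes "u \<in> S"
  shows "dirD v (graph1 p) u = dirD v p u *\<^sub>R vertical u" "dirD v (graph2 q) u = dirD v q u *\<^sub>R vertical u"
    "dirD v vertical u = 0"
  unfolding graph1_def[abs_def] graph2_def[abs_def] vertical_def[abs_def]
  using assms smooth_p smooth_q S
  by (simp_all add: dirD_vector_3[of S] smooth_on_const dirD_const vec_eq_iff forall_3)

lemma bracket_graph: "u \<in> S \<Longrightarrow> lie_bracket (graph1 p) (graph2 q) u = c u *\<^sub>R vertical u"
  by (simp add: lie_bracket_def dirD_def[symmetric] dirD_graph c_def scaleR_diff_left)

lemma commute_12:
  fixes h :: "real^3 \<Rightarrow> real"
  assumes "smooth_on S h" "u \<in> S" shows "D1 (D2 h) u - D2 (D1 h) u = c u * DS h u"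
proof -
  have "dirD (lie_bracket (graph1 p) (graph2 q)) h u = c u * DS h u"
    using bracket_graph[OF assms(2)] linear_frechet[OF assms] by (simp add: dirD_def linear_scale)
  then show ?thesis
    using dirD_lie_bracket[OF S assms(1) smooth_graph(1)[OF S smooth_p] smooth_graph(2)[OF S smooth_q] assms(2)]
    by simp
qed

lemma commute_S:
  fixes h :: "real^3 \<Rightarrow> real"
  assumes "smooth_on S h" "u \<in> S"
  shows "D1 (DS h) u = DS (D1 h) u" "D2 (DS h) u = DS (D2 h) u"
proof -
  have "lie_bracket (graph1 p) vertical u = 0" "lie_bracket (graph2 q) vertical u = 0"
    using assms vertical_pq by (simp_all add: lie_bracket_def dirD_def[symmetric] dirD_graph)
  then have "dirD (lie_bracket (graph1 p) vertical) h u = 0" "dirD (lie_bracket (graph2 q) vertical) h u = 0"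
    using linear_frechet[OF assms] by (simp_all add: dirD_def linear_0)
  then show "D1 (DS h) u = DS (D1 h) u" "D2 (DS h) u = DS (D2 h) u"
    using dirD_lie_bracket[OF S assms(1) smooth_graph(1)[OF S smooth_p] smooth_graph(3)[OF S] assms(2)]
      dirD_lie_bracket[OF S assms(1) smooth_graph(2)[OF S smooth_q] smooth_graph(3)[OF S] assms(2)] by simp_all
qed

lemmas smooth_rules = smooth_p smooth_q S smooth_graph(1)[OF S smooth_p] smooth_graph(2)[OF S smooth_q] smooth_graph(3)[OF S]
  smooth_on_const smooth_on_id smooth_on_add[OF S] smooth_on_diff[OF S] smooth_on_minus[OF S]
  smooth_on_mult[OF S] smooth_on_nth[OF S]
  smooth_on_dirD[OF S _ smooth_graph(1)[OF S smooth_p]] smooth_on_dirD[OF S _ smooth_graph(2)[OF S smooth_q]]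
  smooth_on_dirD[OF S _ smooth_graph(3)[OF S]]

lemmas dirD_rules = dirD_add[of S] dirD_diff[of S] dirD_minus[of S] dirD_mult[of S] dirD_const dirD_nth
  graph1_def graph2_def vertical_def

end

lemma independent_3I:
  fixes x y z :: "real^3"
  assumes "\<And>a b c. a *\<^sub>R x + b *\<^sub>R y + c *\<^sub>R z = 0 \<Longrightarrow> a = 0 \<and> b = 0 \<and> c = 0"
  shows "independent {x, y, z}" and "x \<noteq> y" "y \<noteq> z" "x \<noteq> z"
proof -
  show d: "x \<noteq> y" "y \<noteq> z" "x \<noteq> z"
    using assms[of 1 "-1" 0] assms[of 0 1 "-1"] assms[of 1 0 "-1"] by auto
  show "independent {x, y, z}"
  proof (rule independent_if_scalars_zero)
    fix f w assume "(\<Sum>x\<in>{x, y, z}. f x *\<^sub>R x) = 0" "w \<in> {x, y, z}"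
    then show "f w = 0" using d assms[of "f x" "f y" "f z"] by (auto simp: add.assoc)
  qed simp
qed

lemma frame_independent:
  "independent {graph1 p u, graph2 q u, vertical u}" "graph1 p u \<noteq> graph2 q u"
  "graph2 q u \<noteq> vertical u" "graph1 p u \<noteq> vertical u"
proof -
  have "a = 0 \<and> b = 0 \<and> c = 0" if "a *\<^sub>R graph1 p u + b *\<^sub>R graph2 q u + c *\<^sub>R vertical u = 0" for a b c
  proof -
    have "(a *\<^sub>R graph1 p u + b *\<^sub>R graph2 q u + c *\<^sub>R vertical u) $ i = 0" for i using that by simp
    from this[of 1] this[of 2] this[of 3] show ?thesis
      by (simp add: graph1_def graph2_def vertical_def)
  qed
  then show "independent {graph1 p u, graph2 q u, vertical u}" "graph1 p u \<noteq> graph2 q u"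
    "graph2 q u \<noteq> vertical u" "graph1 p u \<noteq> vertical u"
    using independent_3I[of "graph1 p u" "graph2 q u" "vertical u"] by blast+
qed

text \<open>\<open>D1 p\<close>, \<open>D1 q\<close>, \<open>D2 p\<close>, \<open>D2 q\<close> are
  the Christoffel symbols with upper index 3 for the lower indices 11, 12, 21, 22.\<close>

locale entire_graph = graph UNIV p q for p q +
  assumes nondegenerate: "D1 q 0 \<noteq> 0" "D2 p 0 \<noteq> 0" "D1 q 0 \<noteq> D2 p 0" "D2 q 0 * D1 p 0 - 9 * D1 q 0 * D2 p 0 \<noteq> 0"
begin

abbreviation "r \<equiv> graph_frame p q"

lemma r_simps: "r 1 = graph1 p" "r (Suc 0) = graph1 p" "r 2 = graph2 q" "r 3 = vertical"
  by (simp_all add: graph_frame_def)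

lemma partial_frame: "partial_frame_on U {1..3} r" "partial_frame_on U {1,2} r"
proof -
  have s: "smooth_on U (r i)" if "i \<in> {1..3}" for i
    using smooth_graph(1)[OF open_UNIV smooth_p] smooth_graph(2)[OF open_UNIV smooth_q] smooth_graph(3)[OF open_UNIV]
    by (auto simp: graph_frame_def intro: smooth_on_subset)
  have 13: "{1..3::nat} = {1, 2, 3}" by auto
  have i: "inj_on (\<lambda>i. r i u) {1..3}" "(\<lambda>i. r i u) ` {1..3} = {graph1 p u, graph2 q u, vertical u}" for u
    using frame_independent(2-4)[where u = u] frame_independent(2-4)[where u = u, THEN not_sym] unfolding 13 by (auto simp: graph_frame_def inj_on_def)
  show "partial_frame_on U {1..3} r"
    using s i frame_independent by (simp add: partial_frame_on_def)
  have "independent ((\<lambda>i. r i u) ` {1,2})" for u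
    by (rule independent_mono[OF frame_independent(1)[of p u q]]) (auto simp: graph_frame_def)
  moreover have "inj_on (\<lambda>i. r i u) {1,2}" for u by (rule inj_on_subset[OF i(1)]) auto
  ultimately show "partial_frame_on U {1,2} r"
    using s by (simp add: partial_frame_on_def)
qed

lemma vertical_multiple_span: "t *\<^sub>R vertical u \<in> span {r 1 u, r 2 u} \<Longrightarrow> t = 0"
proof -
  assume "t *\<^sub>R vertical u \<in> span {r 1 u, r 2 u}"
  then obtain a b where "t *\<^sub>R vertical u = b *\<^sub>R graph2 q u + a *\<^sub>R graph1 p u"
    by (auto simp: span_insert span_singleton r_simps diff_eq_eq)
  then have "(t *\<^sub>R vertical u) $ i = (b *\<^sub>R graph2 q u + a *\<^sub>R graph1 p u) $ i" for i by simp
  from this[of 1] this[of 2] this[of 3] show "t = 0"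
    by (simp add: graph1_def graph2_def vertical_def)
qed

lemma christoffel_vertical:
  assumes "nabla (r i) (r j) u = t *\<^sub>R vertical u" shows "christoffel r i j 3 u = t"
proof -
  have "nabla (r i) (r j) u = (\<Sum>k=1..3. christoffel r i j k u *\<^sub>R r k u)"
    by (rule nabla_christoffel[OF partial_frame(1) UNIV_I])
  then have "(t *\<^sub>R vertical u) $ l = (\<Sum>k=1..3. christoffel r i j k u *\<^sub>R r k u) $ l" for l
    using assms by simp
  from this[of 1] this[of 2] this[of 3] show ?thesis
    by (simp add: eval_nat_numeral graph_frame_def graph1_def graph2_def vertical_def)
qed

lemma nabla_r:
  "nabla (r 1) (r 1) u = D1 p u *\<^sub>R vertical u" "nabla (r 1) (r 2) u = D1 q u *\<^sub>R vertical u"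
  "nabla (r 2) (r 1) u = D2 p u *\<^sub>R vertical u" "nabla (r 2) (r 2) u = D2 q u *\<^sub>R vertical u"
  unfolding nabla_eq_dirD r_simps by (simp_all add: dirD_graph)

lemma hypotheses:
  "lie_bracket (r 1) (r 2) 0 \<notin> span {r 1 0, r 2 0}"
  "nabla (r 1) (r 2) 0 \<notin> span {r 1 0, r 2 0}"
  "nabla (r 2) (r 1) 0 \<notin> span {r 1 0, r 2 0}"
  "christoffel r 2 2 3 0 * christoffel r 1 1 3 0 - 9 * christoffel r 1 2 3 0 * christoffel r 2 1 3 0 \<noteq> 0"
proof -
  have "lie_bracket (r 1) (r 2) 0 = c 0 *\<^sub>R vertical 0"
    unfolding r_simps by (rule bracket_graph) simp
  then show "lie_bracket (r 1) (r 2) 0 \<notin> span {r 1 0, r 2 0}"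
    using vertical_multiple_span[of "c 0" 0] nondegenerate by (auto simp: c_def)
  show "nabla (r 1) (r 2) 0 \<notin> span {r 1 0, r 2 0}" "nabla (r 2) (r 1) 0 \<notin> span {r 1 0, r 2 0}"
    using vertical_multiple_span nondegenerate unfolding nabla_r by blast+
  show "christoffel r 2 2 3 0 * christoffel r 1 1 3 0 - 9 * christoffel r 1 2 3 0 * christoffel r 2 1 3 0 \<noteq> 0"
    using nondegenerate unfolding nabla_r[THEN christoffel_vertical] by simp
qed

lemma generic_frame: obtains \<Omega> where "generic_frame 0 r \<Omega>"
  using generic_frame_neighborhood[OF open_UNIV UNIV_I partial_frame(2) hypotheses(1-3) UNIV_I partial_frame(1) hypotheses(4)]
  by blast

end

section \<open>Differential relations for fluxes of a graph frame\<close>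

locale graph_flux = graph V p q + flux_pair V "graph1 p" "graph2 q" f l1 l2 for V p q f l1 l2
begin

text \<open>\<open>a\<close>, \<open>b\<close>, \<open>e\<close> are the components of \<open>DS f\<close> relative to the frame, \<open>m\<close> and \<open>m'\<close> the differences between
  the eigenvalues and the third component.\<close>

definition "a = DS (\<lambda>u. f u $ 1)"
definition "b = DS (\<lambda>u. f u $ 2)"
definition "e u = DS (\<lambda>u. f u $ 3) u - p u * a u - q u * b u"
definition "m u = l1 u - e u"
definition "m' u = l2 u - e u"
definition "w1 = D1 a"
definition "w2 = D2 b"

lemmas smooth_DS = smooth_on_dirD[OF S _ smooth_graph(3)[OF S]]

lemma smooth_ab: "smooth_on V a" "smooth_on V b" "smooth_on V e" "smooth_on V m" "smooth_on V m'"
  "smooth_on V w1" "smooth_on V w2"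
proof -
  show ab: "smooth_on V a" "smooth_on V b"
    unfolding a_def b_def by (intro smooth_DS smooth_on_nth smooth_f S)+
  show e: "smooth_on V e"
    unfolding e_def[abs_def] by (intro smooth_intros smooth_DS smooth_f S ab smooth_p smooth_q)
  show "smooth_on V m" "smooth_on V m'" "smooth_on V w1" "smooth_on V w2"
    unfolding m_def[abs_def] m'_def[abs_def] w1_def w2_def
    by (intro smooth_intros e ab S smooth_l1 smooth_l2 smooth_r1 smooth_r2)+
qed

lemmas sm = smooth_ab smooth_l1 smooth_l2 smooth_rules smooth_on_nth[OF S smooth_f]

lemma components:
  assumes u: "u \<in> V"
  shows "D1 (\<lambda>u. f u $ 1) u = l1 u" "D1 (\<lambda>u. f u $ 2) u = 0" "D1 (\<lambda>u. f u $ 3) u = l1 u * p u"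
    "D2 (\<lambda>u. f u $ 1) u = 0" "D2 (\<lambda>u. f u $ 2) u = l2 u" "D2 (\<lambda>u. f u $ 3) u = l2 u * q u"
  using dirD_linear[OF bounded_linear_vec_nth smooth_f u] eigen1[OF u] eigen2[OF u]
  by (simp_all add: graph1_def graph2_def)

text \<open>\<open>DS\<close> commutes with \<open>D2\<close>, and the first component of
  \<open>f\<close> is constant along \<open>graph2 q\<close>. The next three lemmas transport other
  component equations in the same way.\<close>

lemma D2a: assumes u: "u \<in> V" shows "D2 a u = 0"
  unfolding a_def using commute_S(2)[OF smooth_on_nth[OF S smooth_f] u] dirD_cong[OF S u components(4)]
  by (simp add: dirD_const)

lemma D1b: assumes u: "u \<in> V" shows "D1 b u = 0"
  unfolding b_def using commute_S(1)[OF smooth_on_nth[OF S smooth_f] u] dirD_cong[OF S u components(2)]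
  by (simp add: dirD_const)

lemma Sl1: assumes u: "u \<in> V" shows "DS l1 u = w1 u"
  unfolding a_def w1_def using commute_S(1)[OF smooth_on_nth[OF S smooth_f] u] dirD_cong[OF S u components(1)]
  by simp

lemma Sl2: assumes u: "u \<in> V" shows "DS l2 u = w2 u"
  unfolding b_def w2_def using commute_S(2)[OF smooth_on_nth[OF S smooth_f] u] dirD_cong[OF S u components(5)]
  by simp

lemma D2l1: assumes u: "u \<in> V" shows "D2 l1 u = - c u * a u"
  using commute_12[OF smooth_on_nth[OF S smooth_f] u, of 1] dirD_cong[OF S u components(1), where v = "graph2 q"]
    dirD_cong[OF S u components(4), where v = "graph1 p"]
  by (simp add: dirD_const a_def)

lemma D1l2: assumes u: "u \<in> V" shows "D1 l2 u = c u * b u"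
  using commute_12[OF smooth_on_nth[OF S smooth_f] u, of 2] dirD_cong[OF S u components(5), where v = "graph1 p"]
    dirD_cong[OF S u components(2), where v = "graph2 q"]
  by (simp add: dirD_const b_def)

text \<open>The commutator on the third component of \<open>f\<close>: once \<open>D1l2\<close> and
  \<open>D2l1\<close> replace the derivatives of the eigenvalues, what remains is algebraic, with
  \<open>e\<close> as the common shift.\<close>

lemma constraint:
  assumes u: "u \<in> V" shows "D1 q u * m' u = D2 p u * m u"
proof -
  have "D1 (D2 (\<lambda>u. f u $ 3)) u = D1 l2 u * q u + l2 u * D1 q u"
    using dirD_cong[OF S u components(6)] dirD_mult[OF smooth_l2 smooth_q u] by simp
  moreover have "D2 (D1 (\<lambda>u. f u $ 3)) u = D2 l1 u * p u + l1 u * D2 p u"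
    using dirD_cong[OF S u components(3)] dirD_mult[OF smooth_l1 smooth_p u] by simp
  ultimately show ?thesis
    using commute_12[OF smooth_on_nth[OF S smooth_f] u, of 3] D1l2[OF u] D2l1[OF u]
    unfolding m_def m'_def e_def c_def by algebra
qed

lemma D_e:
  assumes u: "u \<in> V"
  shows "D1 e u = - (D1 p u * a u + D1 q u * b u)" "D2 e u = - (D2 p u * a u + D2 q u * b u)"
proof -
  have "DS (\<lambda>u. l1 u * p u) u = w1 u * p u" "DS (\<lambda>u. l2 u * q u) u = w2 u * q u"
    using u by (simp_all add: dirD_mult[OF smooth_l1 smooth_p] dirD_mult[OF smooth_l2 smooth_q] vertical_pq Sl1 Sl2)
  then have "D1 (DS (\<lambda>u. f u $ 3)) u = w1 u * p u" "D2 (DS (\<lambda>u. f u $ 3)) u = w2 u * q u"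
    using commute_S[OF smooth_on_nth[OF S smooth_f] u, of 3] dirD_cong[OF S u components(3), where v = vertical]
      dirD_cong[OF S u components(6), where v = vertical] by simp_all
  then show "D1 e u = - (D1 p u * a u + D1 q u * b u)" "D2 e u = - (D2 p u * a u + D2 q u * b u)"
    unfolding e_def[abs_def]
    using u by (simp_all add: dirD_rules sm D2a D1b w1_def[symmetric] w2_def[symmetric] algebra_simps)
qed

lemma D2m: "u \<in> V \<Longrightarrow> D2 m u = (2 * D2 p u - D1 q u) * a u + D2 q u * b u"
  unfolding m_def[abs_def] by (simp add: dirD_rules sm D2l1 D_e c_def algebra_simps)

lemma D1m': "u \<in> V \<Longrightarrow> D1 m' u = (2 * D1 q u - D2 p u) * b u + D1 p u * a u"
  unfolding m'_def[abs_def] by (simp add: dirD_rules sm D1l2 D_e c_def algebra_simps)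

lemma Smm': "u \<in> V \<Longrightarrow> DS (\<lambda>u. m u - m' u) u = w1 u - w2 u"
  using dirD_cong[OF S, of u "\<lambda>u. m u - m' u" "\<lambda>u. l1 u - l2 u" vertical] dirD_diff[OF smooth_l1 smooth_l2, of u vertical]
  by (simp add: m_def m'_def Sl1 Sl2)

lemma D1w2: assumes u: "u \<in> V" shows "D1 w2 u = c u * DS b u"
  using commute_12[OF smooth_ab(2) u] dirD_cong[OF S u D1b, where v = "graph2 q"] by (simp add: w2_def dirD_const)

lemma D2w1: assumes u: "u \<in> V" shows "D2 w1 u = - c u * DS a u"
  using commute_12[OF smooth_ab(1) u] dirD_cong[OF S u D2a, where v = "graph1 p"] by (simp add: w1_def dirD_const)

lemma D_Sa: assumes u: "u \<in> V" shows "D1 (DS a) u = DS w1 u" "D2 (DS a) u = 0"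
  using commute_S[OF smooth_ab(1) u] dirD_cong[OF S u D2a, where v = vertical] by (simp_all add: w1_def dirD_const)

lemma D1Sb: assumes u: "u \<in> V" shows "D1 (DS b) u = 0"
  using commute_S[OF smooth_ab(2) u] dirD_cong[OF S u D1b, where v = vertical] by (simp add: dirD_const)

lemmas D_base = D2a D1b D1w2 D2w1 D_Sa D1Sb w1_def[symmetric] w2_def[symmetric]

end

section \<open>Examples of dimension two, three and four\<close>

lemma dirD_divide:
  fixes f :: "_ \<Rightarrow> real"
  shows "smooth_on S f \<Longrightarrow> u \<in> S \<Longrightarrow> dirD v (\<lambda>x. f x / k) u = dirD v f u / k"
  by (rule dirD_linear[OF bounded_linear_divide])

lemma smooth_on_divide_const:
  fixes f :: "_ \<Rightarrow> real"
  shows "open S \<Longrightarrow> smooth_on S f \<Longrightarrow> smooth_on S (\<lambda>x. f x / k)"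
  by (rule smooth_on_linear[OF _ bounded_linear_divide])

text \<open>The functions are chosen such that \<open>\<partial>p/\<partial>y = - Q\<close> and \<open>\<partial>q/\<partial>x = Q\<close> with \<open>Q\<close> depending on \<open>x\<close> only, so that
  \<open>m' = - m\<close>. The flux space has dimension 4 for \<open>Q = 1\<close>, 3 for \<open>Q = 1 + 2x\<close> and 2 for \<open>Q = 1 + x\<^sup>2\<close>.\<close>

definition Qf :: "real \<Rightarrow> real \<Rightarrow> real^3 \<Rightarrow> real" where "Qf \<alpha> \<beta> u = 1 + \<alpha> * u $ 1 + \<beta> * (u $ 1 * u $ 1)"
definition p_Q :: "real \<Rightarrow> real \<Rightarrow> real^3 \<Rightarrow> real" where "p_Q \<alpha> \<beta> u = - (Qf \<alpha> \<beta> u * u $ 2)"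
definition q_Q :: "real \<Rightarrow> real \<Rightarrow> real^3 \<Rightarrow> real" where
  "q_Q \<alpha> \<beta> u = u $ 1 + \<alpha> / 2 * (u $ 1 * u $ 1) + \<beta> / 3 * (u $ 1 * (u $ 1 * u $ 1))"

lemma smooth_Q:
  assumes S: "open S" shows "smooth_on S (Qf \<alpha> \<beta>)" "smooth_on S (p_Q \<alpha> \<beta>)" "smooth_on S (q_Q \<alpha> \<beta>)"
proof -
  show Q: "smooth_on S (Qf \<alpha> \<beta>)"
    unfolding Qf_def[abs_def] by (intro smooth_intros S)
  show "smooth_on S (p_Q \<alpha> \<beta>)" "smooth_on S (q_Q \<alpha> \<beta>)"
    unfolding p_Q_def[abs_def] q_Q_def[abs_def] by (intro smooth_intros S Q)+
qed

lemma dirD_Qf: "dirD v (Qf \<alpha> \<beta>) u = (\<alpha> + 2 * \<beta> * u $ 1) * v u $ 1"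
  unfolding Qf_def[abs_def]
  by (simp add: dirD_add[of UNIV] dirD_mult[of UNIV] dirD_const dirD_nth smooth_intros algebra_simps)

lemma dirD_p_Q: "dirD v (p_Q \<alpha> \<beta>) u = - ((\<alpha> + 2 * \<beta> * u $ 1) * v u $ 1 * u $ 2 + Qf \<alpha> \<beta> u * v u $ 2)"
  unfolding p_Q_def[abs_def]
  by (simp add: dirD_minus[of UNIV] dirD_mult[of UNIV] dirD_nth smooth_intros smooth_Q dirD_Qf)

lemma dirD_q_Q: "dirD v (q_Q \<alpha> \<beta>) u = Qf \<alpha> \<beta> u * v u $ 1"
  unfolding q_Q_def[abs_def]
  by (simp add: dirD_add[of UNIV] dirD_mult[of UNIV] dirD_divide[of UNIV] dirD_const dirD_nth
      smooth_intros smooth_on_divide_const) (simp add: Qf_def algebra_simps)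

lemma graph_Q: "open S \<Longrightarrow> graph S (p_Q \<alpha> \<beta>) (q_Q \<alpha> \<beta>)"
  by unfold_locales (auto simp: smooth_Q dirD_p_Q dirD_q_Q vertical_def)

locale Q_flux = graph_flux V "p_Q \<alpha> \<beta>" "q_Q \<alpha> \<beta>" f l1 l2 for V \<alpha> \<beta> f l1 l2 +
  assumes Q_nonzero: "\<And>u. u \<in> V \<Longrightarrow> Qf \<alpha> \<beta> u \<noteq> 0"
begin

abbreviation "Q \<equiv> Qf \<alpha> \<beta>"
definition "Q1 u = \<alpha> + 2 * \<beta> * u $ 1"

lemma smooth_Q1: "smooth_on V Q1" "smooth_on V Q"
  unfolding Q1_def[abs_def] by (intro smooth_intros S smooth_Q)+

lemma D_pq: "D1 (q_Q \<alpha> \<beta>) u = Q u" "D2 (q_Q \<alpha> \<beta>) u = 0" "D2 (p_Q \<alpha> \<beta>) u = - Q u"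
  "D1 (p_Q \<alpha> \<beta>) u = - (Q1 u * u $ 2)" "c u = 2 * Q u"
  by (simp_all add: dirD_q_Q dirD_p_Q graph1_def graph2_def Q1_def c_def)

lemma D_Q: "D1 Q u = Q1 u" "D2 Q u = 0" "D1 Q1 u = 2 * \<beta>" "D2 Q1 u = 0"
proof -
  show "D1 Q u = Q1 u" "D2 Q u = 0" by (simp_all add: dirD_Qf graph1_def graph2_def Q1_def)
  show "D1 Q1 u = 2 * \<beta>" "D2 Q1 u = 0"
    unfolding Q1_def[abs_def]
    by (simp_all add: dirD_add[of UNIV] dirD_mult[of UNIV] dirD_const dirD_nth smooth_intros graph1_def graph2_def)
qed

lemmas smq = sm smooth_Q1 smooth_DS

lemma m': "u \<in> V \<Longrightarrow> m' u = - m u"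
  using constraint[of u] Q_nonzero[of u] by (simp add: D_pq) algebra

lemma D2m_Q: "u \<in> V \<Longrightarrow> D2 m u = - 3 * Q u * a u"
  by (simp add: D2m D_pq)

lemma D1m_Q: assumes u: "u \<in> V" shows "D1 m u = Q1 u * u $ 2 * a u - 3 * Q u * b u"
  using dirD_cong[OF S u m', of "\<lambda>x. x" "graph1 (p_Q \<alpha> \<beta>)"] D1m'[OF u] dirD_minus[OF smooth_ab(4) u]
  by (simp add: D_pq)

lemma Sm: assumes u: "u \<in> V" shows "2 * DS m u = w1 u - w2 u"
  using Smm'[OF u] dirD_cong[OF S u, of "\<lambda>u. m u - m' u" "\<lambda>u. m u + m u" vertical]
    dirD_add[OF smooth_ab(4,4) u, of vertical] by (simp add: m')

text \<open>The commutator applied to \<open>m\<close>: \<open>w1\<close> and \<open>w2\<close>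
  enter only through their difference, which \<open>Sm\<close> turns into
  \<open>2 * DS m\<close>.\<close>

lemma QSm: assumes u: "u \<in> V" shows "2 * Q u * DS m u = - (Q1 u * a u)"
proof -
  have "D1 (D2 m) u = - 3 * Q1 u * a u - 3 * Q u * w1 u"
    using dirD_cong[OF S u D2m_Q, of "\<lambda>x. x" "graph1 (p_Q \<alpha> \<beta>)"] u
    by (simp add: dirD_rules smq D_Q w1_def)
  moreover have "D2 (D1 m) u = Q1 u * a u - 3 * Q u * w2 u"
    using dirD_cong[OF S u D1m_Q, of "\<lambda>x. x" "graph2 (q_Q \<alpha> \<beta>)"] u
    by (simp add: dirD_rules smq D_Q D2a w2_def)
  ultimately show ?thesis
    using commute_12[OF smooth_ab(4) u] Sm[OF u] unfolding D_pq by algebra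
qed

text \<open>The right side of \<open>QSm\<close> is constant along the second field, while
  \<open>DS\<close> of \<open>D2m_Q\<close> yields a multiple of \<open>DS a\<close>.\<close>

lemma Sa: assumes u: "u \<in> V" shows "DS a u = 0"
proof -
  have "2 * Q u * D2 (DS m) u = 0"
    using dirD_cong[OF S u QSm, of "\<lambda>x. x" "graph2 (q_Q \<alpha> \<beta>)"] u
    by (simp add: dirD_rules smq D_Q D2a)
  moreover have "D2 (DS m) u = - 3 * Q u * DS a u"
    using commute_S(2)[OF smooth_ab(4) u] dirD_cong[OF S u D2m_Q, of "\<lambda>x. x" vertical] u
    by (simp add: dirD_rules smq dirD_Qf)
  ultimately show ?thesis using Q_nonzero[OF u] by simp
qed

lemma D1Sm: assumes u: "u \<in> V" shows "D1 (DS m) u = - 3 * Q u * DS b u"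
  using commute_S(1)[OF smooth_ab(4) u] dirD_cong[OF S u D1m_Q, of "\<lambda>x. x" vertical] u
  by (simp add: dirD_rules smq dirD_Qf Sa Q1_def[abs_def])

text \<open>Successive derivatives of \<open>QSm\<close> along the first field give this relation,
  \<open>relation5\<close> and \<open>relation6\<close>; the last isolates
  \<open>DS b\<close>.\<close>

lemma relation3: assumes u: "u \<in> V"
  shows "2 * Q1 u * DS m u - 6 * (Q u * Q u) * DS b u = - (2 * \<beta> * a u) - Q1 u * w1 u"
  using dirD_cong[OF S u QSm, of "\<lambda>x. x" "graph1 (p_Q \<alpha> \<beta>)"] u
  by (simp add: dirD_rules smq D_Q D1Sm w1_def algebra_simps)

lemma D1w1: assumes u: "u \<in> V" shows "D1 w1 u = - 4 * Q u * DS b u"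
  using dirD_cong[OF S u Sm, of "\<lambda>x. x" "graph1 (p_Q \<alpha> \<beta>)"] u
  by (simp add: dirD_rules smq D1Sm D1w2 D_pq)

lemma relation5: assumes u: "u \<in> V"
  shows "2 * \<beta> * DS m u + 2 * \<beta> * w1 u = 11 * (Q u * Q1 u) * DS b u"
  using dirD_cong[OF S u relation3, of "\<lambda>x. x" "graph1 (p_Q \<alpha> \<beta>)"] u
  by (simp add: dirD_rules smq D_Q D1Sm D1Sb D1w1 w1_def[symmetric] algebra_simps)

lemma relation6: assumes u: "u \<in> V"
  shows "(36 * Q u * \<beta> + 11 * (Q1 u * Q1 u)) * DS b u = 0"
proof -
  have "2 * \<beta> * (- 3 * Q u * DS b u) + 2 * \<beta> * (- 4 * Q u * DS b u)
      = 11 * (Q u * (2 * \<beta>) + Q1 u * Q1 u) * DS b u"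
    using dirD_cong[OF S u relation5, of "\<lambda>x. x" "graph1 (p_Q \<alpha> \<beta>)"] u
    by (simp add: dirD_rules smq D_Q D1Sm D1Sb D1w1 algebra_simps)
  then show ?thesis by algebra
qed

lemma relations_origin:
  assumes "0 \<in> V"
  shows "2 * DS m 0 = - (\<alpha> * a 0)" "2 * \<alpha> * DS m 0 - 6 * DS b 0 = - (2 * \<beta> * a 0) - \<alpha> * w1 0"
    "2 * \<beta> * DS m 0 + 2 * \<beta> * w1 0 = 11 * \<alpha> * DS b 0" "(36 * \<beta> + 11 * (\<alpha> * \<alpha>)) * DS b 0 = 0"
  using QSm[OF assms] relation3[OF assms] relation5[OF assms] relation6[OF assms]
  by (simp_all add: Qf_def Q1_def)

end

section \<open>Examples of dimension zero and one\<close>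

text \<open>Here \<open>q = x\<close> and \<open>P = \<partial>p/\<partial>y\<close>. The pair \<open>(\<xi>, \<epsilon>) = (0, 1)\<close> gives dimension 1, and \<open>(1, 0)\<close> gives 0: a flux
  with \<open>a = b = 0\<close> and \<open>m \<noteq> 0\<close> exists only if \<open>\<partial>P/\<partial>x = 0\<close>.\<close>

definition p_P :: "real \<Rightarrow> real \<Rightarrow> real^3 \<Rightarrow> real" where
  "p_P \<xi> \<epsilon> u = u $ 2 * u $ 2 - u $ 2 + \<xi> * (u $ 1 * u $ 2) + \<epsilon> * (u $ 1 * u $ 1)"
definition Pf :: "real \<Rightarrow> real^3 \<Rightarrow> real" where "Pf \<xi> u = 2 * u $ 2 - 1 + \<xi> * u $ 1"

lemma smooth_P:
  assumes S: "open S" shows "smooth_on S (Pf \<xi>)" "smooth_on S (p_P \<xi> \<epsilon>)"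
  unfolding Pf_def[abs_def] p_P_def[abs_def] by (intro smooth_intros S)+

lemma dirD_Pf: "dirD v (Pf \<xi>) u = 2 * v u $ 2 + \<xi> * v u $ 1"
  unfolding Pf_def[abs_def]
  by (simp add: dirD_add[of UNIV] dirD_diff[of UNIV] dirD_mult[of UNIV] dirD_const dirD_nth smooth_intros)

lemma dirD_p_P: "dirD v (p_P \<xi> \<epsilon>) u = (\<xi> * u $ 2 + 2 * \<epsilon> * u $ 1) * v u $ 1 + Pf \<xi> u * v u $ 2"
  unfolding p_P_def[abs_def]
  by (simp add: dirD_add[of UNIV] dirD_diff[of UNIV] dirD_mult[of UNIV] dirD_const dirD_nth smooth_intros)
     (simp add: Pf_def algebra_simps)

lemma graph_P: "open S \<Longrightarrow> graph S (p_P \<xi> \<epsilon>) (\<lambda>u. u $ 1)"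
  by unfold_locales (auto simp: smooth_P dirD_p_P dirD_nth vertical_def intro: smooth_intros)

locale P_flux = graph_flux V "p_P \<xi> \<epsilon>" "\<lambda>u. u $ 1" f l1 l2 for V \<xi> \<epsilon> f l1 l2 +
  assumes P_nonzero: "\<And>u. u \<in> V \<Longrightarrow> Pf \<xi> u \<noteq> 0" "\<And>u. u \<in> V \<Longrightarrow> Pf \<xi> u \<noteq> 1"
begin

abbreviation "P \<equiv> Pf \<xi>"
definition "E u = \<xi> * u $ 2 + 2 * \<epsilon> * u $ 1"
abbreviation "v1 \<equiv> graph1 (p_P \<xi> \<epsilon>)"
abbreviation "v2 \<equiv> graph2 (\<lambda>u. u $ 1)"

lemma smooth_E: "smooth_on V E" "smooth_on V P"
  unfolding E_def[abs_def] by (intro smooth_intros S smooth_P)+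

lemma D_pq: "D1 (\<lambda>u. u $ 1) u = 1" "D2 (\<lambda>u. u $ 1) u = 0" "D2 (p_P \<xi> \<epsilon>) u = P u"
  "D1 (p_P \<xi> \<epsilon>) u = E u" "c u = 1 - P u"
  by (simp_all add: dirD_nth dirD_p_P graph1_def graph2_def E_def c_def)

lemma D_PE: "D1 P u = \<xi>" "D2 P u = 2" "D1 E u = 2 * \<epsilon>" "D2 E u = \<xi>" "DS P u = 0" "DS E u = 0"
  unfolding E_def[abs_def] dirD_Pf
  by (simp_all add: dirD_add[of UNIV] dirD_mult[of UNIV] dirD_const dirD_nth smooth_intros
      graph1_def graph2_def vertical_def)

lemmas smp = sm smooth_E smooth_DS

lemma m': "u \<in> V \<Longrightarrow> m' u = P u * m u"
  using constraint[of u] by (simp add: D_pq)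

lemma D2m_P: "u \<in> V \<Longrightarrow> D2 m u = (2 * P u - 1) * a u"
  by (simp add: D2m D_pq)

lemma D1m_P: assumes u: "u \<in> V" shows "P u * D1 m u + \<xi> * m u = (2 - P u) * b u + E u * a u"
  using dirD_cong[OF S u m', of "\<lambda>x. x" v1] D1m'[OF u] u
  by (simp add: dirD_rules smp D_pq D_PE)

lemma Sm: assumes u: "u \<in> V" shows "(1 - P u) * DS m u = w1 u - w2 u"
  using Smm'[OF u] dirD_cong[OF S u, of "\<lambda>u. m u - m' u" "\<lambda>u. (1 - P u) * m u" vertical] u
  by (simp add: dirD_rules smp D_PE m' algebra_simps)

text \<open>The commutator identity for \<open>m\<close>, with \<open>D1 m\<close> eliminated
  through \<open>D1m_P\<close> at the cost of factors \<open>P\<close>. The numbered relations are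
  its derivatives.\<close>

lemma relation_m: assumes u: "u \<in> V"
  shows "2 * (P u * P u) * (1 - P u) * w1 u + 2 * P u * (1 - P u) * w2 u
    = P u * (4 * P u - 2) * \<xi> * a u + 4 * b u + 2 * E u * a u - 2 * \<xi> * m u"
proof -
  have 1: "D1 (D2 m) u = 2 * \<xi> * a u + (2 * P u - 1) * w1 u"
    using dirD_cong[OF S u D2m_P, of "\<lambda>x. x" v1] u
    by (simp add: dirD_rules smp D_PE w1_def)
  have 2: "P u * D2 (D1 m) u + 2 * D1 m u + \<xi> * D2 m u = - 2 * b u + (2 - P u) * w2 u + \<xi> * a u"
    using dirD_cong[OF S u D1m_P, of "\<lambda>x. x" v2] u
    by (simp add: dirD_rules smp D_PE D2a w2_def)
  have 3: "D1 (D2 m) u - D2 (D1 m) u = w1 u - w2 u"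
    using commute_12[OF smooth_ab(4) u] Sm[OF u] by (simp add: D_pq)
  show ?thesis using 1 2 3 D2m_P[OF u] D1m_P[OF u] by algebra
qed

lemma D_Sm: assumes u: "u \<in> V"
  shows "P u * D1 (DS m) u + \<xi> * DS m u = (2 - P u) * DS b u + E u * DS a u" "D2 (DS m) u = (2 * P u - 1) * DS a u"
  using commute_S[OF smooth_ab(4) u] dirD_cong[OF S u D1m_P, of "\<lambda>x. x" vertical]
    dirD_cong[OF S u D2m_P, of "\<lambda>x. x" vertical] u
  by (simp_all add: dirD_rules(1-5) smp D_PE)

lemma D1w1: assumes u: "u \<in> V"
  shows "P u * D1 w1 u = 2 * (1 - P u) * DS b u + (1 - P u) * E u * DS a u - \<xi> * DS m u"
proof -
  have "- \<xi> * DS m u + (1 - P u) * D1 (DS m) u = D1 w1 u - (1 - P u) * DS b u"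
    using dirD_cong[OF S u Sm, of "\<lambda>x. x" v1] u
    by (simp add: dirD_rules smp D_PE D1w2 D_pq)
  then show ?thesis using D_Sm(1)[OF u] by algebra
qed

lemma D2w2: assumes u: "u \<in> V"
  shows "D2 w2 u = 2 * DS m u - 2 * P u * (1 - P u) * DS a u"
proof -
  have "- 2 * DS m u + (1 - P u) * D2 (DS m) u = - (1 - P u) * DS a u - D2 w2 u"
    using dirD_cong[OF S u Sm, of "\<lambda>x. x" v2] u
    by (simp add: dirD_rules smp D_PE D2w1 D_pq)
  then show ?thesis using D_Sm(2)[OF u] by algebra
qed

lemma relation_2: assumes u: "u \<in> V"
  shows "2 * (1 - P u) * w1 u - 2 * w2 u - P u * ((1 - P u) * (1 - P u)) * DS a u = 2 * \<xi> * a u"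
proof -
  have "6 * P u * (2 * (1 - P u) * w1 u - 2 * w2 u - P u * ((1 - P u) * (1 - P u)) * DS a u - 2 * \<xi> * a u) = 0"
    using dirD_cong[OF S u relation_m, of "\<lambda>x. x" v2] u Sm[OF u] D2w2[OF u]
    by (simp add: dirD_rules smp D_PE D_base D2m_P D_pq) algebra
  then show ?thesis using P_nonzero(1)[OF u] by simp
qed

lemma relation_1: assumes u: "u \<in> V"
  shows "P u * (\<xi> * (4 * P u - 10 * (P u * P u)) - 2 * E u) * w1 u + 2 * P u * (1 - P u) * \<xi> * w2 u
      + 6 * (P u * P u) * ((1 - P u) * (1 - P u)) * DS b u + 2 * (P u * P u) * ((1 - P u) * (1 - P u)) * E u * DS a u
    = P u * (8 * P u - 2) * (\<xi> * \<xi>) * a u + 4 * P u * \<epsilon> * a u - 2 * \<xi> * ((2 - P u) * b u + E u * a u - \<xi> * m u)"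
  using dirD_cong[OF S u relation_m, of "\<lambda>x. x" v1] u Sm[OF u] D1w1[OF u] D1m_P[OF u]
  by (simp add: dirD_rules smp D_PE D_base D_pq) algebra

lemma relation_3: assumes u: "u \<in> V"
  shows "(2 - P u) * w1 u - w2 u = (1 - P u) * (1 - P u) * (3 * P u - 1) * DS a u"
  using dirD_cong[OF S u relation_2, of "\<lambda>x. x" v2] u Sm[OF u] D2w2[OF u]
  by (simp add: dirD_rules smp D_PE D_base D_pq) algebra

text \<open>The third derivative of \<open>relation_m\<close> along the second field isolates
  \<open>DS a\<close>; at the origin, where \<open>P\<close> is -1, the coefficient is -25.\<close>

lemma relation_4: assumes u: "u \<in> V" shows "(15 * P u - 10) * DS a u = 0"
proof -
  have "(1 - P u) * (1 - P u) * ((15 * P u - 10) * DS a u) = 0"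
    using dirD_cong[OF S u relation_3, of "\<lambda>x. x" v2] u Sm[OF u] D2w2[OF u] relation_3[OF u]
    by (simp add: dirD_rules smp D_PE D_base D_pq) algebra
  then show ?thesis using P_nonzero(2)[OF u] by simp
qed

lemma relations_origin:
  assumes 0: "0 \<in> V"
  shows "3 * w1 0 = w2 0" "4 * w1 0 - 2 * w2 0 = 2 * \<xi> * a 0"
    "4 * w1 0 - 4 * w2 0 = 6 * \<xi> * a 0 + 4 * b 0 - 2 * \<xi> * m 0"
    "14 * \<xi> * w1 0 - 4 * \<xi> * w2 0 + 24 * DS b 0
      = 10 * (\<xi> * \<xi>) * a 0 - 4 * \<epsilon> * a 0 - 2 * \<xi> * (3 * b 0 - \<xi> * m 0)"
    "- 4 * \<xi> * w1 0 + 2 * \<xi> * (w1 0 - w2 0) - 20 * DS b 0 = 0"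
    "- 2 * \<xi> * w1 0 + 3 * \<xi> * (w1 0 - w2 0) - 28 * DS b 0 = 0"
proof -
  have PE: "P 0 = -1" "E 0 = 0" by (simp_all add: Pf_def E_def)
  have Sa: "DS a 0 = 0" using relation_4[OF 0] PE by simp
  \<comment> \<open>This is \<open>relation_4\<close> differentiated along the first field, where
    \<open>D1 (DS a)\<close> is \<open>DS w1\<close>.\<close>
  have "15 * \<xi> * DS a 0 + (15 * P 0 - 10) * DS w1 0 = 0"
    using dirD_cong[OF S 0 relation_4, of "\<lambda>x. x" v1] 0
    by (simp add: dirD_rules smp D_PE D_base)
  then have Sw1: "DS w1 0 = 0" using Sa PE by simp
  have Sm: "2 * DS m 0 = w1 0 - w2 0" using Sm[OF 0] unfolding PE by simp
  have D1w1: "D1 w1 0 = \<xi> * DS m 0 - 4 * DS b 0" using D1w1[OF 0] unfolding PE by simp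
  show "3 * w1 0 = w2 0" using relation_3[OF 0] unfolding PE Sa by simp
  show "4 * w1 0 - 2 * w2 0 = 2 * \<xi> * a 0" using relation_2[OF 0] unfolding PE Sa by simp
  show "4 * w1 0 - 4 * w2 0 = 6 * \<xi> * a 0 + 4 * b 0 - 2 * \<xi> * m 0" using relation_m[OF 0] unfolding PE by simp
  show "14 * \<xi> * w1 0 - 4 * \<xi> * w2 0 + 24 * DS b 0
      = 10 * (\<xi> * \<xi>) * a 0 - 4 * \<epsilon> * a 0 - 2 * \<xi> * (3 * b 0 - \<xi> * m 0)"
    using relation_1[OF 0] unfolding PE Sa by simp
  have "- 4 * \<xi> * w1 0 + 4 * D1 w1 0 - 4 * DS b 0 = 0"
    using dirD_cong[OF S 0 relation_2, of "\<lambda>x. x" v1] 0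
    by (simp add: dirD_rules smp D_PE D_base D_pq PE Sa Sw1)
  then show "- 4 * \<xi> * w1 0 + 2 * \<xi> * (w1 0 - w2 0) - 20 * DS b 0 = 0"
    unfolding D1w1 Sm[symmetric] by (simp add: algebra_simps)
  have "- \<xi> * w1 0 + 3 * D1 w1 0 - 2 * DS b 0 = 0"
    using dirD_cong[OF S 0 relation_3, of "\<lambda>x. x" v1] 0
    by (simp add: dirD_rules smp D_PE D_base D_pq PE Sa Sw1)
  then show "- 2 * \<xi> * w1 0 + 3 * \<xi> * (w1 0 - w2 0) - 28 * DS b 0 = 0"
    unfolding D1w1 Sm[symmetric] by (simp add: algebra_simps)
qed

end

section \<open>The theorem\<close>

locale generic_graph = entire_graph p q + generic_frame 0 "graph_frame p q" \<Omega> for p q \<Omega>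
begin

lemma nonzero_on_\<Omega>:
  assumes "u \<in> \<Omega>" shows "D1 q u \<noteq> 0" "D2 p u \<noteq> 0" "c u \<noteq> 0"
proof -
  have "cross3 (graph1 p u) (graph2 q u) \<bullet> vertical u = 1"
    by (simp add: cross3_def inner_3 graph1_def graph2_def vertical_def)
  then show "D1 q u \<noteq> 0" "D2 p u \<noteq> 0" "c u \<noteq> 0"
    using \<Gamma>12[OF assms] \<Gamma>21[OF assms] bracket[OF assms]
    by (auto simp: r_simps dirD_graph bracket_graph)
qed

lemma flux_jetsE:
  assumes "g \<in> fluxes 0 r"
  obtains V f l1 l2 where "graph_flux V p q f l1 l2" "0 \<in> V" "V \<subseteq> \<Omega>"
    "germ_jet 0 g = graph_flux.m p q f l1 0 - graph_flux.m' p q f l2 0"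
    "germ_jet 1 g = c 0 * graph_flux.b f 0" "germ_jet 2 g = - c 0 * graph_flux.a f 0"
    "germ_jet 3 g = c 0 * graph_flux.w1 p f 0"
proof -
  obtain f d where f: "d > 0" "ball 0 d \<subseteq> \<Omega>" "g = germ 0 f"
    "generic_flux_pair (ball 0 d) (r 1) (r 2) f (lam 1 f) (lam 2 f)" and j: "\<And>j. germ_jet j g = jet j f"
    using flux_germE[OF assms] by blast
  interpret fp: flux_pair "ball 0 d" "graph1 p" "graph2 q" f "lam 1 f" "lam 2 f"
    using f(4) unfolding r_simps generic_flux_pair_def by blast
  interpret gf: graph_flux "ball 0 d" p q f "lam 1 f" "lam 2 f"
    by unfold_locales (use smooth_p smooth_q vertical_pq in \<open>auto intro: smooth_on_subset\<close>)
  have 0: "0 \<in> ball (0::real^3) d" using f(1) by simp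
  have "dirD (lie_bracket (graph1 p) (graph2 q)) (lam 1 f) 0 = c 0 * DS (lam 1 f) 0"
    using bracket_graph[of 0] linear_frechet[OF fp.smooth_l1 0] by (simp add: dirD_def linear_scale)
  moreover have "lam 1 f 0 - lam 2 f 0 = gf.m 0 - gf.m' 0"
    unfolding gf.m_def gf.m'_def by simp
  ultimately have "germ_jet 0 g = gf.m 0 - gf.m' 0" "germ_jet 1 g = c 0 * gf.b 0" "germ_jet 2 g = - c 0 * gf.a 0"
    "germ_jet 3 g = c 0 * gf.w1 0"
    unfolding j jet_def r_simps using gf.D1l2[OF 0] gf.D2l1[OF 0] gf.Sl1[OF 0]
    by simp_all
  then show thesis using that[OF gf.graph_flux_axioms 0 f(2)] by blast
qed

text \<open>Triangular fluxes make the first \<open>k\<close> functionals independent, and the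
  relations make the remaining ones vanish wherever those do.\<close>

lemma quotient_dim_exact:
  assumes "k \<le> 4"
    and b: "\<And>i. i < k \<Longrightarrow> b i \<in> fluxes 0 r" "\<And>i. i < k \<Longrightarrow> germ_jet i (b i) \<noteq> 0"
      "\<And>i j. i < k \<Longrightarrow> j < i \<Longrightarrow> germ_jet j (b i) = 0"
    and relation: "\<And>g j. g \<in> fluxes 0 r \<Longrightarrow> (\<And>j. j < k \<Longrightarrow> germ_jet j g = 0) \<Longrightarrow> j < 4 \<Longrightarrow> germ_jet j g = 0"
  shows "quotient_dim (fluxes 0 r) (trivial_fluxes 0) k"
proof -
  have "annihilated k = annihilated 4"
    using assms(1) relation by (auto simp: annihilated_def)
  then show ?thesis
    using quotient_dim_annihilated[of k b, OF b] by (simp add: trivial_fluxes_annihilated)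
qed

lemma explicit_graph_flux:
  assumes s: "smooth_on UNIV f1" "smooth_on UNIV f2" "smooth_on UNIV f3" "smooth_on UNIV l1" "smooth_on UNIV l2"
    and e: "\<And>u. D1 f1 u = l1 u" "\<And>u. D1 f2 u = 0" "\<And>u. D1 f3 u = l1 u * p u"
      "\<And>u. D2 f1 u = 0" "\<And>u. D2 f2 u = l2 u" "\<And>u. D2 f3 u = l2 u * q u"
  defines "g \<equiv> germ 0 (\<lambda>u. vector [f1 u, f2 u, f3 u])"
  shows "g \<in> fluxes 0 r" "germ_jet 0 g = l1 0 - l2 0" "germ_jet 1 g = D1 l2 0" "germ_jet 2 g = D2 l1 0"
    "germ_jet 3 g = c 0 * DS l1 0"
proof -
  have sv: "smooth_on UNIV (\<lambda>u. vector [f1 u, f2 u, f3 u] :: real^3)"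
    by (intro smooth_on_vector_3 s open_UNIV)
  have d1: "dirD (r 1) (\<lambda>u. vector [f1 u, f2 u, f3 u] :: real^3) u = l1 u *\<^sub>R r 1 u" for u
    using dirD_vector_3[OF open_UNIV s(1-3) UNIV_I, of "r 1" u]
    by (simp add: r_simps e vec_eq_iff forall_3 graph1_def)
  have d2: "dirD (r 2) (\<lambda>u. vector [f1 u, f2 u, f3 u] :: real^3) u = l2 u *\<^sub>R r 2 u" for u
    using dirD_vector_3[OF open_UNIV s(1-3) UNIV_I, of "r 2" u]
    by (simp add: r_simps e vec_eq_iff forall_3 graph2_def)
  note x = explicit_flux[OF sv[THEN smooth_on_subset] s(4)[THEN smooth_on_subset] s(5)[THEN smooth_on_subset] d1 d2,
      OF subset_UNIV subset_UNIV subset_UNIV, folded g_def]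
  have "dirD (lie_bracket (graph1 p) (graph2 q)) l1 0 = c 0 * DS l1 0"
    using bracket_graph[of 0] linear_frechet[OF s(4) UNIV_I] by (simp add: dirD_def linear_scale)
  then show "g \<in> fluxes 0 r" "germ_jet 0 g = l1 0 - l2 0" "germ_jet 1 g = D1 l2 0" "germ_jet 2 g = D2 l1 0"
    "germ_jet 3 g = c 0 * DS l1 0"
    using x by (simp_all only: r_simps)
qed

lemma explicit_graph_flux_exists:
  assumes "smooth_on UNIV f1" "smooth_on UNIV f2" "smooth_on UNIV f3" "smooth_on UNIV l1" "smooth_on UNIV l2"
    and "\<And>u. D1 f1 u = l1 u" "\<And>u. D1 f2 u = 0" "\<And>u. D1 f3 u = l1 u * p u"
      "\<And>u. D2 f1 u = 0" "\<And>u. D2 f2 u = l2 u" "\<And>u. D2 f3 u = l2 u * q u"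
  shows "\<exists>g\<in>fluxes 0 r. germ_jet 0 g = l1 0 - l2 0 \<and> germ_jet 1 g = D1 l2 0 \<and> germ_jet 2 g = D2 l1 0
    \<and> germ_jet 3 g = c 0 * DS l1 0"
  using explicit_graph_flux[OF assms] by blast

end

section \<open>The five examples\<close>

definition realizable :: "nat \<Rightarrow> bool" where
  "realizable k \<longleftrightarrow> (\<exists>p q \<Omega>. generic_graph p q \<Omega> \<and>
     quotient_dim (fluxes 0 (graph_frame p q)) (trivial_fluxes 0) k)"

lemma generic_graphE:
  assumes "entire_graph p q" obtains \<Omega> where "generic_graph p q \<Omega>"
  using entire_graph.generic_frame[OF assms] assms unfolding generic_graph_def by blast

lemma less_4_cases: "j < (4::nat) \<longleftrightarrow> j = 0 \<or> j = 1 \<or> j = 2 \<or> j = 3"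
  by auto

lemmas poly_rules = dirD_add[of UNIV] dirD_diff[of UNIV] dirD_minus[of UNIV] dirD_mult[of UNIV] dirD_const dirD_nth dirD_divide[of UNIV]
  smooth_on_divide_const dirD_q_Q smooth_Q smooth_P smooth_on_const smooth_on_id smooth_on_add smooth_on_diff smooth_on_minus smooth_on_mult
  smooth_on_nth graph1_def graph2_def vertical_def

lemma entire_graph_P: "\<xi> = 0 \<or> \<xi> = 1 \<Longrightarrow> entire_graph (p_P \<xi> \<epsilon>) (\<lambda>u. u $ 1)"
proof -
  interpret graph UNIV "p_P \<xi> \<epsilon>" "\<lambda>u. u $ 1" by (rule graph_P) simp
  show ?thesis
    by unfold_locales (simp_all add: dirD_p_P dirD_nth graph1_def graph2_def Pf_def)
qed

lemma entire_graph_Q: "entire_graph (p_Q \<alpha> \<beta>) (q_Q \<alpha> \<beta>)"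
proof -
  interpret graph UNIV "p_Q \<alpha> \<beta>" "q_Q \<alpha> \<beta>" by (rule graph_Q) simp
  show ?thesis
    by unfold_locales (simp_all add: dirD_p_Q dirD_q_Q graph1_def graph2_def Qf_def)
qed

lemma relations_P:
  assumes "generic_graph (p_P \<xi> \<epsilon>) (\<lambda>u. u $ 1) \<Omega>"
    and g: "g \<in> fluxes 0 (graph_frame (p_P \<xi> \<epsilon>) (\<lambda>u. u $ 1))"
  obtains m0 a0 b0 w1 w2 Sb :: real where
    "generic_frame.germ_jet 0 (graph_frame (p_P \<xi> \<epsilon>) (\<lambda>u. u $ 1)) 0 g = 2 * m0"
    "generic_frame.germ_jet 0 (graph_frame (p_P \<xi> \<epsilon>) (\<lambda>u. u $ 1)) 1 g = 2 * b0"
    "generic_frame.germ_jet 0 (graph_frame (p_P \<xi> \<epsilon>) (\<lambda>u. u $ 1)) 2 g = - 2 * a0"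
    "generic_frame.germ_jet 0 (graph_frame (p_P \<xi> \<epsilon>) (\<lambda>u. u $ 1)) 3 g = 2 * w1"
    "3 * w1 = w2" "4 * w1 - 2 * w2 = 2 * \<xi> * a0"
    "4 * w1 - 4 * w2 = 6 * \<xi> * a0 + 4 * b0 - 2 * \<xi> * m0"
    "14 * \<xi> * w1 - 4 * \<xi> * w2 + 24 * Sb
      = 10 * (\<xi> * \<xi>) * a0 - 4 * \<epsilon> * a0 - 2 * \<xi> * (3 * b0 - \<xi> * m0)"
    "- 4 * \<xi> * w1 + 2 * \<xi> * (w1 - w2) - 20 * Sb = 0"
    "- 2 * \<xi> * w1 + 3 * \<xi> * (w1 - w2) - 28 * Sb = 0"
proof -
  interpret generic_graph "p_P \<xi> \<epsilon>" "\<lambda>u. u $ 1" \<Omega> by fact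
  obtain V f l1 l2 where G: "graph_flux V (p_P \<xi> \<epsilon>) (\<lambda>u. u $ 1) f l1 l2" and V: "0 \<in> V" "V \<subseteq> \<Omega>"
    and j: "germ_jet 0 g = graph_flux.m (p_P \<xi> \<epsilon>) (\<lambda>u. u $ 1) f l1 0 - graph_flux.m' (p_P \<xi> \<epsilon>) (\<lambda>u. u $ 1) f l2 0"
    "germ_jet 1 g = c 0 * graph_flux.b f 0" "germ_jet 2 g = - c 0 * graph_flux.a f 0"
    "germ_jet 3 g = c 0 * graph_flux.w1 (p_P \<xi> \<epsilon>) f 0"
    by (rule flux_jetsE[OF g]) blast
  interpret gf: graph_flux V "p_P \<xi> \<epsilon>" "\<lambda>u. u $ 1" f l1 l2 by fact
  interpret P_flux V \<xi> \<epsilon> f l1 l2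
  proof
    fix u assume "u \<in> V"
    then have "u \<in> \<Omega>" using V by blast
    from nonzero_on_\<Omega>[OF this] show "Pf \<xi> u \<noteq> 0" "Pf \<xi> u \<noteq> 1"
      by (auto simp: c_def dirD_p_P dirD_nth graph1_def graph2_def)
  qed
  have P0: "Pf \<xi> 0 = -1" by (simp add: Pf_def)
  have c0: "c 0 = 2" using D_pq(5)[of 0] P0 by simp
  show thesis
    by (rule that[of "gf.m 0" "gf.b 0" "gf.a 0" "gf.w1 0" "gf.w2 0" "DS gf.b 0"])
       (use j c0 m'[OF V(1)] P0 relations_origin[OF V(1)] in auto)
qed

lemma relations_Q:
  assumes "generic_graph (p_Q \<alpha> \<beta>) (q_Q \<alpha> \<beta>) \<Omega>"
    and g: "g \<in> fluxes 0 (graph_frame (p_Q \<alpha> \<beta>) (q_Q \<alpha> \<beta>))"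
  obtains m0 a0 b0 w1 Sb Sm :: real where
    "generic_frame.germ_jet 0 (graph_frame (p_Q \<alpha> \<beta>) (q_Q \<alpha> \<beta>)) 0 g = 2 * m0"
    "generic_frame.germ_jet 0 (graph_frame (p_Q \<alpha> \<beta>) (q_Q \<alpha> \<beta>)) 1 g = 2 * b0"
    "generic_frame.germ_jet 0 (graph_frame (p_Q \<alpha> \<beta>) (q_Q \<alpha> \<beta>)) 2 g = - 2 * a0"
    "generic_frame.germ_jet 0 (graph_frame (p_Q \<alpha> \<beta>) (q_Q \<alpha> \<beta>)) 3 g = 2 * w1"
    "2 * Sm = - (\<alpha> * a0)" "2 * \<alpha> * Sm - 6 * Sb = - (2 * \<beta> * a0) - \<alpha> * w1"
    "2 * \<beta> * Sm + 2 * \<beta> * w1 = 11 * \<alpha> * Sb" "(36 * \<beta> + 11 * (\<alpha> * \<alpha>)) * Sb = 0"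
proof -
  interpret generic_graph "p_Q \<alpha> \<beta>" "q_Q \<alpha> \<beta>" \<Omega> by fact
  obtain V f l1 l2 where G: "graph_flux V (p_Q \<alpha> \<beta>) (q_Q \<alpha> \<beta>) f l1 l2" and V: "0 \<in> V" "V \<subseteq> \<Omega>"
    and j: "germ_jet 0 g = graph_flux.m (p_Q \<alpha> \<beta>) (q_Q \<alpha> \<beta>) f l1 0 - graph_flux.m' (p_Q \<alpha> \<beta>) (q_Q \<alpha> \<beta>) f l2 0"
    "germ_jet 1 g = c 0 * graph_flux.b f 0" "germ_jet 2 g = - c 0 * graph_flux.a f 0"
    "germ_jet 3 g = c 0 * graph_flux.w1 (p_Q \<alpha> \<beta>) f 0"
    by (rule flux_jetsE[OF g]) blast
  interpret gf: graph_flux V "p_Q \<alpha> \<beta>" "q_Q \<alpha> \<beta>" f l1 l2 by fact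
  interpret Q_flux V \<alpha> \<beta> f l1 l2
  proof
    fix u assume "u \<in> V"
    then have "u \<in> \<Omega>" using V by blast
    from nonzero_on_\<Omega>(1)[OF this] show "Qf \<alpha> \<beta> u \<noteq> 0" by (simp add: dirD_q_Q graph1_def)
  qed
  have c0: "c 0 = 2" using D_pq(5)[of 0] by (simp add: Qf_def)
  show thesis
    by (rule that[of "gf.m 0" "gf.b 0" "gf.a 0" "gf.w1 0" "DS gf.m 0" "DS gf.b 0"])
       (use j c0 m'[OF V(1)] relations_origin[OF V(1)] in auto)
qed

lemma realizable_0: "realizable 0"
proof -
  obtain \<Omega> where G: "generic_graph (p_P 1 0) (\<lambda>u. u $ 1) \<Omega>"
    using generic_graphE[OF entire_graph_P] by blast
  interpret generic_graph "p_P 1 0" "\<lambda>u. u $ 1" \<Omega> by (rule G)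
  have "quotient_dim (fluxes 0 r) (trivial_fluxes 0) 0"
  proof (rule quotient_dim_exact)
    fix g and j :: nat assume g: "g \<in> fluxes 0 r" and j: "j < 4"
    show "germ_jet j g = 0"
      \<comment> \<open>The first and the last two relations give \<open>w1 = w2 = Sb = 0\<close>,
        hence \<open>a0 = 0\<close>; the others reduce to \<open>m0 = 2 * b0\<close> and
        \<open>m0 = 3 * b0\<close>.\<close>
      by (rule relations_P[OF G g]) (use j in \<open>auto simp: less_4_cases\<close>)
  qed auto
  then show ?thesis using G unfolding realizable_def by blast
qed

lemma realizable_1: "realizable 1"
proof -
  obtain \<Omega> where G: "generic_graph (p_P 0 1) (\<lambda>u. u $ 1) \<Omega>"
    using generic_graphE[OF entire_graph_P] by blast
  interpret generic_graph "p_P 0 1" "\<lambda>u. u $ 1" \<Omega> by (rule G)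
  \<comment> \<open>The choice \<open>a = b = e = 0\<close>, \<open>m = 1\<close>; then
    \<open>m' = P * m\<close> makes \<open>P\<close> the second eigenvalue.\<close>
  obtain g0 where g0: "g0 \<in> fluxes 0 r" "germ_jet 0 g0 = 2"
    using explicit_graph_flux_exists[of "\<lambda>u. u $ 1" "\<lambda>u. u $ 2 * u $ 2 - u $ 2"
      "\<lambda>u. u $ 1 * (u $ 2 * u $ 2) - u $ 1 * u $ 2 + u $ 1 * (u $ 1 * u $ 1) / 3" "\<lambda>u. 1" "\<lambda>u. 2 * u $ 2 - 1"]
    by (auto simp: poly_rules p_P_def algebra_simps)
  have "quotient_dim (fluxes 0 r) (trivial_fluxes 0) 1"
  proof (rule quotient_dim_exact[of _ "\<lambda>_. g0"])
    fix g and j :: nat assume g: "g \<in> fluxes 0 r" and 0: "\<And>j. j < 1 \<Longrightarrow> germ_jet j g = 0" and j: "j < 4"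
    show "germ_jet j g = 0"
      \<comment> \<open>For \<open>\<xi> = 0\<close> only \<open>m0\<close> stays free;
        \<open>\<epsilon> = 1\<close> turns \<open>Sb = 0\<close> into
        \<open>a0 = 0\<close>.\<close>
      by (rule relations_P[OF G g]) (use j 0[of 0] in \<open>auto simp: less_4_cases\<close>)
  qed (use g0 in auto)
  then show ?thesis using G unfolding realizable_def by blast
qed

text \<open>Constant eigenvalues 1 and -1 are the simplest pair with \<open>m' = - m\<close>; no
  component depends on the third coordinate, so \<open>a = b = e = 0\<close>.\<close>

lemma Q_flux_0:
  assumes "generic_graph (p_Q \<alpha> \<beta>) (q_Q \<alpha> \<beta>) \<Omega>"
  obtains g where "g \<in> fluxes 0 (graph_frame (p_Q \<alpha> \<beta>) (q_Q \<alpha> \<beta>))"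
    "generic_frame.germ_jet 0 (graph_frame (p_Q \<alpha> \<beta>) (q_Q \<alpha> \<beta>)) 0 g = 2"
proof -
  interpret generic_graph "p_Q \<alpha> \<beta>" "q_Q \<alpha> \<beta>" \<Omega> by fact
  show thesis
    using explicit_graph_flux_exists[of "\<lambda>u. u $ 1" "\<lambda>u. - u $ 2" "\<lambda>u. - (q_Q \<alpha> \<beta> u * u $ 2)" "\<lambda>u. 1" "\<lambda>u. - 1"] that
    by (auto simp: poly_rules p_Q_def)
qed

text \<open>Built from \<open>a = 0\<close>, \<open>b = 1\<close>: \<open>D1m_Q\<close> becomes
  \<open>D1 m = - 3 * Q\<close>, solved by \<open>m = - 3 * q_Q\<close>. A third component free of
  the third coordinate gives \<open>e = - q_Q\<close>, hence the eigenvalues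
  \<open>- 4 * q_Q\<close> and \<open>2 * q_Q\<close>.\<close>

lemma Q_flux_1:
  assumes "generic_graph (p_Q \<alpha> \<beta>) (q_Q \<alpha> \<beta>) \<Omega>"
  obtains g where "g \<in> fluxes 0 (graph_frame (p_Q \<alpha> \<beta>) (q_Q \<alpha> \<beta>))"
    "generic_frame.germ_jet 0 (graph_frame (p_Q \<alpha> \<beta>) (q_Q \<alpha> \<beta>)) 0 g = 0"
    "generic_frame.germ_jet 0 (graph_frame (p_Q \<alpha> \<beta>) (q_Q \<alpha> \<beta>)) 1 g = 2"
proof -
  interpret generic_graph "p_Q \<alpha> \<beta>" "q_Q \<alpha> \<beta>" \<Omega> by fact
  have "\<exists>g\<in>fluxes 0 r. germ_jet 0 g = - 4 * q_Q \<alpha> \<beta> 0 - 2 * q_Q \<alpha> \<beta> 0 \<and> germ_jet 1 g = D1 (\<lambda>u. 2 * q_Q \<alpha> \<beta> u) 0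
    \<and> germ_jet 2 g = D2 (\<lambda>u. - 4 * q_Q \<alpha> \<beta> u) 0 \<and> germ_jet 3 g = c 0 * DS (\<lambda>u. - 4 * q_Q \<alpha> \<beta> u) 0"
    by (rule explicit_graph_flux_exists[of "\<lambda>u. - 2 * (u $ 1 * u $ 1) - 2 * \<alpha> * (u $ 1 * (u $ 1 * u $ 1)) / 3
          - \<beta> * (u $ 1 * (u $ 1 * (u $ 1 * u $ 1))) / 3" "\<lambda>u. u $ 3 + q_Q \<alpha> \<beta> u * u $ 2"
          "\<lambda>u. 2 * q_Q \<alpha> \<beta> u * q_Q \<alpha> \<beta> u * u $ 2"])
       (simp_all add: poly_rules p_Q_def, simp_all add: q_Q_def Qf_def field_simps)
  then show thesis
    using that by (auto simp: poly_rules) (auto simp: q_Q_def Qf_def)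
qed

lemma realizable_2: "realizable 2"
proof -
  obtain \<Omega> where G: "generic_graph (p_Q 0 1) (q_Q 0 1) \<Omega>"
    using generic_graphE[OF entire_graph_Q] by blast
  interpret generic_graph "p_Q 0 1" "q_Q 0 1" \<Omega> by (rule G)
  obtain g0 where g0: "g0 \<in> fluxes 0 r" "germ_jet 0 g0 = 2" by (rule Q_flux_0[OF G])
  obtain g1 where g1: "g1 \<in> fluxes 0 r" "germ_jet 0 g1 = 0" "germ_jet 1 g1 = 2" by (rule Q_flux_1[OF G])
  have "quotient_dim (fluxes 0 r) (trivial_fluxes 0) 2"
  proof (rule quotient_dim_exact[of _ "\<lambda>i. if i = 0 then g0 else g1"])
    fix g and j :: nat assume g: "g \<in> fluxes 0 r" and 0: "\<And>j. j < 2 \<Longrightarrow> germ_jet j g = 0" and j: "j < 4"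
    show "germ_jet j g = 0"
      \<comment> \<open>Here \<open>Sb = 0\<close> by the last relation, so the second gives
        \<open>a0 = 0\<close>; the first and third give \<open>Sm = 0\<close> and
        \<open>w1 = 0\<close>.\<close>
      by (rule relations_Q[OF G g]) (use j 0[of 0] 0[of 1] in \<open>auto simp: less_4_cases\<close>)
  qed (use g0 g1 in \<open>auto simp: less_2_cases_iff\<close>)
  then show ?thesis using G unfolding realizable_def by blast
qed

lemma realizable_3: "realizable 3"
proof -
  obtain \<Omega> where G: "generic_graph (p_Q 2 0) (q_Q 2 0) \<Omega>"
    using generic_graphE[OF entire_graph_Q] by blast
  interpret generic_graph "p_Q 2 0" "q_Q 2 0" \<Omega> by (rule G)
  obtain g0 where g0: "g0 \<in> fluxes 0 r" "germ_jet 0 g0 = 2" by (rule Q_flux_0[OF G])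
  obtain g1 where g1: "g1 \<in> fluxes 0 r" "germ_jet 0 g1 = 0" "germ_jet 1 g1 = 2" by (rule Q_flux_1[OF G])
  let ?q = "q_Q 2 0" and ?Q = "Qf 2 0"
  have Q2: "?Q u * ?Q u = 1 + 4 * ?q u" for u
    by (simp add: Qf_def q_Q_def algebra_simps)
  \<comment> \<open>Here \<open>relation5\<close> forces \<open>DS b = 0\<close>; \<open>QSm\<close>
    and \<open>relation3\<close> then give \<open>D1 a = 2 * a / Q\<close>, solved by
    \<open>a = Q\<close>. By \<open>Sm\<close> this means \<open>w2 = 4\<close>, whence
    \<open>b = 4 * u $ 2\<close>.\<close>
  let ?l1 = "\<lambda>u. 2 * u $ 3 - 2 * (?q u * u $ 2) - 2 * ((1 + 4 * ?q u) * u $ 2)"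
  let ?l2 = "\<lambda>u. 4 * u $ 3 + 12 * (?q u * u $ 2) + 4 * u $ 2"
  have "\<exists>g\<in>fluxes 0 r. germ_jet 0 g = ?l1 0 - ?l2 0 \<and> germ_jet 1 g = D1 ?l2 0 \<and> germ_jet 2 g = D2 ?l1 0
    \<and> germ_jet 3 g = c 0 * DS ?l1 0"
  proof (rule explicit_graph_flux_exists[of "\<lambda>u. ?Q u * (u $ 3 - ?q u * u $ 2)"
        "\<lambda>u. 4 * (u $ 2 * u $ 3) + 4 * (?q u * (u $ 2 * u $ 2)) + 2 * (u $ 2 * u $ 2)"
        "\<lambda>u. 3 * (u $ 3 * u $ 3) / 2 + ?q u * (u $ 2 * u $ 3) + 11 * (?q u * (?q u * (u $ 2 * u $ 2))) / 2
            + 2 * (?q u * (u $ 2 * u $ 2))"])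
    fix u
    show "D1 (\<lambda>u. ?Q u * (u $ 3 - ?q u * u $ 2)) u = ?l1 u"
      unfolding Q2[symmetric] by (simp add: poly_rules dirD_Qf p_Q_def Qf_def algebra_simps)
    show "D1 (\<lambda>u. 3 * (u $ 3 * u $ 3) / 2 + ?q u * (u $ 2 * u $ 3) + 11 * (?q u * (?q u * (u $ 2 * u $ 2))) / 2
            + 2 * (?q u * (u $ 2 * u $ 2))) u = ?l1 u * p_Q 2 0 u"
      by (simp add: poly_rules p_Q_def) (simp add: Qf_def algebra_simps q_Q_def)
  qed (simp_all add: poly_rules dirD_Qf p_Q_def algebra_simps)
  then obtain g2 where g2: "g2 \<in> fluxes 0 r" "germ_jet 0 g2 = 0" "germ_jet 1 g2 = 0" "germ_jet 2 g2 = - 2"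
    by (auto simp: poly_rules p_Q_def[of _ _ 0] q_Q_def[of _ _ 0])
  have "quotient_dim (fluxes 0 r) (trivial_fluxes 0) 3"
  proof (rule quotient_dim_exact[of _ "\<lambda>i. if i = 0 then g0 else if i = 1 then g1 else g2"])
    fix g and j :: nat assume g: "g \<in> fluxes 0 r" and 0: "\<And>j. j < 3 \<Longrightarrow> germ_jet j g = 0" and j: "j < 4"
    show "germ_jet j g = 0"
      by (rule relations_Q[OF G g]) (use j 0[of 0] 0[of 1] 0[of 2] in \<open>auto simp: less_4_cases\<close>)
  qed (use g0 g1 g2 in \<open>auto simp: numeral_3_eq_3 numeral_2_eq_2 less_Suc_eq\<close>)
  then show ?thesis using G unfolding realizable_def by blast
qed

text \<open>The fields span the standard contact structure of the Heisenberg group. Four triangular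
  fluxes attain the general bound.\<close>

lemma realizable_4: "realizable 4"
proof -
  obtain \<Omega> where G: "generic_graph (p_Q 0 0) (q_Q 0 0) \<Omega>"
    using generic_graphE[OF entire_graph_Q] by blast
  interpret generic_graph "p_Q 0 0" "q_Q 0 0" \<Omega> by (rule G)
  obtain g0 where g0: "g0 \<in> fluxes 0 r" "germ_jet 0 g0 = 2" by (rule Q_flux_0[OF G])
  obtain g1 where g1: "g1 \<in> fluxes 0 r" "germ_jet 0 g1 = 0" "germ_jet 1 g1 = 2" by (rule Q_flux_1[OF G])
  have pq: "p_Q 0 0 = (\<lambda>u. - u $ 2)" "q_Q 0 0 = (\<lambda>u. u $ 1)"
    by (simp_all add: p_Q_def q_Q_def Qf_def fun_eq_iff)
  have c0: "c 0 = 2" by (simp add: c_def dirD_p_Q dirD_q_Q Qf_def graph1_def graph2_def)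
  obtain g2 where g2: "g2 \<in> fluxes 0 r" "germ_jet 0 g2 = 0" "germ_jet 1 g2 = 0" "germ_jet 2 g2 = - 2"
    using explicit_graph_flux_exists[of "\<lambda>u. u $ 3 - u $ 1 * u $ 2" "\<lambda>u. 2 * (u $ 2 * u $ 2)"
      "\<lambda>u. 2 * (u $ 1 * (u $ 2 * u $ 2))" "\<lambda>u. - 2 * u $ 2" "\<lambda>u. 4 * u $ 2"]
    by (auto simp: poly_rules pq)
  \<comment> \<open>\<open>QSm\<close> and \<open>Sm\<close> give \<open>w1 = w2\<close>, so
    \<open>w1 = 1\<close> is realized by \<open>a = u $ 1\<close> and \<open>b = u $ 2\<close>;
    \<open>g2\<close> has \<open>a = 1\<close> and \<open>b = 0\<close>.\<close>
  obtain g3 where g3: "g3 \<in> fluxes 0 r" "germ_jet 0 g3 = 0" "germ_jet 1 g3 = 0" "germ_jet 2 g3 = 0" "germ_jet 3 g3 = 2"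
    using explicit_graph_flux_exists[of "\<lambda>u. u $ 1 * u $ 3 - u $ 1 * (u $ 1 * u $ 2)" "\<lambda>u. u $ 2 * u $ 3 + u $ 1 * (u $ 2 * u $ 2)"
      "\<lambda>u. u $ 3 * u $ 3 / 2 + 3 * (u $ 1 * (u $ 1 * (u $ 2 * u $ 2))) / 2"
      "\<lambda>u. u $ 3 - 3 * (u $ 1 * u $ 2)" "\<lambda>u. u $ 3 + 3 * (u $ 1 * u $ 2)"]
    by (auto simp: poly_rules pq c0[unfolded pq] algebra_simps)
  have "quotient_dim (fluxes 0 r) (trivial_fluxes 0) 4"
    by (rule quotient_dim_exact[of _ "\<lambda>i. if i = 0 then g0 else if i = 1 then g1 else if i = 2 then g2 else g3"])
       (use g0 g1 g2 g3 in \<open>auto simp: less_4_cases eval_nat_numeral less_Suc_eq\<close>)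
  then show ?thesis using G unfolding realizable_def by blast
qed

theorem theorem6p2:
  shows
    "(\<forall>(p::real^3) \<Omega> U (r :: nat \<Rightarrow> vfield).
        open \<Omega> \<and> p \<in> \<Omega> \<and> partial_frame_on \<Omega> {1,2} r \<and>
        lie_bracket (r 1) (r 2) p \<notin> span {r 1 p, r 2 p} \<and>
        nabla (r 1) (r 2) p \<notin> span {r 1 p, r 2 p} \<and>
        nabla (r 2) (r 1) p \<notin> span {r 1 p, r 2 p} \<and>
        open U \<and> p \<in> U \<and> partial_frame_on U {1..3} r \<and>
        christoffel r 2 2 3 p * christoffel r 1 1 3 p
          - 9 * christoffel r 1 2 3 p * christoffel r 2 1 3 p \<noteq> 0
        \<longrightarrow> (\<exists>k. 0 \<le> k \<and> k \<le> 4 \<and> quotient_dim (fluxes p r) (trivial_fluxes p) k)) \<and>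
     (\<forall>k\<in>{0..4}. \<exists>(p::real^3) \<Omega> U (r :: nat \<Rightarrow> vfield).
        open \<Omega> \<and> p \<in> \<Omega> \<and> partial_frame_on \<Omega> {1,2} r \<and>
        lie_bracket (r 1) (r 2) p \<notin> span {r 1 p, r 2 p} \<and>
        nabla (r 1) (r 2) p \<notin> span {r 1 p, r 2 p} \<and>
        nabla (r 2) (r 1) p \<notin> span {r 1 p, r 2 p} \<and>
        open U \<and> p \<in> U \<and> partial_frame_on U {1..3} r \<and>
        christoffel r 2 2 3 p * christoffel r 1 1 3 p
          - 9 * christoffel r 1 2 3 p * christoffel r 2 1 3 p \<noteq> 0 \<and>
        quotient_dim (fluxes p r) (trivial_fluxes p) k)"
proof (intro conjI allI impI ballI)
  fix p :: "real^3" and \<Omega> U and r :: "nat \<Rightarrow> vfield"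
  assume h: "open \<Omega> \<and> p \<in> \<Omega> \<and> partial_frame_on \<Omega> {1,2} r \<and>
        lie_bracket (r 1) (r 2) p \<notin> span {r 1 p, r 2 p} \<and>
        nabla (r 1) (r 2) p \<notin> span {r 1 p, r 2 p} \<and>
        nabla (r 2) (r 1) p \<notin> span {r 1 p, r 2 p} \<and>
        open U \<and> p \<in> U \<and> partial_frame_on U {1..3} r \<and>
        christoffel r 2 2 3 p * christoffel r 1 1 3 p
          - 9 * christoffel r 1 2 3 p * christoffel r 2 1 3 p \<noteq> 0"
  then obtain \<Omega>' where "generic_frame p r \<Omega>'"
    using generic_frame_neighborhood[of \<Omega> p r U] by blast
  then show "\<exists>k\<ge>0. k \<le> 4 \<and> quotient_dim (fluxes p r) (trivial_fluxes p) k"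
    using generic_frame.quotient_dim_fluxes_le_4 by blast
next
  fix k :: nat assume "k \<in> {0..4}"
  then have "k = 0 \<or> k = 1 \<or> k = 2 \<or> k = 3 \<or> k = 4" by auto
  then have "realizable k"
    using realizable_0 realizable_1 realizable_2 realizable_3 realizable_4 by blast
  then obtain p q \<Omega> where G: "generic_graph p q \<Omega>"
    and k: "quotient_dim (fluxes 0 (graph_frame p q)) (trivial_fluxes 0) k"
    unfolding realizable_def by blast
  interpret generic_graph p q \<Omega> by (rule G)
  show "\<exists>(p::real^3) \<Omega> U (r :: nat \<Rightarrow> vfield).
        open \<Omega> \<and> p \<in> \<Omega> \<and> partial_frame_on \<Omega> {1,2} r \<and>
        lie_bracket (r 1) (r 2) p \<notin> span {r 1 p, r 2 p} \<and>
        nabla (r 1) (r 2) p \<notin> span {r 1 p, r 2 p} \<and>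
        nabla (r 2) (r 1) p \<notin> span {r 1 p, r 2 p} \<and>
        open U \<and> p \<in> U \<and> partial_frame_on U {1..3} r \<and>
        christoffel r 2 2 3 p * christoffel r 1 1 3 p
          - 9 * christoffel r 1 2 3 p * christoffel r 2 1 3 p \<noteq> 0 \<and>
        quotient_dim (fluxes p r) (trivial_fluxes p) k"
    by (rule exI[of _ 0], rule exI[of _ UNIV], rule exI[of _ UNIV], rule exI[of _ r])
       (use hypotheses partial_frame k in blast)
qed

end
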